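(* Let $G$ be any group acting topologically properly by automorphisms on a product of $k$ simplicial trees (which need not be locally finite). Then either a finite index subgroup of $G$ has an action of general type on one of these trees (so that $G$ contains the free group $F_2$), or $G$ has a finite index subgroup $H$ with a normal subgroup $K$ of $H$ which is locally finite and such that $H/K\cong\mathbb{Z}^n$ for some $0\le n\le k$. In particular, if $G$ contains no subgroup which is infinite but locally finite, or even if $G$ contains no locally finite, infinite subgroup having a normaliser of finite index in $G$, then either $F_2\le G$ or $G$ is virtually $\mathbb{Z}^n$ for some $n$.
   Context: A product $X=T_1\times\cdots\times T_k$ of trees is regarded as a $k$-dimensional (cube) complex with the product cell structure, and automorphisms are combinatorial automorphisms of this complex; some finite index subgroup of $G$ preserves the factors and hence acts by graph automorphisms on each $T_i$ (the actions on single trees in the statement are of this kind). Acting topologically properly means that for every compact $C\subseteq X$ the set $\{g\in G: g(C)\cap C\ne\emptyset\}$ is finite; for actions by automorphisms this is equivalent to every vertex of $X$ having finite stabiliser. A group is locally finite if every finitely generated subgroup is finite. An action on a tree (or hyperbolic space) $T$ is of general type if its limit set in $\partial T$ is infinite and there are two loxodromic elements with disjoint limit sets (pairs of endpoints in $\partial T$). *)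

theory Defs
  imports
    "HOL-Analysis.Function_Topology"
    "HOL-Algebra.Group_Action"
    "HOL-Algebra.Generated_Groups"
    "HOL-Algebra.Product_Groups"
begin

record 'v sgraph =
  verts :: "'v set"
  adj :: "'v \<Rightarrow> 'v \<Rightarrow> bool"

definition simple_graph :: "'v sgraph \<Rightarrow> bool" where
  "simple_graph T \<longleftrightarrow>
     (\<forall>u v. adj T u v \<longrightarrow> u \<in> verts T \<and> v \<in> verts T \<and> u \<noteq> v \<and> adj T v u)"

definition walk :: "'v sgraph \<Rightarrow> 'v \<Rightarrow> 'v list \<Rightarrow> 'v \<Rightarrow> bool" where
  "walk T u p v \<longleftrightarrow>
     p \<noteq> [] \<and> set p \<subseteq> verts T \<and> successively (adj T) p \<and> hd p = u \<and> last p = v"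

definition cycle :: "'v sgraph \<Rightarrow> 'v list \<Rightarrow> bool" where
  "cycle T p \<longleftrightarrow>
     length p \<ge> 3 \<and> distinct p \<and> walk T (hd p) p (last p) \<and> adj T (last p) (hd p)"

definition tree :: "'v sgraph \<Rightarrow> bool" where
  "tree T \<longleftrightarrow> simple_graph T \<and> verts T \<noteq> {} \<and>
     (\<forall>u\<in>verts T. \<forall>v\<in>verts T. \<exists>p. walk T u p v) \<and> (\<nexists>p. cycle T p)"

definition graph_automorphism :: "'v sgraph \<Rightarrow> ('v \<Rightarrow> 'v) \<Rightarrow> bool" where
  "graph_automorphism T f \<longleftrightarrow> bij_betw f (verts T) (verts T) \<and>
     (\<forall>u\<in>verts T. \<forall>v\<in>verts T. adj T (f u) (f v) \<longleftrightarrow> adj T u v)"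

definition gdist :: "'v sgraph \<Rightarrow> 'v \<Rightarrow> 'v \<Rightarrow> nat" where
  "gdist T u v = (LEAST n. \<exists>p. walk T u p v \<and> length p = Suc n)"

text \<open>A cell (vertex or edge) is represented by its set of vertices, and a point of the
  geometric realisation by its barycentric coordinates.\<close>

definition tree_cells :: "'v sgraph \<Rightarrow> 'v set set" where
  "tree_cells T = {{v} | v. v \<in> verts T} \<union> {{u, v} | u v. adj T u v}"

definition tree_points :: "'v sgraph \<Rightarrow> ('v \<Rightarrow> real) set" where
  "tree_points T =
     {x. (\<forall>v. 0 \<le> x v) \<and> {v. x v \<noteq> 0} \<in> tree_cells T \<and> (\<Sum>v | x v \<noteq> 0. x v) = 1}"

text \<open>The factors are \<open>T 0, \<dots>, T (k - 1)\<close>.\<close>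

definition prod_verts :: "nat \<Rightarrow> (nat \<Rightarrow> 'v sgraph) \<Rightarrow> (nat \<Rightarrow> 'v) set" where
  "prod_verts k T = (\<Pi>\<^sub>E i\<in>{..<k}. verts (T i))"

definition prod_cells :: "nat \<Rightarrow> (nat \<Rightarrow> 'v sgraph) \<Rightarrow> (nat \<Rightarrow> 'v) set set" where
  "prod_cells k T =
     {(\<Pi>\<^sub>E i\<in>{..<k}. s i) | s. \<forall>i<k. s i \<in> tree_cells (T i)}"

definition prod_points :: "nat \<Rightarrow> (nat \<Rightarrow> 'v sgraph) \<Rightarrow> (nat \<Rightarrow> 'v \<Rightarrow> real) set" where
  "prod_points k T = (\<Pi>\<^sub>E i\<in>{..<k}. tree_points (T i))"

text \<open>Faces of a cube are the cells contained in it, so a bijection on the vertices that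
  permutes the cells also preserves the face relation and the dimension of cells. It may
  permute the factors.\<close>

definition cube_automorphism ::
    "nat \<Rightarrow> (nat \<Rightarrow> 'v sgraph) \<Rightarrow> ((nat \<Rightarrow> 'v) \<Rightarrow> nat \<Rightarrow> 'v) \<Rightarrow> bool" where
  "cube_automorphism k T f \<longleftrightarrow>
     bij_betw f (prod_verts k T) (prod_verts k T) \<and>
     bij_betw ((`) f) (prod_cells k T) (prod_cells k T)"

text \<open>The homeomorphism of the realisation induced by a cube automorphism. A point \<open>x\<close> of a cube
  is the barycentre of its vertices \<open>v\<close> with weights \<open>\<Prod>i<k. x i (v i)\<close>; the image point is
  the barycentre of the vertices \<open>f v\<close> with the same weights, and its \<open>j\<close>-th
  component is the \<open>j\<close>-th marginal of these weights.\<close>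

definition realise ::
    "nat \<Rightarrow> ((nat \<Rightarrow> 'v) \<Rightarrow> nat \<Rightarrow> 'v) \<Rightarrow> (nat \<Rightarrow> 'v \<Rightarrow> real) \<Rightarrow> (nat \<Rightarrow> 'v \<Rightarrow> real)" where
  "realise k f x =
     (\<lambda>j\<in>{..<k}. \<lambda>u.
        \<Sum>v | v \<in> (\<Pi>\<^sub>E i\<in>{..<k}. {w. x i w \<noteq> 0}) \<and> f v j = u. \<Prod>i<k. x i (v i))"

text \<open>Here \<^const>\<open>compact\<close> refers to the topology of coordinatewise convergence. On the
  realisation of a graph it is the topology of the path metric with edges of length one, even
  if the graph is not locally finite: for \<open>0 < e < 1\<close> the ball of radius \<open>e\<close> around a
  vertex \<open>v\<close> is given by \<open>x v > 1 - e\<close>. Hence it is the metric topology on the product.\<close>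

definition topologically_proper ::
    "('g, 'm) monoid_scheme \<Rightarrow> nat \<Rightarrow> (nat \<Rightarrow> 'v sgraph) \<Rightarrow>
     ('g \<Rightarrow> (nat \<Rightarrow> 'v) \<Rightarrow> nat \<Rightarrow> 'v) \<Rightarrow> bool" where
  "topologically_proper G k T \<phi> \<longleftrightarrow>
     (\<forall>C. C \<subseteq> prod_points k T \<and> compact C \<longrightarrow>
        finite {g \<in> carrier G. realise k (\<phi> g) ` C \<inter> C \<noteq> {}})"

definition gromov_product :: "'v sgraph \<Rightarrow> 'v \<Rightarrow> 'v \<Rightarrow> 'v \<Rightarrow> real" where
  "gromov_product T b u v = (real (gdist T b u) + real (gdist T b v) - real (gdist T u v)) / 2"

definition gromov_related :: "'v sgraph \<Rightarrow> (nat \<Rightarrow> 'v) \<Rightarrow> (nat \<Rightarrow> 'v) \<Rightarrow> bool" where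
  "gromov_related T x y \<longleftrightarrow>
     (\<forall>b\<in>verts T. filterlim (\<lambda>(m, n). gromov_product T b (x m) (y n)) at_top
        (sequentially \<times>\<^sub>F sequentially))"

definition converging_seqs :: "'v sgraph \<Rightarrow> (nat \<Rightarrow> 'v) set" where
  "converging_seqs T = {x. range x \<subseteq> verts T \<and> gromov_related T x x}"

text \<open>The Gromov boundary of the vertex set, which is that of the realisation, as it is
  coarsely dense and isometrically embedded there.\<close>

definition boundary :: "'v sgraph \<Rightarrow> (nat \<Rightarrow> 'v) set set" where
  "boundary T = converging_seqs T //
     {(x, y). x \<in> converging_seqs T \<and> y \<in> converging_seqs T \<and> gromov_related T x y}"

text \<open>The choice of the orbit, that is of \<open>v\<close>, is irrelevant.\<close>

definition limit_set ::
    "('g, 'm) monoid_scheme \<Rightarrow> 'v sgraph \<Rightarrow> ('g \<Rightarrow> 'v \<Rightarrow> 'v) \<Rightarrow> (nat \<Rightarrow> 'v) set set" where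
  "limit_set H T \<psi> =
     {\<xi> \<in> boundary T. \<exists>v\<in>verts T. \<exists>x\<in>\<xi>. range x \<subseteq> orbit H \<psi> v}"

definition elt_limit_set ::
    "('g, 'm) monoid_scheme \<Rightarrow> 'v sgraph \<Rightarrow> ('g \<Rightarrow> 'v \<Rightarrow> 'v) \<Rightarrow> 'g \<Rightarrow> (nat \<Rightarrow> 'v) set set" where
  "elt_limit_set H T \<psi> g = limit_set (H\<lparr>carrier := generate H {g}\<rparr>) T \<psi>"

definition loxodromic ::
    "('g, 'm) monoid_scheme \<Rightarrow> 'v sgraph \<Rightarrow> ('g \<Rightarrow> 'v \<Rightarrow> 'v) \<Rightarrow> 'g \<Rightarrow> bool" where
  "loxodromic H T \<psi> g \<longleftrightarrow>
     (\<exists>v\<in>verts T. \<exists>l c :: real. l \<ge> 1 \<and> c \<ge> 0 \<and>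
        (\<forall>m n :: int.
           real_of_int \<bar>m - n\<bar> / l - c
             \<le> real (gdist T (\<psi> (g [^]\<^bsub>H\<^esub> m) v) (\<psi> (g [^]\<^bsub>H\<^esub> n) v)) \<and>
           real (gdist T (\<psi> (g [^]\<^bsub>H\<^esub> m) v) (\<psi> (g [^]\<^bsub>H\<^esub> n) v))
             \<le> l * real_of_int \<bar>m - n\<bar> + c))"

definition general_type ::
    "('g, 'm) monoid_scheme \<Rightarrow> 'v sgraph \<Rightarrow> ('g \<Rightarrow> 'v \<Rightarrow> 'v) \<Rightarrow> bool" where
  "general_type H T \<psi> \<longleftrightarrow>
     infinite (limit_set H T \<psi>) \<and>
     (\<exists>g\<in>carrier H. \<exists>h\<in>carrier H. loxodromic H T \<psi> g \<and> loxodromic H T \<psi> h \<and>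
        elt_limit_set H T \<psi> g \<inter> elt_limit_set H T \<psi> h = {})"

definition finite_index :: "'g set \<Rightarrow> ('g, 'm) monoid_scheme \<Rightarrow> bool" where
  "finite_index H G \<longleftrightarrow> subgroup H G \<and> finite (rcosets\<^bsub>G\<^esub> H)"

definition locally_finite :: "'g set \<Rightarrow> ('g, 'm) monoid_scheme \<Rightarrow> bool" where
  "locally_finite K G \<longleftrightarrow> (\<forall>S. S \<subseteq> K \<and> finite S \<longrightarrow> finite (generate G S))"

definition Z_pow :: "nat \<Rightarrow> (nat \<Rightarrow> int) monoid" where
  "Z_pow n = product_group {..<n} (\<lambda>_. integer_group)"

text \<open>The free group on two generators, as the group of reduced words in letters \<open>(x, e)\<close>,
  where \<open>x\<close> is the generator and \<open>e\<close> tells whether it is inverted.\<close>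

type_synonym F2_letter = "bool \<times> bool"

definition inv_letter :: "F2_letter \<Rightarrow> F2_letter" where
  "inv_letter a = (fst a, \<not> snd a)"

definition reduced :: "F2_letter list \<Rightarrow> bool" where
  "reduced w \<longleftrightarrow> successively (\<lambda>a b. b \<noteq> inv_letter a) w"

fun cancel_cons :: "F2_letter \<Rightarrow> F2_letter list \<Rightarrow> F2_letter list" where
  "cancel_cons a [] = [a]"
| "cancel_cons a (b # w) = (if b = inv_letter a then w else a # b # w)"

definition F2 :: "F2_letter list monoid" where
  "F2 = \<lparr>carrier = {w. reduced w}, monoid.mult = foldr cancel_cons, one = []\<rparr>"

definition contains_F2 :: "('g, 'm) monoid_scheme \<Rightarrow> bool" where
  "contains_F2 G \<longleftrightarrow> (\<exists>H. subgroup H G \<and> F2 \<cong> G\<lparr>carrier := H\<rparr>)"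

definition factor_actions ::
    "('g, 'm) monoid_scheme \<Rightarrow> 'g set \<Rightarrow> nat \<Rightarrow> (nat \<Rightarrow> 'v sgraph) \<Rightarrow>
     ('g \<Rightarrow> (nat \<Rightarrow> 'v) \<Rightarrow> nat \<Rightarrow> 'v) \<Rightarrow> (nat \<Rightarrow> 'g \<Rightarrow> 'v \<Rightarrow> 'v) \<Rightarrow> bool" where
  "factor_actions G H k T \<phi> \<psi> \<longleftrightarrow>
     (\<forall>i<k. group_action (G\<lparr>carrier := H\<rparr>) (verts (T i)) (\<psi> i) \<and>
            (\<forall>h\<in>H. graph_automorphism (T i) (\<psi> i h)) \<and>
            (\<forall>h\<in>H. \<forall>x\<in>prod_verts k T. \<phi> h x i = \<psi> i h (x i)))"

definition virtually_general_type_on_factor ::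
    "('g, 'm) monoid_scheme \<Rightarrow> nat \<Rightarrow> (nat \<Rightarrow> 'v sgraph) \<Rightarrow>
     ('g \<Rightarrow> (nat \<Rightarrow> 'v) \<Rightarrow> nat \<Rightarrow> 'v) \<Rightarrow> bool" where
  "virtually_general_type_on_factor G k T \<phi> \<longleftrightarrow>
     (\<exists>H \<psi>. finite_index H G \<and> factor_actions G H k T \<phi> \<psi> \<and>
        (\<exists>i<k. general_type (G\<lparr>carrier := H\<rparr>) (T i) (\<psi> i)))"

end

theory Submission
  imports Defs
begin

text \<open>A tree enters the argument only as a metric space with integral distances that satisfies the
  four point condition. Ends are represented by sequences whose Gromov
  products tend to infinity. After restriction to a subgroup of finite index the group preserves
  the factors and has no inversions, so that an element acts on a factor either with a fixed vertex
  or as a translation along an axis. If two translations of a factor have no common end, the action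
  is of general type and ping-pong gives a free subgroup. If any two translations share an end,
  a subgroup of finite index fixes an end, and the Busemann cocycle of this end is a homomorphism to
  \<open>\<int>\<close> whose kernel contains no translation; finitely many elements of the kernel have a common
  fixed vertex. The \<open>k\<close> homomorphisms together have a locally finite kernel, as
  vertex stabilisers of the product are finite, and an image in \<open>\<int>\<^sup>k\<close>. If the kernel is
  finite, all conjugacy classes are finite, so suitable powers of lifts of a basis of the image
  commute and generate a free abelian subgroup of finite index.\<close>

section \<open>Trees as metric spaces\<close>

text \<open>Existence comes instead from minimising natural numbers (the displacement of one
  element, the total displacement of a finite set) and from integer sequences that become constant.
  The four point condition alone does not describe trees: a complete graph satisfies it together
  with \<open>step\<close>. Bipartiteness, here \<open>parity\<close>, excludes this; it also makes
  the parity of the displacement of an automorphism independent of the vertex and a homomorphism to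
  the group of order two, so inversions of edges disappear on a subgroup of index at most two. The
  delicate case is a group whose translations pairwise share an end: a common end is not given in
  advance, and only the dichotomy between exactly one common end and the same pair of ends produces
  a virtually fixed one. The kernel of a Busemann homomorphism may have no common fixed vertex
  although each of its elements has one, which is why it is treated through finite subsets and is
  only locally finite in the end.\<close>

locale tree_metric =
  fixes V :: "'v set" and d :: "'v \<Rightarrow> 'v \<Rightarrow> nat"
  assumes nonempty: "V \<noteq> {}"
    and dist_0: "\<lbrakk>x \<in> V; y \<in> V\<rbrakk> \<Longrightarrow> d x y = 0 \<longleftrightarrow> x = y"
    and dist_sym: "\<lbrakk>x \<in> V; y \<in> V\<rbrakk> \<Longrightarrow> d x y = d y x"
    and triangle: "\<lbrakk>x \<in> V; y \<in> V; z \<in> V\<rbrakk> \<Longrightarrow> d x z \<le> d x y + d y z"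
    and four_point: "\<lbrakk>x \<in> V; y \<in> V; z \<in> V; w \<in> V\<rbrakk> \<Longrightarrow>
      d x y + d z w \<le> max (d x z + d y w) (d x w + d y z)"
    and parity: "\<lbrakk>x \<in> V; y \<in> V; z \<in> V\<rbrakk> \<Longrightarrow> even (d x y + d y z + d x z)"
    and step: "\<lbrakk>x \<in> V; y \<in> V; x \<noteq> y\<rbrakk> \<Longrightarrow> \<exists>z\<in>V. d x z = 1 \<and> d x y = Suc (d z y)"

section \<open>Walks and distances in a tree\<close>

lemma walk_join:
  assumes "walk T u p v" "walk T v q w"
  shows "walk T u (p @ tl q) w"
  using assms unfolding walk_def
  by (cases q) (auto simp: successively_append_iff successively_Cons)

lemma walk_ends:
  assumes "walk T u p v" "length p = Suc n"
  shows "p ! 0 = u" "p ! n = v"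
  using assms unfolding walk_def by (auto simp: hd_conv_nth last_conv_nth)

lemma walk_distinct:
  assumes "walk T u p v"
  shows "\<exists>q. walk T u q v \<and> distinct q \<and> set q \<subseteq> set p"
  using assms
proof (induction "length p" arbitrary: p rule: less_induct)
  case less
  show ?case
  proof (cases "distinct p")
    case True
    then show ?thesis using less.prems by blast
  next
    case False
    then obtain xs ys zs y where p: "p = xs @ [y] @ ys @ [y] @ zs"
      using not_distinct_decomp by blast
    let ?q = "xs @ [y] @ zs"
    have "walk T u ?q v"
      using less.prems unfolding p walk_def
      by (cases xs) (auto simp: successively_append_iff successively_Cons hd_append split: if_splits)
    moreover have "length ?q < length p" and "set ?q \<subseteq> set p"
      by (auto simp: p)
    ultimately show ?thesis using less.hyps by blast
  qed
qed

locale graph_tree =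
  fixes T :: "'v sgraph"
  assumes tree: "tree T"
begin

lemma adjD: "adj T u v \<Longrightarrow> u \<in> verts T \<and> v \<in> verts T \<and> u \<noteq> v \<and> adj T v u"
  using tree unfolding tree_def simple_graph_def by blast

lemma walk_verts: "walk T u p v \<Longrightarrow> u \<in> verts T \<and> v \<in> verts T"
  unfolding walk_def by auto

lemma walk_rev: "walk T u p v \<Longrightarrow> walk T v (rev p) u"
  unfolding walk_def using adjD
  by (auto simp: hd_rev last_rev intro: successively_mono)

lemma gdist_walk:
  assumes "u \<in> verts T" "v \<in> verts T"
  obtains p where "walk T u p v" "length p = Suc (gdist T u v)"
proof -
  obtain q where q: "walk T u q v" using tree assms unfolding tree_def by blast
  then have "length q = Suc (length q - 1)" unfolding walk_def by (cases q) auto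
  with q have "\<exists>n p. walk T u p v \<and> length p = Suc n" by blast
  then have "\<exists>p. walk T u p v \<and> length p = Suc (gdist T u v)"
    unfolding gdist_def by (rule LeastI_ex)
  then show ?thesis using that by blast
qed

lemma gdist_le:
  assumes "walk T u p v"
  shows "Suc (gdist T u v) \<le> length p"
proof -
  obtain n where "length p = Suc n" using assms unfolding walk_def by (cases p) auto
  moreover from this assms have "gdist T u v \<le> n" unfolding gdist_def by (intro Least_le) auto
  ultimately show ?thesis by simp
qed

lemma gdist_sym:
  assumes "u \<in> verts T" "v \<in> verts T"
  shows "gdist T u v = gdist T v u"
proof -
  have "gdist T u v \<le> gdist T v u" if uv: "u \<in> verts T" "v \<in> verts T" for u v
  proof -
    obtain p where "walk T v p u" "length p = Suc (gdist T v u)" using gdist_walk uv by metis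
    then show ?thesis using gdist_le[OF walk_rev] by fastforce
  qed
  then show ?thesis using assms by (simp add: antisym)
qed

lemma gdist_triangle:
  assumes "u \<in> verts T" "v \<in> verts T" "w \<in> verts T"
  shows "gdist T u w \<le> gdist T u v + gdist T v w"
proof -
  obtain p where p: "walk T u p v" "length p = Suc (gdist T u v)" using gdist_walk assms by metis
  obtain q where q: "walk T v q w" "length q = Suc (gdist T v w)" using gdist_walk assms by metis
  show ?thesis using gdist_le[OF walk_join[OF p(1) q(1)]] p q by simp
qed

lemma gdist_0:
  assumes "u \<in> verts T" "v \<in> verts T"
  shows "gdist T u v = 0 \<longleftrightarrow> u = v"
proof
  assume "gdist T u v = 0"
  then obtain p where "walk T u p v" "length p = Suc 0" using gdist_walk assms by metis
  then show "u = v" unfolding walk_def by (cases p) auto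
next
  assume "u = v"
  then have "walk T u [u] v" using assms by (auto simp: walk_def)
  then show "gdist T u v = 0" using gdist_le by fastforce
qed

lemma gdist_adj:
  assumes "adj T u v"
  shows "gdist T u v = 1"
proof -
  have "walk T u [u, v] v" using assms adjD by (auto simp: walk_def)
  then have "gdist T u v \<le> 1" using gdist_le by fastforce
  moreover have "gdist T u v \<noteq> 0" using gdist_0 adjD assms by blast
  ultimately show ?thesis by simp
qed

text \<open>Each section of a shortest walk bounds the distance between its ends from above. The
  bounds for the three sections before, between and after the two indices add up to the whole
  length, so by the triangle inequality none of them is strict.\<close>

lemma walk_gdist:
  assumes p: "walk T u p v" "length p = Suc (gdist T u v)" and ij: "i \<le> j" "j \<le> gdist T u v"
  shows "gdist T (p ! i) (p ! j) = j - i"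
proof -
  have sub: "gdist T (p ! i) (p ! j) \<le> j - i" if "i \<le> j" "j \<le> gdist T u v" for i j
  proof -
    let ?q = "take (Suc j - i) (drop i p)"
    have "set ?q \<subseteq> verts T" using p set_take_subset set_drop_subset
      unfolding walk_def by fast
    moreover have "successively (adj T) ?q" using p that
      unfolding walk_def successively_conv_nth by auto
    moreover have len: "length ?q = Suc (j - i)" using p that by auto
    then have "?q \<noteq> []" "hd ?q = p ! i" "last ?q = p ! j"
      using p that by (auto simp: hd_conv_nth last_conv_nth simp del: length_take length_drop)
    ultimately have "walk T (p ! i) ?q (p ! j)" by (simp add: walk_def)
    from gdist_le[OF this] show ?thesis unfolding len by simp
  qed
  have V: "p ! l \<in> verts T" if "l \<le> gdist T u v" for l
    using p that unfolding walk_def by (auto dest!: nth_mem[of l p])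
  have "p ! 0 = u" "p ! gdist T u v = v"
    using walk_ends[OF p] by auto
  then have "gdist T u v \<le> gdist T (p ! 0) (p ! i) + gdist T (p ! i) (p ! j) + gdist T (p ! j) (p ! gdist T u v)"
    using gdist_triangle[of u "p ! i" v] gdist_triangle[of "p ! i" "p ! j" v] V[of i] V[of j]
      p walk_verts[OF p(1)] ij by auto
  also have "\<dots> \<le> i + gdist T (p ! i) (p ! j) + (gdist T u v - j)"
    using sub[of 0 i] sub[of j "gdist T u v"] ij by auto
  finally show ?thesis using sub[of i j] ij by auto
qed

lemma geodesic:
  assumes "u \<in> verts T" "v \<in> verts T"
  shows "\<exists>\<pi>. \<pi> 0 = u \<and> \<pi> (gdist T u v) = v \<and> (\<forall>i\<le>gdist T u v. \<pi> i \<in> verts T) \<and>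
    (\<forall>i j. i \<le> j \<longrightarrow> j \<le> gdist T u v \<longrightarrow> gdist T (\<pi> i) (\<pi> j) = j - i) \<and>
    (\<forall>i<gdist T u v. adj T (\<pi> i) (\<pi> (Suc i)))"
proof -
  obtain p where p: "walk T u p v" "length p = Suc (gdist T u v)" using gdist_walk assms by metis
  show ?thesis
  proof (intro exI[of _ "\<lambda>i. p ! i"] conjI allI impI)
    show "p ! i \<in> verts T" if "i \<le> gdist T u v" for i
      using p that unfolding walk_def by (auto dest!: nth_mem[of i p])
    show "adj T (p ! i) (p ! Suc i)" if "i < gdist T u v" for i
      using p that unfolding walk_def by (auto simp: successively_conv_nth)
    show "gdist T (p ! i) (p ! j) = j - i" if "i \<le> j" "j \<le> gdist T u v" for i j
      using walk_gdist[OF p that] .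
  qed (rule walk_ends[OF p])+
qed

text \<open>Otherwise a shortest such walk closes up through \<open>v\<close> to a cycle.\<close>

lemma neighbours_separated:
  assumes "adj T v u" "adj T v w" "walk T u p w" "v \<notin> set p"
  shows "u = w"
proof (rule ccontr)
  assume "u \<noteq> w"
  obtain q where q: "walk T u q w" "distinct q" "v \<notin> set q"
    using walk_distinct[OF assms(3)] assms(4) by blast
  have "length q \<ge> 2"
    using q(1) \<open>u \<noteq> w\<close> unfolding walk_def by (cases q; cases "tl q") auto
  then have "cycle T (v # q)"
    using q assms adjD[OF assms(1)] adjD[OF assms(2)] unfolding cycle_def walk_def
    by (auto simp: successively_Cons)
  then show False using tree unfolding tree_def by blast
qed

text \<open>A shortest walk from \<open>b\<close> to a neighbour of \<open>v\<close> that is no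
  farther than \<open>v\<close> cannot pass through \<open>v\<close>. Two such walks, joined at
  \<open>b\<close>, avoid \<open>v\<close>, and \<open>neighbours_separated\<close> identifies their
  ends. The absence of cycles enters the metric theory through this lemma alone.\<close>

lemma neighbour_unique:
  assumes "adj T v u" "adj T v w" "b \<in> verts T"
    and "gdist T b u \<le> gdist T b v" "gdist T b w \<le> gdist T b v"
  shows "u = w"
proof -
  have avoid: "\<exists>p. walk T b p u \<and> v \<notin> set p" if "adj T v u" "gdist T b u \<le> gdist T b v" for u
  proof -
    have "u \<in> verts T" using that(1) adjD by blast
    then obtain p where p: "walk T b p u" "length p = Suc (gdist T b u)"
      using gdist_walk[OF assms(3)] by blast
    have "v \<notin> set p"
    proof
      assume "v \<in> set p"
      then obtain j where j: "j \<le> gdist T b u" "p ! j = v"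
        using p by (metis in_set_conv_nth less_Suc_eq_le)
      have "p ! 0 = b" "p ! gdist T b u = u"
        using walk_ends[OF p] by auto
      then have "gdist T b v = j" "u = v \<or> j \<noteq> gdist T b u"
        using walk_gdist[OF p, of 0 j] j by auto
      then show False using j that adjD by fastforce
    qed
    then show ?thesis using p by blast
  qed
  obtain p where p: "walk T b p u" "v \<notin> set p" using avoid assms by blast
  obtain q where q: "walk T b q w" "v \<notin> set q" using avoid assms by blast
  have "v \<notin> set (rev p @ tl q)" using p q by (auto dest: list.set_sel(2)[rotated] simp: walk_def)
  then show ?thesis
    using neighbours_separated[OF assms(1,2) walk_join[OF walk_rev[OF p(1)] q(1)]] by blast
qed

text \<open>If both ends of the edge were equally far from \<open>b\<close>, then \<open>u\<close>
  and the predecessor of \<open>v\<close> on a geodesic from \<open>b\<close> would be two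
  neighbours as in \<open>neighbour_unique\<close>, hence equal, although the predecessor is
  closer.\<close>

lemma gdist_neighbour:
  assumes "adj T v u" "b \<in> verts T"
  shows "gdist T b u = Suc (gdist T b v) \<or> gdist T b v = Suc (gdist T b u)"
proof -
  have V: "u \<in> verts T" "v \<in> verts T" "u \<noteq> v" "adj T u v" using adjD[OF assms(1)] by auto
  have "gdist T b u \<noteq> gdist T b v"
  proof
    assume eq: "gdist T b u = gdist T b v"
    then have "gdist T b v \<noteq> 0" using V assms gdist_0 by metis
    moreover obtain \<pi> where \<pi>: "\<pi> 0 = b" "\<pi> (gdist T b v) = v"
      "\<And>i. i \<le> gdist T b v \<Longrightarrow> \<pi> i \<in> verts T"
      "\<And>i j. \<lbrakk>i \<le> j; j \<le> gdist T b v\<rbrakk> \<Longrightarrow> gdist T (\<pi> i) (\<pi> j) = j - i"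
      "\<And>i. i < gdist T b v \<Longrightarrow> adj T (\<pi> i) (\<pi> (Suc i))"
      using geodesic[OF assms(2) V(2)] by blast
    ultimately obtain i where i: "gdist T b v = Suc i" by (cases "gdist T b v") auto
    have "adj T v (\<pi> i)" "gdist T b (\<pi> i) = i" using \<pi>(5)[of i] \<pi>(4)[of 0 i] \<pi>(1,2) i adjD by auto
    then have "u = \<pi> i" using neighbour_unique[OF assms(1) _ assms(2)] i eq by simp
    then show False using \<open>gdist T b (\<pi> i) = i\<close> i eq by simp
  qed
  moreover have "gdist T b u \<le> gdist T b v + 1" "gdist T b v \<le> gdist T b u + 1"
    using gdist_triangle[of b v u] gdist_triangle[of b u v] gdist_adj V assms by auto
  ultimately show ?thesis by linarith
qed

text \<open>Once the distance to \<open>z\<close> has gone up, the previous vertex is the one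
  neighbour that is no farther; the next vertex is different from it, so the distance goes up
  again.\<close>

lemma gdist_ascending:
  assumes z: "z \<in> verts T" and V: "\<And>i. i \<le> n \<Longrightarrow> \<pi> i \<in> verts T"
    and adj: "\<And>i. i < n \<Longrightarrow> adj T (\<pi> i) (\<pi> (Suc i))"
    and inj: "\<And>i. Suc (Suc i) \<le> n \<Longrightarrow> \<pi> i \<noteq> \<pi> (Suc (Suc i))"
    and up: "n > 0 \<Longrightarrow> gdist T z (\<pi> 0) \<le> gdist T z (\<pi> (Suc 0))"
    and "i \<le> n"
  shows "gdist T z (\<pi> i) = gdist T z (\<pi> 0) + i"
  using \<open>i \<le> n\<close>
proof (induction i rule: less_induct)
  case (less i)
  consider "i = 0" | "i = Suc 0" | j where "i = Suc (Suc j)" by (metis not0_implies_Suc)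
  then show ?case
  proof cases
    case 2
    then have "adj T (\<pi> 0) (\<pi> (Suc 0))" "n > 0" using adj less.prems by auto
    then show ?thesis using gdist_neighbour[of "\<pi> 0" "\<pi> (Suc 0)" z] z up 2 by simp
  next
    case 3
    then have j: "adj T (\<pi> (Suc j)) (\<pi> j)" "adj T (\<pi> (Suc j)) (\<pi> i)" "\<pi> j \<noteq> \<pi> i"
      using adj[of j] adj[of "Suc j"] inj[of j] adjD[of "\<pi> j" "\<pi> (Suc j)"] less.prems by simp_all
    have IH: "gdist T z (\<pi> j) = gdist T z (\<pi> 0) + j"
      "gdist T z (\<pi> (Suc j)) = gdist T z (\<pi> 0) + Suc j"
      using less.IH[of j] less.IH[of "Suc j"] less.prems 3 by simp_all
    then have "\<not> gdist T z (\<pi> i) \<le> gdist T z (\<pi> (Suc j))"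
      using neighbour_unique[OF j(1,2) z] j(3) by auto
    then show ?thesis using gdist_neighbour[OF j(2) z] IH 3 by auto
  qed auto
qed

text \<open>By \<open>neighbour_unique\<close> the distance to \<open>z\<close> has no local maximum along a geodesic.\<close>

lemma gdist_projection:
  assumes z: "z \<in> verts T" and V: "\<And>i. i \<le> n \<Longrightarrow> \<pi> i \<in> verts T"
    and adj: "\<And>i. i < n \<Longrightarrow> adj T (\<pi> i) (\<pi> (Suc i))"
    and inj: "\<And>i. Suc (Suc i) \<le> n \<Longrightarrow> \<pi> i \<noteq> \<pi> (Suc (Suc i))"
  obtains m where "m \<le> n" "gdist T z (\<pi> 0) = gdist T z (\<pi> m) + m"
    "gdist T z (\<pi> n) = gdist T z (\<pi> m) + (n - m)"
proof -
  \<comment> \<open>From a nearest index the distance cannot decrease in either direction, so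
    \<open>gdist_ascending\<close> applies to both halves of the path.\<close>
  define m where "m = arg_min_on (\<lambda>i. gdist T z (\<pi> i)) {..n}"
  have m: "m \<le> n" "\<And>i. i \<le> n \<Longrightarrow> gdist T z (\<pi> m) \<le> gdist T z (\<pi> i)"
    unfolding m_def using arg_min_if_finite[of "{..n}" "\<lambda>i. gdist T z (\<pi> i)"]
    by (auto simp: not_less[symmetric])
  have "gdist T z (\<pi> (m + (n - m))) = gdist T z (\<pi> (m + 0)) + (n - m)"
    by (rule gdist_ascending[where \<pi> = "\<lambda>i. \<pi> (m + i)" and n = "n - m"])
       (use z V adj inj m in auto)
  moreover have "gdist T z (\<pi> (m - m)) = gdist T z (\<pi> (m - 0)) + m"
  proof (rule gdist_ascending[where \<pi> = "\<lambda>i. \<pi> (m - i)" and n = m])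
    show "adj T (\<pi> (m - i)) (\<pi> (m - Suc i))" if "i < m" for i
      using adj[of "m - Suc i"] adjD that m(1) by (simp add: Suc_diff_Suc)
    show "\<pi> (m - i) \<noteq> \<pi> (m - Suc (Suc i))" if "Suc (Suc i) \<le> m" for i
    proof -
      have "m - i = Suc (Suc (m - Suc (Suc i)))" using that by simp
      then show ?thesis using inj[of "m - Suc (Suc i)"] m(1) by (metis diff_le_self le_trans)
    qed
  qed (use z V m in auto)
  ultimately show ?thesis using that[of m] m(1) by auto
qed

lemma tree_metric_gdist: "tree_metric (verts T) (gdist T)"
proof
  show "verts T \<noteq> {}" using tree unfolding tree_def by blast
next
  fix x y assume V: "x \<in> verts T" "y \<in> verts T"
  show "gdist T x y = 0 \<longleftrightarrow> x = y" "gdist T x y = gdist T y x" using V gdist_0 gdist_sym by auto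
  obtain \<pi> where \<pi>: "\<pi> 0 = x" "\<pi> (gdist T x y) = y" "\<And>i. i \<le> gdist T x y \<Longrightarrow> \<pi> i \<in> verts T"
    "\<And>i j. \<lbrakk>i \<le> j; j \<le> gdist T x y\<rbrakk> \<Longrightarrow> gdist T (\<pi> i) (\<pi> j) = j - i"
    "\<And>i. i < gdist T x y \<Longrightarrow> adj T (\<pi> i) (\<pi> (Suc i))"
    using geodesic[OF V] by blast
  \<comment> \<open>\<open>\<pi> m\<close> is the projection of \<open>z\<close> to the geodesic
    from \<open>x\<close> to \<open>y\<close>. Parity is read off from one projection, the four
    point condition from the positions of two.\<close>
  have proj: "\<exists>m\<le>gdist T x y. gdist T z x = gdist T z (\<pi> m) + m \<and>
      gdist T z y = gdist T z (\<pi> m) + (gdist T x y - m)" if "z \<in> verts T" for z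
  proof -
    have "\<pi> i \<noteq> \<pi> (Suc (Suc i))" if "Suc (Suc i) \<le> gdist T x y" for i
      using \<pi>(3)[of "Suc (Suc i)"] \<pi>(4)[of i "Suc (Suc i)"] that gdist_0 by fastforce
    then obtain m where "m \<le> gdist T x y" "gdist T z (\<pi> 0) = gdist T z (\<pi> m) + m"
      "gdist T z (\<pi> (gdist T x y)) = gdist T z (\<pi> m) + (gdist T x y - m)"
      using gdist_projection[of z "gdist T x y" \<pi>] \<pi>(3,5) \<open>z \<in> verts T\<close> by metis
    then show ?thesis using \<pi>(1,2) by auto
  qed
  show "\<exists>z\<in>verts T. gdist T x z = 1 \<and> gdist T x y = Suc (gdist T z y)" if "x \<noteq> y"
  proof -
    have "gdist T x y \<ge> 1" using that V gdist_0 by (metis One_nat_def Suc_leI gr0I)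
    then show ?thesis using \<pi>(1,2) \<pi>(3)[of 1] \<pi>(4)[of 0 1] \<pi>(4)[of 1 "gdist T x y"]
      by (intro bexI[of _ "\<pi> 1"]) auto
  qed
  fix z assume z: "z \<in> verts T"
  show "gdist T x z \<le> gdist T x y + gdist T y z" using V z gdist_triangle by blast
  obtain m where m: "m \<le> gdist T x y" "gdist T z x = gdist T z (\<pi> m) + m"
      "gdist T z y = gdist T z (\<pi> m) + (gdist T x y - m)" using proj z by blast
  have "gdist T x y + gdist T y z + gdist T x z = 2 * (gdist T x y + gdist T z (\<pi> m))"
    using m gdist_sym V z by auto
  then show "even (gdist T x y + gdist T y z + gdist T x z)" by (metis dvd_triv_left)
  fix w assume w: "w \<in> verts T"
  obtain l where l: "l \<le> gdist T x y" "gdist T w x = gdist T w (\<pi> l) + l"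
      "gdist T w y = gdist T w (\<pi> l) + (gdist T x y - l)" using proj w by blast
  have lm: "gdist T (\<pi> m) (\<pi> l) = (if m \<le> l then l - m else m - l)"
    using \<pi>(3)[of l] \<pi>(3)[of m] \<pi>(4)[of m l] \<pi>(4)[of l m] l(1) m(1) gdist_sym by auto
  have "gdist T z w \<le> gdist T z (\<pi> m) + gdist T (\<pi> m) (\<pi> l) + gdist T w (\<pi> l)"
    using gdist_triangle[of z "\<pi> m" w] gdist_triangle[of "\<pi> m" "\<pi> l" w] gdist_sym[of w "\<pi> l"]
      \<pi>(3)[of l] \<pi>(3)[of m] z w l(1) m(1) by auto
  moreover have "gdist T x z = gdist T z (\<pi> m) + m" "gdist T x w = gdist T w (\<pi> l) + l"
    "gdist T y z = gdist T z (\<pi> m) + (gdist T x y - m)"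
    "gdist T y w = gdist T w (\<pi> l) + (gdist T x y - l)"
    using l(2,3) m(2,3) V z w gdist_sym by simp_all
  ultimately show "gdist T x y + gdist T z w
      \<le> max (gdist T x z + gdist T y w) (gdist T x w + gdist T y z)"
    using l(1) m(1) lm by (cases "m \<le> l") simp_all
qed

end

section \<open>Ends and the Busemann cocycle\<close>

context tree_metric
begin

text \<open>Because the overlap has positive length, \<open>d x z + d y w\<close> exceeds
  \<open>d x y + d z w\<close>, so the four point condition bounds it by the remaining sum
  \<open>d x w + d y z\<close>.\<close>

lemma concat_geodesic:
  assumes V: "x \<in> V" "y \<in> V" "z \<in> V" "w \<in> V"
    and "d x z = d x y + d y z" "d y w = d y z + d z w" "y \<noteq> z"
  shows "d x w = d x y + d y z + d z w"
proof -
  have "d y z > 0" using dist_0 assms by blast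
  moreover have "d x z + d y w \<le> max (d x y + d z w) (d x w + d z y)"
    using four_point[of x z y w] V by simp
  ultimately show ?thesis
    using assms triangle[of x z w] dist_sym[of y z] by linarith
qed

text \<open>Two sequences converge to the same end of the tree.\<close>

definition asymptotic :: "(nat \<Rightarrow> 'v) \<Rightarrow> (nat \<Rightarrow> 'v) \<Rightarrow> bool" where
  "asymptotic x y \<longleftrightarrow> range x \<subseteq> V \<and> range y \<subseteq> V \<and>
     (\<forall>b\<in>V. \<forall>C. \<exists>N. \<forall>m\<ge>N. \<forall>n\<ge>N. C + d (x m) (y n) \<le> d b (x m) + d b (y n))"

lemma asymptotic_in: "asymptotic x y \<Longrightarrow> x n \<in> V" "asymptotic x y \<Longrightarrow> y n \<in> V"
  unfolding asymptotic_def by auto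

lemma asymptoticD:
  assumes "asymptotic x y" "b \<in> V"
  obtains N where "\<And>m n. \<lbrakk>m \<ge> N; n \<ge> N\<rbrakk> \<Longrightarrow> C + d (x m) (y n) \<le> d b (x m) + d b (y n)"
  using assms unfolding asymptotic_def by metis

text \<open>The constant \<open>C\<close> bounds twice the Gromov product. A change of base point
  alters this by at most \<open>2 * d a b\<close>, so one base point is enough.\<close>

lemma asymptoticI:
  assumes x: "\<And>n. x n \<in> V" and y: "\<And>n. y n \<in> V" and b: "b \<in> V"
    and N: "\<And>C. \<exists>N. \<forall>m\<ge>N. \<forall>n\<ge>N. C + d (x m) (y n) \<le> d b (x m) + d b (y n)"
  shows "asymptotic x y"
  unfolding asymptotic_def
proof (intro conjI ballI allI)
  fix a C assume a: "a \<in> V"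
  obtain N where N: "\<forall>m\<ge>N. \<forall>n\<ge>N. (C + 2 * d a b) + d (x m) (y n) \<le> d b (x m) + d b (y n)"
    using N by blast
  have "C + d (x m) (y n) \<le> d a (x m) + d a (y n)" if "m \<ge> N" "n \<ge> N" for m n
    using N[rule_format, OF that] triangle[OF b a x[of m]] triangle[OF b a y[of n]]
      dist_sym[OF a b] by linarith
  then show "\<exists>N. \<forall>m\<ge>N. \<forall>n\<ge>N. C + d (x m) (y n) \<le> d a (x m) + d a (y n)" by blast
qed (use x y in auto)

lemma asymptotic_sym: "asymptotic x y \<Longrightarrow> asymptotic y x"
proof -
  assume xy: "asymptotic x y"
  obtain b where b: "b \<in> V" using nonempty by blast
  show "asymptotic y x"
  proof (rule asymptoticI[OF asymptotic_in(2)[OF xy] asymptotic_in(1)[OF xy] b])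
    fix C
    obtain N where N: "\<And>m n. \<lbrakk>m \<ge> N; n \<ge> N\<rbrakk> \<Longrightarrow> C + d (x m) (y n) \<le> d b (x m) + d b (y n)"
      using asymptoticD[OF xy b] by blast
    show "\<exists>N. \<forall>m\<ge>N. \<forall>n\<ge>N. C + d (y m) (x n) \<le> d b (y m) + d b (x n)"
    proof (intro exI allI impI)
      fix m n assume "N \<le> m" "N \<le> n"
      then show "C + d (y m) (x n) \<le> d b (y m) + d b (x n)"
        using N[of n m] dist_sym[OF asymptotic_in(1)[OF xy, of n] asymptotic_in(2)[OF xy, of m]] by linarith
    qed
  qed
qed

text \<open>By the four point condition a Gromov product is at least the smaller of the two products
  with a third point; a late term of \<open>y\<close> is taken as this point.\<close>

lemma asymptotic_trans:
  assumes xy: "asymptotic x y" and yz: "asymptotic y z"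
  shows "asymptotic x z"
proof -
  obtain b where b: "b \<in> V" using nonempty by blast
  show ?thesis
  proof (rule asymptoticI[OF asymptotic_in(1)[OF xy] asymptotic_in(2)[OF yz] b])
    fix C
    obtain N where N: "\<And>m n. \<lbrakk>m \<ge> N; n \<ge> N\<rbrakk> \<Longrightarrow> C + d (x m) (y n) \<le> d b (x m) + d b (y n)"
      using asymptoticD[OF xy b] by blast
    obtain M where M: "\<And>m n. \<lbrakk>m \<ge> M; n \<ge> M\<rbrakk> \<Longrightarrow> C + d (y m) (z n) \<le> d b (y m) + d b (z n)"
      using asymptoticD[OF yz b] by blast
    have "C + d (x m) (z n) \<le> d b (x m) + d b (z n)" if "m \<ge> max M N" "n \<ge> max M N" for m n
    proof -
      let ?y = "y (max M N)"
      have V: "x m \<in> V" "?y \<in> V" "z n \<in> V" using asymptotic_in xy yz by blast+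
      have "C + d (x m) ?y \<le> d b (x m) + d b ?y" "C + d ?y (z n) \<le> d b ?y + d b (z n)"
        using N[of m "max M N"] M[of "max M N" n] that by simp_all
      then show ?thesis
        using four_point[OF V(1,3,2) b] dist_sym[OF V(1) b] dist_sym[OF V(2) b]
          dist_sym[OF V(3) b] dist_sym[OF V(3,2)] by linarith
    qed
    then show "\<exists>N. \<forall>m\<ge>N. \<forall>n\<ge>N. C + d (x m) (z n) \<le> d b (x m) + d b (z n)" by blast
  qed
qed

lemma asymptotic_refl1: "asymptotic x y \<Longrightarrow> asymptotic x x" and asymptotic_refl2: "asymptotic x y \<Longrightarrow> asymptotic y y"
  using asymptotic_sym asymptotic_trans by blast+

lemma asymptotic_bounded:
  assumes xx: "asymptotic x x" and y: "\<And>n. y n \<in> V" and D: "\<And>n. d (x n) (y n) \<le> D"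
  shows "asymptotic x y"
proof -
  obtain b where b: "b \<in> V" using nonempty by blast
  show ?thesis
  proof (rule asymptoticI[OF asymptotic_in(1)[OF xx] y b])
    fix C
    obtain N where N: "\<And>m n. \<lbrakk>m \<ge> N; n \<ge> N\<rbrakk> \<Longrightarrow>
        (C + 2 * D) + d (x m) (x n) \<le> d b (x m) + d b (x n)"
      using asymptoticD[OF xx b] by blast
    have "C + d (x m) (y n) \<le> d b (x m) + d b (y n)" if "m \<ge> N" "n \<ge> N" for m n
      using N[OF that] D[of n] triangle[OF asymptotic_in(1)[OF xx, of m] asymptotic_in(1)[OF xx, of n] y[of n]]
        triangle[OF b y[of n] asymptotic_in(1)[OF xx, of n]] dist_sym[OF asymptotic_in(1)[OF xx, of n] y[of n]]
      by linarith
    then show "\<exists>N. \<forall>m\<ge>N. \<forall>n\<ge>N. C + d (x m) (y n) \<le> d b (x m) + d b (y n)" by blast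
  qed
qed

lemma asymptotic_subseq:
  assumes xx: "asymptotic x x" and k: "\<And>n. k n \<ge> n"
  shows "asymptotic x (\<lambda>n. x (k n))"
proof -
  obtain b where b: "b \<in> V" using nonempty by blast
  show ?thesis
  proof (rule asymptoticI[OF asymptotic_in(1)[OF xx] asymptotic_in(1)[OF xx] b])
    fix C
    obtain N where N: "\<And>m n. \<lbrakk>m \<ge> N; n \<ge> N\<rbrakk> \<Longrightarrow> C + d (x m) (x n) \<le> d b (x m) + d b (x n)"
      using asymptoticD[OF xx b] by blast
    then show "\<exists>N. \<forall>m\<ge>N. \<forall>n\<ge>N. C + d (x m) (x (k n)) \<le> d b (x m) + d b (x (k n))"
      using k le_trans by meson
  qed
qed

text \<open>Failure of convergence gives one \<open>C\<close> that is not reached by some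
  arbitrarily late pair \<open>x i\<close>, \<open>y j\<close>. Late terms within each sequence do
  reach \<open>C\<close>, so the four point condition carries the bound to any other late pair,
  exchanging first \<open>x i\<close> for \<open>x m\<close> and then \<open>y j\<close> for
  \<open>y n\<close>.\<close>

lemma asymptotic_bounded_product:
  assumes xx: "asymptotic x x" and yy: "asymptotic y y" and "\<not> asymptotic x y" and b: "b \<in> V"
  shows "\<exists>C N. \<forall>m\<ge>N. \<forall>n\<ge>N. d b (x m) + d b (y n) \<le> C + d (x m) (y n)"
proof -
  obtain C where C: "\<And>N. \<exists>m\<ge>N. \<exists>n\<ge>N. d b (x m) + d b (y n) < C + d (x m) (y n)"
  proof -
    have "\<not> (\<forall>C. \<exists>N. \<forall>m\<ge>N. \<forall>n\<ge>N. C + d (x m) (y n) \<le> d b (x m) + d b (y n))"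
      using asymptoticI[of x y b, OF asymptotic_in(1)[OF xx] asymptotic_in(1)[OF yy] b] assms(3)
      by blast
    then show ?thesis using that by (simp add: not_le) blast
  qed
  obtain N where N: "\<And>m n. \<lbrakk>m \<ge> N; n \<ge> N\<rbrakk> \<Longrightarrow> C + d (x m) (x n) \<le> d b (x m) + d b (x n)"
    using asymptoticD[OF xx b] by blast
  obtain M where M: "\<And>m n. \<lbrakk>m \<ge> M; n \<ge> M\<rbrakk> \<Longrightarrow> C + d (y m) (y n) \<le> d b (y m) + d b (y n)"
    using asymptoticD[OF yy b] by blast
  have "d b (x m) + d b (y n) \<le> C + d (x m) (y n)" if mn: "m \<ge> max M N" "n \<ge> max M N" for m n
  proof -
    obtain i j where ij: "i \<ge> max M N" "j \<ge> max M N" "d b (x i) + d b (y j) < C + d (x i) (y j)"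
      using C by blast
    have V: "x i \<in> V" "y j \<in> V" "x m \<in> V" "y n \<in> V" using asymptotic_in xx yy by blast+
    have "C + d (x i) (x m) \<le> d b (x i) + d b (x m)" "C + d (y n) (y j) \<le> d b (y n) + d b (y j)"
      using N[of i m] M[of n j] ij mn by auto
    moreover have "d (x i) (y j) + d b (x m) \<le> max (d (x i) b + d (y j) (x m)) (d (x i) (x m) + d (y j) b)"
      using four_point[OF V(1,2) b V(3)] .
    moreover have "d (x m) (y j) + d b (y n) \<le> max (d (x m) b + d (y j) (y n)) (d (x m) (y n) + d (y j) b)"
      using four_point[OF V(3,2) b V(4)] .
    ultimately show ?thesis
      using ij(3) dist_sym[OF V(1) b] dist_sym[OF V(2) b] dist_sym[OF V(3) b] dist_sym[OF V(4) b]
        dist_sym[OF V(2,3)] dist_sym[OF V(2,4)] by linarith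
  qed
  then show ?thesis by blast
qed

lemma asymptotic_diff:
  assumes xy: "asymptotic x y" and u: "u \<in> V" and v: "v \<in> V"
  obtains N where "\<And>m n. \<lbrakk>m \<ge> N; n \<ge> N\<rbrakk> \<Longrightarrow>
    int (d u (x m)) - int (d v (x m)) = int (d u (y n)) - int (d v (y n))"
proof -
  \<comment> \<open>With this constant \<open>d u v + d (x m) (y n)\<close> is strictly the smallest
    of the three sums in the four point condition for \<open>u\<close>, \<open>v\<close>,
    \<open>x m\<close>, \<open>y n\<close>, so the other two sums agree.\<close>
  obtain N where N: "\<And>m n. \<lbrakk>m \<ge> N; n \<ge> N\<rbrakk> \<Longrightarrow>
      (2 * d u v + 1) + d (x m) (y n) \<le> d v (x m) + d v (y n)"
    using asymptoticD[OF xy v] by blast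
  have "int (d u (x m)) - int (d v (x m)) = int (d u (y n)) - int (d v (y n))"
    if "m \<ge> N" "n \<ge> N" for m n
  proof -
    have V: "x m \<in> V" "y n \<in> V" using asymptotic_in xy by blast+
    have "d u (x m) + d v (y n) = d u (y n) + d v (x m)"
      using N[OF that] four_point[OF u V(1) v V(2)] four_point[OF u V(2) v V(1)]
        triangle[OF u v V(1)] triangle[OF v u V(1)] triangle[OF u v V(2)] triangle[OF v u V(2)]
        dist_sym[OF u v] dist_sym[OF V] dist_sym[OF v V(1)] dist_sym[OF v V(2)] by linarith
    then show ?thesis by linarith
  qed
  then show ?thesis using that by blast
qed

text \<open>The Busemann cocycle of a sequence converging to an end; distances are integers, so the
  differences are eventually constant.\<close>

definition busemann :: "(nat \<Rightarrow> 'v) \<Rightarrow> 'v \<Rightarrow> 'v \<Rightarrow> int" where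
  "busemann x u v =
     (SOME c. \<forall>\<^sub>F n in sequentially. int (d u (x n)) - int (d v (x n)) = c)"

lemma busemann_eventually:
  assumes "asymptotic x x" "u \<in> V" "v \<in> V"
  shows "\<forall>\<^sub>F n in sequentially. int (d u (x n)) - int (d v (x n)) = busemann x u v"
proof -
  obtain N where "\<And>m n. \<lbrakk>m \<ge> N; n \<ge> N\<rbrakk> \<Longrightarrow>
      int (d u (x m)) - int (d v (x m)) = int (d u (x n)) - int (d v (x n))"
    using asymptotic_diff[OF assms] by blast
  then have "\<exists>c. \<forall>\<^sub>F n in sequentially. int (d u (x n)) - int (d v (x n)) = c"
    unfolding eventually_sequentially by blast
  then show ?thesis unfolding busemann_def by (rule someI_ex)
qed

lemma busemann_eqI:
  assumes "asymptotic x x" "u \<in> V" "v \<in> V"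
    and "\<forall>\<^sub>F n in sequentially. int (d u (x n)) - int (d v (x n)) = c"
  shows "busemann x u v = c"
proof -
  have "\<forall>\<^sub>F n in sequentially. busemann x u v = c"
    using busemann_eventually[OF assms(1-3)] assms(4) by eventually_elim simp
  then show ?thesis by simp
qed

lemma busemann_add:
  assumes "asymptotic x x" "u \<in> V" "v \<in> V" "w \<in> V"
  shows "busemann x u w = busemann x u v + busemann x v w"
proof (rule busemann_eqI[OF assms(1,2,4)])
  show "\<forall>\<^sub>F n in sequentially. int (d u (x n)) - int (d w (x n)) = busemann x u v + busemann x v w"
    using busemann_eventually[OF assms(1-3)] busemann_eventually[OF assms(1,3,4)]
    by eventually_elim simp
qed

lemma busemann_self:
  assumes "asymptotic x x" "u \<in> V"
  shows "busemann x u u = 0"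
  by (rule busemann_eqI) (use assms in auto)

lemma busemann_asymptotic:
  assumes xy: "asymptotic x y" and uv: "u \<in> V" "v \<in> V"
  shows "busemann x u v = busemann y u v"
proof (rule busemann_eqI[OF asymptotic_refl1[OF xy] uv])
  obtain N where "\<And>m n. \<lbrakk>m \<ge> N; n \<ge> N\<rbrakk> \<Longrightarrow>
      int (d u (x m)) - int (d v (x m)) = int (d u (y n)) - int (d v (y n))"
    using asymptotic_diff[OF xy uv] by blast
  then have "\<forall>\<^sub>F n in sequentially. int (d u (x n)) - int (d v (x n)) = int (d u (y n)) - int (d v (y n))"
    unfolding eventually_sequentially by blast
  then show "\<forall>\<^sub>F n in sequentially. int (d u (x n)) - int (d v (x n)) = busemann y u v"
    using busemann_eventually[OF asymptotic_refl2[OF xy] uv] by eventually_elim simp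
qed

end

section \<open>Translations of trees\<close>

locale tree_action = tree_metric V d + group_action G V \<phi>
  for V :: "'v set" and d and G :: "('g, 'm) monoid_scheme" (structure) and \<phi> +
  assumes isometry: "\<lbrakk>g \<in> carrier G; x \<in> V; y \<in> V\<rbrakk> \<Longrightarrow> d (\<phi> g x) (\<phi> g y) = d x y"
begin

sublocale group G
  using group_hom group_hom.axioms(1) by blast

lemma act_closed [simp]: "\<lbrakk>g \<in> carrier G; x \<in> V\<rbrakk> \<Longrightarrow> \<phi> g x \<in> V"
  using element_image by blast

lemma act_one [simp]: "x \<in> V \<Longrightarrow> \<phi> \<one> x = x"
  using id_eq_one by (metis restrict_apply')

lemma act_inv [simp]: "\<lbrakk>g \<in> carrier G; x \<in> V\<rbrakk> \<Longrightarrow> \<phi> (inv g) (\<phi> g x) = x"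
  using orbit_sym_aux by blast

lemma act_inv' [simp]: "\<lbrakk>g \<in> carrier G; x \<in> V\<rbrakk> \<Longrightarrow> \<phi> g (\<phi> (inv g) x) = x"
  using act_inv[of "inv g" x] by simp

lemma dist_act_left: "\<lbrakk>g \<in> carrier G; x \<in> V; y \<in> V\<rbrakk> \<Longrightarrow> d (\<phi> g x) y = d x (\<phi> (inv g) y)"
  using isometry[of g x "\<phi> (inv g) y"] by simp

lemma asymptotic_act:
  assumes "asymptotic x y" "g \<in> carrier G"
  shows "asymptotic (\<phi> g \<circ> x) (\<phi> g \<circ> y)"
proof -
  obtain b where b: "b \<in> V" using nonempty by blast
  show ?thesis
  proof (rule asymptoticI[where b = "\<phi> g b"])
    fix C
    obtain N where "\<And>m n. \<lbrakk>m \<ge> N; n \<ge> N\<rbrakk> \<Longrightarrow> C + d (x m) (y n) \<le> d b (x m) + d b (y n)"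
      using asymptoticD[OF assms(1) b] by blast
    then show "\<exists>N. \<forall>m\<ge>N. \<forall>n\<ge>N. C + d ((\<phi> g \<circ> x) m) ((\<phi> g \<circ> y) n)
        \<le> d (\<phi> g b) ((\<phi> g \<circ> x) m) + d (\<phi> g b) ((\<phi> g \<circ> y) n)"
      using assms asymptotic_in b by (auto simp: isometry)
  qed (use assms b asymptotic_in in auto)
qed

lemma act_comp:
  assumes "\<And>n. x n \<in> V" "g \<in> carrier G" "h \<in> carrier G"
  shows "\<phi> g \<circ> (\<phi> h \<circ> x) = \<phi> (g \<otimes> h) \<circ> x"
  using assms composition_rule by fastforce

lemma act_comp_one: "(\<And>n. x n \<in> V) \<Longrightarrow> \<phi> \<one> \<circ> x = x"
  by fastforce

lemma asymptotic_act_inv: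
  assumes "asymptotic (\<phi> g \<circ> x) y" "g \<in> carrier G" "\<And>n. x n \<in> V"
  shows "asymptotic x (\<phi> (inv g) \<circ> y)"
  using asymptotic_act[OF assms(1), of "inv g"] assms(2,3) act_comp[of x "inv g" g]
    act_comp_one[of x] by simp

lemma busemann_act:
  assumes "asymptotic x x" "g \<in> carrier G" "u \<in> V" "v \<in> V"
  shows "busemann (\<phi> g \<circ> x) (\<phi> g u) (\<phi> g v) = busemann x u v"
  unfolding busemann_def using assms asymptotic_in[OF assms(1)] by (simp add: isometry)

text \<open>\<open>p\<close> lies on the axis of the translation \<open>g\<close> of length \<open>t\<close>.\<close>

definition axis :: "'g \<Rightarrow> 'v \<Rightarrow> nat \<Rightarrow> bool" where
  "axis g p t \<longleftrightarrow> g \<in> carrier G \<and> p \<in> V \<and> t > 0 \<and> d p (\<phi> g p) = t \<and> d p (\<phi> g (\<phi> g p)) = 2 * t"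

definition ray :: "'g \<Rightarrow> 'v \<Rightarrow> nat \<Rightarrow> 'v" where
  "ray g p n = \<phi> (g [^] n) p"

lemma ray_closed [simp]: "\<lbrakk>g \<in> carrier G; p \<in> V\<rbrakk> \<Longrightarrow> ray g p n \<in> V"
  unfolding ray_def by simp

lemma ray_0 [simp]: "p \<in> V \<Longrightarrow> ray g p 0 = p"
  unfolding ray_def by simp

lemma ray_Suc: "\<lbrakk>g \<in> carrier G; p \<in> V\<rbrakk> \<Longrightarrow> ray g p (Suc n) = \<phi> g (ray g p n)"
  unfolding ray_def using composition_rule[of p g "g [^] n"] nat_pow_Suc2[of g n] by simp

lemma ray_add: "\<lbrakk>g \<in> carrier G; p \<in> V\<rbrakk> \<Longrightarrow> ray g p (m + n) = \<phi> (g [^] m) (ray g p n)"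
  unfolding ray_def by (simp add: nat_pow_mult[symmetric] composition_rule)

lemma ray_power: "\<lbrakk>g \<in> carrier G; p \<in> V\<rbrakk> \<Longrightarrow> ray (g [^] (k :: nat)) p n = ray g p (k * n)"
  unfolding ray_def by (simp add: nat_pow_pow)

lemma ray_act: "\<lbrakk>g \<in> carrier G; p \<in> V\<rbrakk> \<Longrightarrow> \<phi> g \<circ> ray g p = (\<lambda>n. ray g p (Suc n))"
  by (auto simp: ray_Suc)

lemma axisD: "axis g p t \<Longrightarrow> g \<in> carrier G" "axis g p t \<Longrightarrow> p \<in> V" "axis g p t \<Longrightarrow> t > 0"
  unfolding axis_def by auto

text \<open>By isometry any two consecutive steps of the orbit form a geodesic, and
  \<open>concat_geodesic\<close> extends this to the whole orbit. The last condition in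
  \<open>axis\<close> is what excludes backtracking at \<open>\<phi> g p\<close>.\<close>

lemma axis_ray_0:
  assumes ax: "axis g p t"
  shows "d p (ray g p n) = n * t"
proof -
  have g: "g \<in> carrier G" "p \<in> V" "t > 0" using axisD[OF ax] by auto
  have t: "d p (\<phi> g p) = t" "d p (\<phi> g (\<phi> g p)) = 2 * t" using ax unfolding axis_def by auto
  have 1: "d (ray g p n) (ray g p (Suc n)) = t" for n
    using isometry[of "g [^] n" p "\<phi> g p"] g t ray_add[of g p n 1] ray_add[of g p n 0] ray_Suc[of g p 0]
    by simp
  have 2: "d (ray g p n) (ray g p (Suc (Suc n))) = 2 * t" for n
    using isometry[of "g [^] n" p "\<phi> g (\<phi> g p)"] g t ray_add[of g p n 2] ray_add[of g p n 0]
      ray_Suc[of g p 0] ray_Suc[of g p 1] by (simp add: numeral_2_eq_2)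
  show ?thesis
  proof (induction n rule: less_induct)
    case (less n)
    consider "n = 0" | "n = Suc 0" | k where "n = Suc (Suc k)" by (metis not0_implies_Suc)
    then show ?case
    proof cases
      case 1
      then show ?thesis using g dist_0 by simp
    next
      case 2
      then show ?thesis using g t ray_Suc[of g p 0] by simp
    next
      case 3
      have "ray g p k \<noteq> ray g p (Suc k)" using 1[of k] g dist_0[of "ray g p k" "ray g p (Suc k)"] by auto
      then show ?thesis
        using concat_geodesic[of p "ray g p k" "ray g p (Suc k)" "ray g p n"] g 1[of k] 1[of "Suc k"]
          2[of k] less.IH[of k] less.IH[of "Suc k"] 3 by simp
    qed
  qed
qed

lemma axis_inv:
  assumes ax: "axis g p t"
  shows "axis (inv g) p t"
proof -
  have g: "g \<in> carrier G" "p \<in> V" using axisD[OF ax] by auto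
  have "d p (\<phi> (inv g) p) = d (\<phi> g p) p"
    using dist_act_left[OF g g(2)] by simp
  moreover have "d p (\<phi> (inv g) (\<phi> (inv g) p)) = d (\<phi> g (\<phi> g p)) p"
    using dist_act_left[OF g(1), of "\<phi> g p" p] dist_act_left[OF g(1), of p "\<phi> (inv g) p"] g by simp
  moreover have "d (\<phi> g p) p = d p (\<phi> g p)" "d (\<phi> g (\<phi> g p)) p = d p (\<phi> g (\<phi> g p))"
    using g dist_sym[OF _ g(2)] by simp_all
  ultimately show ?thesis using ax g unfolding axis_def by simp
qed

lemma axis_dist:
  assumes ax: "axis g p t"
  shows "d (ray g p m) (ray g p (m + n)) = n * t"
  using axis_ray_0[OF ax, of n] axisD[OF ax] isometry[of "g [^] m" p "ray g p n"]
    ray_add[of g p m n] ray_add[of g p m 0] by simp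

lemma axis_dist_inv:
  assumes ax: "axis g p t"
  shows "d (ray g p m) (ray (inv g) p n) = (m + n) * t"
proof -
  have g: "g \<in> carrier G" "p \<in> V" using axisD[OF ax] by auto
  have "d (ray g p m) (ray (inv g) p n) = d (\<phi> (g [^] n) (ray g p m)) (\<phi> (g [^] n) (ray (inv g) p n))"
    using g isometry by simp
  also have "\<phi> (g [^] n) (ray (inv g) p n) = p"
    using g unfolding ray_def by (simp add: nat_pow_inv)
  finally show ?thesis
    using axis_ray_0[OF ax, of "m + n"] ray_add[of g p n m] g dist_sym by (simp add: add.commute)
qed

lemma ray_asymptotic:
  assumes ax: "axis g p t"
  shows "asymptotic (ray g p) (ray g p)"
proof (rule asymptoticI[where b = p])
  fix C
  have t: "t > 0" using axisD[OF ax] by blast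
  have le: "C + d (ray g p m) (ray g p n) \<le> d p (ray g p m) + d p (ray g p n)"
    if mn: "m \<ge> C" "m \<le> n" for m n
  proof -
    obtain k where k: "n = m + k" using mn le_Suc_ex by blast
    have "C \<le> m * t" using mn t by (metis le_trans mult.right_neutral mult_le_mono Suc_leI One_nat_def)
    then show ?thesis using axis_dist[OF ax, of m k] axis_ray_0[OF ax, of n] axis_ray_0[OF ax, of m] k
      by (simp add: algebra_simps)
  qed
  have "C + d (ray g p m) (ray g p n) \<le> d p (ray g p m) + d p (ray g p n)"
    if "m \<ge> C" "n \<ge> C" for m n
    using le[of m n] le[of n m] that axisD[OF ax] dist_sym[of "ray g p m" "ray g p n"]
    by (cases "m \<le> n") auto
  then show "\<exists>N. \<forall>m\<ge>N. \<forall>n\<ge>N. C + d (ray g p m) (ray g p n) \<le> d p (ray g p m) + d p (ray g p n)"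
    by blast
qed (use axisD[OF ax] in auto)

text \<open>The vertex \<open>p\<close> lies between the two rays, so their Gromov product at
  \<open>p\<close> is zero.\<close>

lemma ray_not_asymptotic:
  assumes ax: "axis g p t"
  shows "\<not> asymptotic (ray g p) (ray (inv g) p)"
proof
  assume "asymptotic (ray g p) (ray (inv g) p)"
  then obtain N where "\<And>m n. \<lbrakk>m \<ge> N; n \<ge> N\<rbrakk> \<Longrightarrow>
      1 + d (ray g p m) (ray (inv g) p n) \<le> d p (ray g p m) + d p (ray (inv g) p n)"
    using asymptoticD axisD[OF ax] by blast
  from this[of N N] show False
    using axis_ray_0[OF ax, of N] axis_ray_0[OF axis_inv[OF ax], of N] axis_dist_inv[OF ax, of N N]
    by (simp add: algebra_simps)
qed

lemma ray_fixed:
  assumes ax: "axis g p t"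
  shows "asymptotic (\<phi> g \<circ> ray g p) (ray g p)"
  using asymptotic_sym[OF asymptotic_subseq[OF ray_asymptotic[OF ax], of Suc]] ray_act axisD[OF ax]
  by simp

lemma axis_power:
  fixes k :: nat
  assumes ax: "axis g p t" and "k > 0"
  shows "axis (g [^] k) p (k * t)"
proof -
  have g: "g \<in> carrier G" "p \<in> V" "t > 0" using axisD[OF ax] by auto
  have "\<phi> (g [^] k) p = ray g p k" "\<phi> (g [^] k) (ray g p k) = ray g p (k + k)"
    using g ray_add[of g p k k] by (simp_all add: ray_def)
  then show ?thesis
    unfolding axis_def using g \<open>k > 0\<close> axis_ray_0[OF ax, of k] axis_ray_0[OF ax, of "k + k"] by simp
qed

lemma ray_power_asymptotic:
  fixes k :: nat
  assumes ax: "axis g p t" and "k > 0"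
  shows "asymptotic (ray (g [^] k) p) (ray g p)"
proof -
  have "ray (g [^] k) p = (\<lambda>n. ray g p (k * n))"
    using axisD[OF ax] by (auto simp: ray_power)
  then show ?thesis
    using asymptotic_sym[OF asymptotic_subseq[OF ray_asymptotic[OF ax], of "\<lambda>n. k * n"]] \<open>k > 0\<close> by simp
qed

lemma ray_conj:
  assumes g: "g \<in> carrier G" "p \<in> V" and h: "h \<in> carrier G"
  shows "ray (h \<otimes> g \<otimes> inv h) (\<phi> h p) = \<phi> h \<circ> ray g p"
proof
  fix n
  show "ray (h \<otimes> g \<otimes> inv h) (\<phi> h p) n = (\<phi> h \<circ> ray g p) n"
  proof (induction n)
    case (Suc n)
    then show ?case using assms by (simp add: ray_Suc composition_rule)
  qed (use assms in simp)
qed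

lemma axis_conj:
  assumes ax: "axis g p t" and h: "h \<in> carrier G"
  shows "axis (h \<otimes> g \<otimes> inv h) (\<phi> h p) t"
  using assms unfolding axis_def by (simp add: composition_rule isometry)

lemma inv_conj:
  assumes "g \<in> carrier G" "h \<in> carrier G"
  shows "inv (h \<otimes> g \<otimes> inv h) = h \<otimes> inv g \<otimes> inv h"
  using assms by (simp add: inv_mult_group m_assoc)

section \<open>The Busemann cocycle of a fixed end along an axis\<close>

lemma busemann_fixed:
  assumes fx: "asymptotic (\<phi> g \<circ> x) x" and g: "g \<in> carrier G" and V: "u \<in> V" "v \<in> V"
  shows "busemann x (\<phi> g u) (\<phi> g v) = busemann x u v"
  using busemann_asymptotic[OF fx, of "\<phi> g u" "\<phi> g v"] busemann_act[OF asymptotic_refl2[OF fx] g V]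
    g V by simp

text \<open>The detours from \<open>u\<close> to \<open>v\<close> and back cancel by
  \<open>busemann_fixed\<close>. Hence the signed translation towards a fixed end can be defined at
  one vertex and evaluated on an axis elsewhere.\<close>

lemma busemann_translation:
  assumes fx: "asymptotic (\<phi> g \<circ> x) x" and g: "g \<in> carrier G" and V: "u \<in> V" "v \<in> V"
  shows "busemann x u (\<phi> g u) = busemann x v (\<phi> g v)"
proof -
  note xx = asymptotic_refl2[OF fx]
  have "busemann x u (\<phi> g u) = busemann x u v + busemann x v (\<phi> g v) + busemann x (\<phi> g v) (\<phi> g u)"
    using busemann_add[OF xx, of u v "\<phi> g u"] busemann_add[OF xx, of v "\<phi> g v" "\<phi> g u"] g V by simp
  also have "busemann x (\<phi> g v) (\<phi> g u) = busemann x v u" using busemann_fixed[OF fx g] V by simp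
  also have "busemann x v u = - busemann x u v"
    using busemann_add[OF xx V V(1)] busemann_self[OF xx V(1)] by simp
  finally show ?thesis by simp
qed

lemma busemann_ray:
  assumes fx: "asymptotic (\<phi> g \<circ> x) x" and g: "g \<in> carrier G" "p \<in> V"
  shows "busemann x p (ray g p n) = int n * busemann x p (\<phi> g p)"
proof (induction n)
  case 0
  then show ?case using g busemann_self[OF asymptotic_refl2[OF fx]] by simp
next
  case (Suc n)
  have "busemann x p (ray g p (Suc n)) =
      busemann x p (ray g p n) + busemann x (ray g p n) (\<phi> g (ray g p n))"
    using busemann_add[OF asymptotic_refl2[OF fx], of p "ray g p n" "\<phi> g (ray g p n)"] g
    by (simp add: ray_Suc)
  then show ?case
    using Suc.IH busemann_translation[OF fx g(1), of "ray g p n" p] g by (simp add: algebra_simps)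
qed

text \<open>The distances from a late \<open>x n\<close> to three consecutive points of the axis
  form an arithmetic progression. By the triangle inequality its difference is at most
  \<open>t\<close> in absolute value; since the outer points are \<open>2 * t\<close> apart, the
  four point condition excludes anything smaller.\<close>

lemma busemann_axis:
  assumes fx: "asymptotic (\<phi> g \<circ> x) x" and ax: "axis g p t"
  shows "\<bar>busemann x p (\<phi> g p)\<bar> = int t"
proof -
  have g: "g \<in> carrier G" "p \<in> V" using axisD[OF ax] by auto
  have t: "d p (\<phi> g p) = t" "d p (\<phi> g (\<phi> g p)) = 2 * t" using ax unfolding axis_def by auto
  define \<beta> where "\<beta> = busemann x p (\<phi> g p)"
  note xx = asymptotic_refl2[OF fx]
  have V: "\<phi> g p \<in> V" "\<phi> g (\<phi> g p) \<in> V" using g by auto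
  have "busemann x (\<phi> g p) (\<phi> g (\<phi> g p)) = \<beta>"
    unfolding \<beta>_def using busemann_fixed[OF fx g(1)] g by simp
  then have "\<forall>\<^sub>F n in sequentially. int (d p (x n)) - int (d (\<phi> g p) (x n)) = \<beta> \<and>
      int (d (\<phi> g p) (x n)) - int (d (\<phi> g (\<phi> g p)) (x n)) = \<beta>"
    using eventually_conj[OF busemann_eventually[OF xx g(2) V(1)] busemann_eventually[OF xx V]] \<beta>_def
    by simp
  then obtain n where n: "int (d p (x n)) - int (d (\<phi> g p) (x n)) = \<beta>"
      "int (d (\<phi> g p) (x n)) - int (d (\<phi> g (\<phi> g p)) (x n)) = \<beta>"
    by (auto simp: eventually_sequentially)
  have x: "x n \<in> V" using asymptotic_in xx by blast
  have "d (\<phi> g p) (\<phi> g (\<phi> g p)) = t" using isometry[of g p "\<phi> g p"] g t by simp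
  then have "\<bar>\<beta>\<bar> = int t"
    using four_point[OF V(1) x g(2) V(2)] triangle[OF g(2) V(1) x] triangle[OF V(1) g(2) x] n t
      dist_sym[OF V(1) g(2)] dist_sym[OF x g(2)] dist_sym[OF x V(2)] by linarith
  then show ?thesis by (simp add: \<beta>_def)
qed

lemma asymptotic_ray:
  assumes fx: "asymptotic (\<phi> g \<circ> x) x" and ax: "axis g p t" and b: "busemann x p (\<phi> g p) = int t"
  shows "asymptotic x (ray g p)"
proof (rule asymptoticI[where b = p])
  have g: "g \<in> carrier G" "p \<in> V" "t > 0" using axisD[OF ax] by auto
  show "p \<in> V" "ray g p n \<in> V" for n using g by auto
  note xx = asymptotic_refl2[OF fx]
  show x: "x n \<in> V" for n using asymptotic_in xx by blast
  fix C
  \<comment> \<open>Every step along the ray gains \<open>t\<close>, so late terms of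
    \<open>x\<close> are reached from \<open>p\<close> through \<open>ray g p C\<close>. The
    geodesics from \<open>p\<close> to \<open>x m\<close> and to \<open>ray g p n\<close> therefore
    share a segment of length \<open>C * t\<close>.\<close>
  have "\<forall>\<^sub>F m in sequentially. int (d p (x m)) - int (d (ray g p C) (x m)) = int C * int t"
    using busemann_eventually[OF xx, of p "ray g p C"] busemann_ray[OF fx, of p C] g b by simp
  then obtain N where N: "\<And>m. m \<ge> N \<Longrightarrow> int (d p (x m)) - int (d (ray g p C) (x m)) = int C * int t"
    unfolding eventually_sequentially by blast
  have "C + d (x m) (ray g p n) \<le> d p (x m) + d p (ray g p n)" if mn: "m \<ge> max N C" "n \<ge> max N C" for m n
  proof -
    obtain k where k: "n = C + k" using mn le_Suc_ex by fastforce
    have "C \<le> C * t" using g by simp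
    moreover have "int (d p (x m)) = int (d (ray g p C) (x m)) + int C * int t" using N[of m] mn by simp
    then have "d p (x m) = d (ray g p C) (x m) + C * t" by (metis of_nat_add of_nat_eq_iff of_nat_mult)
    moreover have "d (x m) (ray g p n) \<le> d (ray g p C) (x m) + k * t"
      using triangle[of "x m" "ray g p C" "ray g p n"] axis_dist[OF ax, of C k] x[of m] g k
        dist_sym[of "x m" "ray g p C"] by simp
    moreover have "d p (ray g p n) = C * t + k * t"
      using axis_ray_0[OF ax, of n] k by (simp add: algebra_simps)
    ultimately show ?thesis by linarith
  qed
  then show "\<exists>N. \<forall>m\<ge>N. \<forall>n\<ge>N. C + d (x m) (ray g p n) \<le> d p (x m) + d p (ray g p n)" by blast
qed

text \<open>The sign of the Busemann translation decides between the two ends; a negative sign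
  becomes positive for \<open>inv g\<close>.\<close>

lemma fixed_end:
  assumes fx: "asymptotic (\<phi> g \<circ> x) x" and ax: "axis g p t"
  shows "asymptotic x (ray g p) \<or> asymptotic x (ray (inv g) p)"
proof (cases "busemann x p (\<phi> g p) = int t")
  case True
  then show ?thesis using asymptotic_ray[OF fx ax] by blast
next
  case False
  have g: "g \<in> carrier G" "p \<in> V" using axisD[OF ax] by auto
  note xx = asymptotic_refl2[OF fx]
  have fx': "asymptotic (\<phi> (inv g) \<circ> x) x"
    using asymptotic_act_inv[OF fx g(1)] asymptotic_in xx asymptotic_sym by blast
  have "busemann x p (\<phi> g p) = - int t" using busemann_axis[OF fx ax] False by linarith
  moreover have "busemann x p (\<phi> (inv g) p) = busemann x (\<phi> g p) p"
    using busemann_translation[OF fx', of p "\<phi> g p"] g by simp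
  moreover have "busemann x p (\<phi> g p) + busemann x (\<phi> g p) p = 0"
    using busemann_add[OF xx, of p "\<phi> g p" p] busemann_self[OF xx] g by simp
  ultimately show ?thesis using asymptotic_ray[OF fx' axis_inv[OF ax]] by simp
qed

end

section \<open>Elliptic elements\<close>

context tree_action
begin

text \<open>A vertex \<open>p\<close> of least displacement \<open>t\<close> will do. If it is
  neither fixed nor on an axis, then the path from \<open>p\<close> to \<open>\<phi> g p\<close> and
  on to the next image backtracks, and a vertex one edge further along is moved less unless
  \<open>t = 1\<close>.\<close>

lemma minimal_displacement:
  assumes g: "g \<in> carrier G"
  shows "\<exists>p\<in>V. \<phi> g p = p \<or> d p (\<phi> g p) = 1 \<and> \<phi> g (\<phi> g p) = p \<or> (\<exists>t. axis g p t)"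
proof -
  obtain p where p: "p \<in> V" and min: "\<And>q. q \<in> V \<Longrightarrow> d p (\<phi> g p) \<le> d q (\<phi> g q)"
    using ex_has_least_nat[of "\<lambda>p. p \<in> V" _ "\<lambda>p. d p (\<phi> g p)"] nonempty by blast
  define t q r where "t = d p (\<phi> g p)" and "q = \<phi> g p" and "r = \<phi> g q"
  have V: "q \<in> V" "r \<in> V" using g p by (auto simp: q_def r_def)
  have qr: "d q r = t" unfolding t_def r_def using isometry[OF g p V(1)] by (simp add: q_def)
  have pq: "d p q = t" by (simp add: t_def q_def)
  consider "t = 0" | "t > 0" "d p r = 2 * t" | "t > 0" "d p r \<noteq> 2 * t" by auto
  then show ?thesis
  proof cases
    case 1
    then have "\<phi> g p = p" using dist_0[OF p V(1)] pq by (simp add: q_def)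
    then show ?thesis using p by blast
  next
    case 2
    then show ?thesis using p g pq by (auto simp: axis_def q_def r_def)
  next
    case 3
    \<comment> \<open>Parity makes the defect at least 2, so the path backtracks at \<open>q\<close>
      over a whole edge.\<close>
    have pr: "d p r + 2 \<le> 2 * t"
      using triangle[OF p V] parity[OF p V] pq qr 3 by presburger
    have "p \<noteq> q" using dist_0[OF p V(1)] pq 3 by auto
    then obtain q' where q': "q' \<in> V" "d p q' = 1" "d p q = Suc (d q' q)" using step[OF p V(1)] by blast
    obtain s where s: "s \<in> V" "d q s = 1" "d q p = Suc (d s p)"
      using step[OF V(1) p] \<open>p \<noteq> q\<close> by blast
    have sym: "d q p = t" "d s q = 1" "d s p = t - 1" "d q' p = 1" "d r q = t" "d r p = d p r" "d s q' = d q' s"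
      using dist_sym p V q' s pq qr by auto
    have gq': "d q (\<phi> g q') = 1" "d (\<phi> g q') r = t - 1" "\<phi> g q' \<in> V"
      using isometry[OF g p q'(1)] isometry[OF g q'(1) V(1)] q' pq g by (auto simp: q_def r_def)
    have gq'q: "d (\<phi> g q') q = 1" using dist_sym[OF gq'(3) V(1)] gq' by simp
    \<comment> \<open>If the geodesics from \<open>q\<close> to \<open>p\<close> and \<open>r\<close> share their first step, it is also the image
      of the first step of the geodesic from \<open>p\<close> to \<open>q\<close>, whose displacement is \<open>t - 2\<close>.\<close>
    have "d s r + d q p \<le> max (d s q + d r p) (d s p + d r q)"
      using four_point[OF s(1) V(2,1) p] .
    then have "d s r \<le> t - 1" using sym pr qr 3 by linarith
    moreover have "d s (\<phi> g q') + d q r \<le> max (d s q + d (\<phi> g q') r) (d s r + d (\<phi> g q') q)"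
      using four_point[OF s(1) gq'(3) V] .
    ultimately have "d s (\<phi> g q') = 0" using sym gq' gq'q qr 3 by linarith
    then have sq: "\<phi> g q' = s" using dist_0[OF s(1) gq'(3)] by simp
    \<comment> \<open>Both ends of the geodesic from \<open>p\<close> to \<open>q\<close> have moved
      inwards by one edge, so over the integers \<open>d q' s \<le> max (2 - t) (t - 2)\<close>.
      Minimality leaves \<open>t = 1\<close>, and \<open>pr\<close> then gives
      \<open>r = p\<close>.\<close>
    have "d q' s + d p q \<le> max (d q' p + d s q) (d q' q + d s p)"
      using four_point[OF q'(1) s(1) p V(1)] .
    moreover have "t \<le> d q' s" using min[OF q'(1)] sq by (simp add: t_def)
    ultimately have "t = 1" using sym q'(3) pq 3 by linarith
    then show ?thesis using dist_0[OF p V(2)] pr p pq by (auto simp: q_def r_def)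
  qed
qed

text \<open>The points \<open>p\<close>, \<open>\<phi> g p\<close> and
  \<open>\<phi> g (\<phi> g p)\<close> are equidistant from \<open>v\<close>, so the four point
  condition becomes the ultrametric inequality for them. On an axis the distance would double
  instead; this contrast rules out translations below.\<close>

lemma fixed_displacement:
  assumes "g \<in> carrier G" "v \<in> V" "\<phi> g v = v" "p \<in> V"
  shows "d p (\<phi> g (\<phi> g p)) \<le> d p (\<phi> g p)"
proof -
  have V: "\<phi> g p \<in> V" "\<phi> g (\<phi> g p) \<in> V" using assms by auto
  have "d (\<phi> g p) v = d p v" "d (\<phi> g (\<phi> g p)) v = d p v"
    using isometry[of g p v] isometry[of g "\<phi> g p" v] assms V by auto
  moreover have "d (\<phi> g p) (\<phi> g (\<phi> g p)) = d p (\<phi> g p)" using isometry assms V by auto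
  ultimately show ?thesis
    using four_point[OF assms(4) V(2,1) assms(2)] dist_sym[OF V(1) V(2)] by linarith
qed

text \<open>Even displacement removes the inverted edge from
  \<open>minimal_displacement\<close>.\<close>

lemma fixed_or_axis:
  assumes g: "g \<in> carrier G" and even: "\<And>p. p \<in> V \<Longrightarrow> even (d p (\<phi> g p))"
  shows "(\<exists>v\<in>V. \<phi> g v = v) \<or> (\<exists>p t. axis g p t)"
  using minimal_displacement[OF g] even by fastforce

text \<open>If the geodesics from \<open>v\<close> to its images under two elliptic elements met only in \<open>v\<close>, then
  the product of these elements would be a translation.\<close>

lemma elliptic_directions:
  assumes K: "subgroup K G" and ell: "\<And>h. h \<in> K \<Longrightarrow> \<exists>v\<in>V. \<phi> h v = v"
    and ab: "a \<in> K" "b \<in> K" and v: "v \<in> V" and mv: "\<phi> a v \<noteq> v" "\<phi> b v \<noteq> v"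
  shows "d (\<phi> a v) (\<phi> b v) < d v (\<phi> a v) + d v (\<phi> b v)"
proof (rule ccontr)
  have G: "a \<in> carrier G" "b \<in> carrier G" "a \<otimes> b \<in> K" "a \<otimes> b \<in> carrier G"
    using ab subgroup.mem_carrier[OF K] subgroup.m_closed[OF K] by auto
  define A B where "A = d v (\<phi> a v)" and "B = d v (\<phi> b v)"
  define a' b' where "a' = \<phi> (inv a) v" and "b' = \<phi> (inv b) v"
  have V: "\<phi> a v \<in> V" "\<phi> b v \<in> V" "a' \<in> V" "b' \<in> V" using G v by (auto simp: a'_def b'_def)
  have pos: "A > 0" "B > 0"
    using dist_0[OF v] V mv by (auto simp: A_def B_def intro!: gr0I)
  assume "\<not> ?thesis"
  then have far: "d (\<phi> a v) (\<phi> b v) \<ge> A + B" by (simp add: A_def B_def)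
  have a'v: "d v a' = A" "d a' v = A" and b'v: "d v b' = B" "d b' v = B"
    using dist_act_left[OF G(1) v v] dist_act_left[OF G(2) v v] dist_sym v V
    by (simp_all add: a'_def b'_def A_def B_def)
  \<comment> \<open>By \<open>fixed_displacement\<close> the vertices \<open>a'\<close> and
    \<open>\<phi> a v\<close> leave \<open>v\<close> in a common direction, and so do
    \<open>b'\<close> and \<open>\<phi> b v\<close>.\<close>
  have aa: "d a' (\<phi> a v) \<le> A" "d b' (\<phi> b v) \<le> B"
  proof -
    obtain z where "z \<in> V" "\<phi> a z = z" using ell ab by blast
    then have "d v (\<phi> a (\<phi> a v)) \<le> A" using fixed_displacement[OF G(1) _ _ v] by (simp add: A_def)
    moreover have "d (\<phi> a a') (\<phi> a (\<phi> a v)) = d a' (\<phi> a v)" "\<phi> a a' = v"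
      using isometry[OF G(1) V(3,1)] G v by (simp_all add: a'_def)
    ultimately show "d a' (\<phi> a v) \<le> A" by simp
    obtain z where "z \<in> V" "\<phi> b z = z" using ell ab by blast
    then have "d v (\<phi> b (\<phi> b v)) \<le> B" using fixed_displacement[OF G(2) _ _ v] by (simp add: B_def)
    moreover have "d (\<phi> b b') (\<phi> b (\<phi> b v)) = d b' (\<phi> b v)" "\<phi> b b' = v"
      using isometry[OF G(2) V(4,2)] G v by (simp_all add: b'_def)
    ultimately show "d b' (\<phi> b v) \<le> B" by simp
  qed
  have sy: "d (\<phi> a v) v = A" "d (\<phi> b v) v = B" "d (\<phi> a v) a' = d a' (\<phi> a v)"
    "d (\<phi> b v) b' = d b' (\<phi> b v)" "d b' a' = d a' b'"
    using dist_sym V v by (simp_all add: A_def B_def)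
  \<comment> \<open>Hence the geodesics from \<open>a'\<close> to \<open>\<phi> b v\<close> and from
    \<open>b'\<close> to \<open>\<phi> a v\<close> pass through \<open>v\<close> as well.\<close>
  have a'b: "d a' (\<phi> b v) = A + B"
    using four_point[OF V(1,2) v V(3)] triangle[OF V(3) v V(2)] far aa a'v sy pos dist_sym[OF V(2,3)]
    by (simp add: A_def[symmetric] B_def[symmetric]; linarith)
  have b'a: "d b' (\<phi> a v) = A + B"
    using four_point[OF V(2,1) v V(4)] triangle[OF V(4) v V(1)] far aa b'v sy pos dist_sym[OF V(1,4)]
      dist_sym[OF V(1,2)] by (simp add: A_def[symmetric] B_def[symmetric]; linarith)
  \<comment> \<open>The path from \<open>v\<close> through \<open>?x1\<close>, \<open>?x2\<close>,
    \<open>?x3\<close> to \<open>?x4\<close> has steps of lengths \<open>A\<close>,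
    \<open>B\<close>, \<open>A\<close>, \<open>B\<close>, and any two consecutive steps form a
    geodesic. So the whole path does, and applying \<open>a \<otimes> b\<close> twice doubles the
    displacement.\<close>
  let ?x1 = "\<phi> a v" and ?x2 = "\<phi> (a \<otimes> b) v" and ?x3 = "\<phi> (a \<otimes> b) (\<phi> a v)"
    and ?x4 = "\<phi> (a \<otimes> b) (\<phi> (a \<otimes> b) v)"
  have X: "?x1 \<in> V" "?x2 \<in> V" "?x3 \<in> V" "?x4 \<in> V" using G v by auto
  have x12: "d ?x1 ?x2 = B"
    using isometry[OF G(1) v V(2)] G v by (simp add: composition_rule B_def)
  have x02: "d v ?x2 = A + B"
    using isometry[OF G(1) V(3,2)] a'b G v by (simp add: composition_rule a'_def)
  have x23: "d ?x2 ?x3 = A" using isometry[OF G(4) v V(1)] by (simp add: A_def)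
  have x24: "d ?x2 ?x4 = A + B" using isometry[OF G(4) v X(2)] x02 by simp
  have x34: "d ?x3 ?x4 = B" using isometry[OF G(4) V(1) X(2)] x12 by simp
  have "\<phi> (a \<otimes> b) b' = ?x1" using G v by (simp add: composition_rule b'_def)
  then have x13: "d ?x1 ?x3 = A + B" using isometry[OF G(4) V(4,1)] b'a by simp
  have "d v ?x3 = A + B + A"
    using concat_geodesic[OF v X(1,2,3)] x12 x02 x23 x13 pos dist_0[OF X(1,2)] by (simp add: A_def)
  then have "d v ?x4 = A + B + A + B"
    using concat_geodesic[OF v X(2,3,4)] x02 x23 x24 x34 pos dist_0[OF X(2,3)] by simp
  moreover obtain z where "z \<in> V" "\<phi> (a \<otimes> b) z = z" using ell[OF G(3)] by blast
  ultimately show False using fixed_displacement[OF G(4) _ _ v] x02 pos by fastforce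
qed

text \<open>A vertex minimising the total displacement of \<open>S\<close> is fixed, since otherwise all elements
  of \<open>S\<close> that move it move it in the same direction.\<close>

lemma common_fixed_vertex:
  assumes K: "subgroup K G" and ell: "\<And>h. h \<in> K \<Longrightarrow> \<exists>v\<in>V. \<phi> h v = v"
    and S: "S \<subseteq> K" "finite S"
  shows "\<exists>v\<in>V. \<forall>s\<in>S. \<phi> s v = v"
proof -
  obtain v where v: "v \<in> V" and
    min: "\<And>w. w \<in> V \<Longrightarrow> (\<Sum>s\<in>S. d v (\<phi> s v)) \<le> (\<Sum>s\<in>S. d w (\<phi> s w))"
    using ex_has_least_nat[of "\<lambda>v. v \<in> V" _ "\<lambda>v. \<Sum>s\<in>S. d v (\<phi> s v)"] nonempty by blast
  have KG: "s \<in> carrier G" if "s \<in> K" for s using that subgroup.mem_carrier[OF K] by blast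
  have "\<phi> s v = v" if "s \<in> S" for s
  proof (rule ccontr)
    assume mv: "\<phi> s v \<noteq> v"
    have s: "s \<in> K" "\<phi> s v \<in> V" using that S KG v by auto
    \<comment> \<open>\<open>e\<close> is the first vertex on the way to \<open>\<phi> s v\<close>;
      it will have a smaller total displacement than \<open>v\<close>.\<close>
    obtain e where e: "e \<in> V" "d v e = 1" "d v (\<phi> s v) = Suc (d e (\<phi> s v))"
      using step[OF v s(2)] mv by auto
    have ev: "d e v = 1" using dist_sym[OF e(1) v] e by simp
    \<comment> \<open>By parity the geodesics from \<open>v\<close> to \<open>\<phi> a v\<close> and
      to \<open>\<phi> s v\<close> share at least a whole edge, which is the one from
      \<open>v\<close> to \<open>e\<close>.\<close>
    have dir: "Suc (d e (\<phi> a v)) \<le> d v (\<phi> a v)" if a: "a \<in> K" "\<phi> a v \<noteq> v" for a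
    proof -
      have av: "\<phi> a v \<in> V" using a KG v by simp
      have "d (\<phi> a v) (\<phi> s v) < d v (\<phi> a v) + d v (\<phi> s v)"
        using elliptic_directions[OF K ell a(1) s(1) v a(2) mv] .
      then have "d (\<phi> a v) (\<phi> s v) + 2 \<le> d v (\<phi> a v) + d v (\<phi> s v)"
        using parity[OF v av s(2)] by presburger
      then show ?thesis
        using four_point[OF e(1) av v s(2)] ev e dist_sym[OF av v] by linarith
    qed
    \<comment> \<open>The geodesics from \<open>v\<close> to its images under \<open>a\<close> and
      \<open>inv a\<close> both begin with \<open>e\<close>, so the one to \<open>\<phi> a v\<close>
      also has \<open>\<phi> a e\<close> as its last vertex but one. Passing to \<open>e\<close>
      removes an edge at both ends.\<close>
    have less: "d e (\<phi> a e) < d v (\<phi> a v)" if a: "a \<in> K" "\<phi> a v \<noteq> v" for a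
    proof -
      have G: "a \<in> carrier G" using a KG by blast
      have V: "\<phi> a v \<in> V" "\<phi> a e \<in> V" "\<phi> (inv a) v \<in> V" using G v e by auto
      have "\<phi> (inv a) v \<noteq> v" using a(2) act_inv'[OF G v] by metis
      then have "Suc (d e (\<phi> (inv a) v)) \<le> d v (\<phi> (inv a) v)"
        using dir[of "inv a"] subgroup.m_inv_closed[OF K a(1)] by blast
      moreover have "d (\<phi> a e) v = d e (\<phi> (inv a) v)" "d (\<phi> a v) v = d v (\<phi> (inv a) v)"
        using dist_act_left[OF G] e v by auto
      ultimately have 1: "Suc (d (\<phi> a e) v) \<le> d v (\<phi> a v)" using dist_sym[OF V(1) v] by simp
      have 2: "Suc (d e (\<phi> a v)) \<le> d v (\<phi> a v)" using dir[OF a] .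
      have 3: "d (\<phi> a e) (\<phi> a v) = 1" using isometry[OF G e(1) v] ev by simp
      \<comment> \<open>Displacement 1 would leave no room for removing two edges; it is odd, while
        an element with a fixed vertex moves every vertex by an even distance.\<close>
      have "d v (\<phi> a v) \<noteq> 1"
      proof -
        obtain z where z: "z \<in> V" "\<phi> a z = z" using ell a by blast
        then have "d (\<phi> a v) z = d v z" using isometry[OF G v z(1)] by simp
        then show ?thesis using parity[OF v V(1) z(1)] by presburger
      qed
      then show ?thesis
        using four_point[OF e(1) V(2) v V(1)] 1 2 3 ev by linarith
    qed
    \<comment> \<open>Elements fixing \<open>v\<close> must not start to move at \<open>e\<close>.
      The conjugate of \<open>s\<close> by \<open>a\<close> moves \<open>v\<close>, hence in the
      direction of \<open>e\<close> by \<open>dir\<close>, but also in that of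
      \<open>\<phi> a e\<close>. Such conjugates lie in \<open>K\<close> and not in
      \<open>S\<close>, so \<open>dir\<close> is stated for all of \<open>K\<close>.\<close>
    have fix_dir: "\<phi> a e = e" if a: "a \<in> K" "\<phi> a v = v" for a
    proof -
      have G: "a \<in> carrier G" "s \<in> carrier G" using a s KG by auto
      define c where "c = a \<otimes> s \<otimes> inv a"
      have c: "c \<in> K" using a s K by (simp add: c_def subgroup.m_closed subgroup.m_inv_closed)
      have iv: "\<phi> (inv a) v = v" using a(2) act_inv[OF G(1) v] by simp
      have cv: "\<phi> c v = \<phi> a (\<phi> s v)" using G v iv by (simp add: c_def composition_rule)
      have V: "\<phi> a e \<in> V" "\<phi> c v \<in> V" using G e v s cv by auto
      have dc: "d v (\<phi> c v) = d v (\<phi> s v)" using isometry[OF G(1) v s(2)] a cv by simp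
      then have "\<phi> c v \<noteq> v" using mv dist_0 v s by metis
      then have "Suc (d e (\<phi> c v)) \<le> d v (\<phi> c v)" using dir c by blast
      moreover have "d (\<phi> a e) (\<phi> c v) = d e (\<phi> s v)" using isometry[OF G(1) e(1) s(2)] cv by simp
      moreover have "d (\<phi> a e) v = 1" using isometry[OF G(1) e(1) v] a ev by simp
      ultimately have "d e (\<phi> a e) = 0"
        using four_point[OF e(1) V(1) v V(2)] dc e ev by linarith
      then show ?thesis using dist_0[OF e(1) V(1)] by simp
    qed
    have "(\<Sum>s\<in>S. d e (\<phi> s e)) < (\<Sum>s\<in>S. d v (\<phi> s v))"
    proof (rule sum_strict_mono_ex1[OF S(2)])
      have "d e (\<phi> a e) \<le> d v (\<phi> a v)" if "a \<in> S" for a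
        using less[of a] fix_dir[of a] that S dist_0[OF e(1) e(1)] by (cases "\<phi> a v = v") auto
      then show "\<forall>a\<in>S. d e (\<phi> a e) \<le> d v (\<phi> a v)" by blast
      show "\<exists>a\<in>S. d e (\<phi> a e) < d v (\<phi> a v)" using less[OF s(1) mv] \<open>s \<in> S\<close> by blast
    qed
    then show False using min[OF e(1)] by simp
  qed
  then show ?thesis using v by blast
qed

end

section \<open>Groups of automorphisms fixing an end\<close>

context tree_action
begin

definition share_end :: "'g \<Rightarrow> 'v \<Rightarrow> 'g \<Rightarrow> 'v \<Rightarrow> bool" where
  "share_end g p h q \<longleftrightarrow>
     asymptotic (ray g p) (ray h q) \<or> asymptotic (ray g p) (ray (inv h) q) \<or>
     asymptotic (ray (inv g) p) (ray h q) \<or> asymptotic (ray (inv g) p) (ray (inv h) q)"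

definition end_stabilizer :: "(nat \<Rightarrow> 'v) \<Rightarrow> 'g set" where
  "end_stabilizer x = {h \<in> carrier G. asymptotic (\<phi> h \<circ> x) x}"

lemma end_stabilizer_subgroup:
  assumes xx: "asymptotic x x"
  shows "subgroup (end_stabilizer x) G"
proof
  have x: "x n \<in> V" for n using asymptotic_in xx by blast
  show "end_stabilizer x \<subseteq> carrier G" by (auto simp: end_stabilizer_def)
  show "\<one> \<in> end_stabilizer x" using xx act_comp_one[of x] x by (simp add: end_stabilizer_def)
  show "g \<otimes> h \<in> end_stabilizer x" if "g \<in> end_stabilizer x" "h \<in> end_stabilizer x" for g h
    using that asymptotic_trans[OF asymptotic_act[of "\<phi> h \<circ> x" x g]] act_comp[of x g h] x
    by (simp add: end_stabilizer_def)
  show "inv h \<in> end_stabilizer x" if "h \<in> end_stabilizer x" for h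
    using that asymptotic_sym[OF asymptotic_act_inv[of h x x]] x by (simp add: end_stabilizer_def)
qed

text \<open>The homomorphism is the Busemann displacement of one vertex. On a translation it is plus
  or minus the positive translation length by \<open>busemann_axis\<close>, so the value zero leaves
  only elements with a fixed vertex.\<close>

lemma end_stabilizer_hom:
  assumes even: "\<And>g p. \<lbrakk>g \<in> carrier G; p \<in> V\<rbrakk> \<Longrightarrow> even (d p (\<phi> g p))" and xx: "asymptotic x x"
  shows "\<exists>\<beta> :: 'g \<Rightarrow> int. (\<forall>g\<in>end_stabilizer x. \<forall>h\<in>end_stabilizer x. \<beta> (g \<otimes> h) = \<beta> g + \<beta> h) \<and>
     (\<forall>h\<in>end_stabilizer x. \<beta> h = 0 \<longrightarrow> (\<exists>v\<in>V. \<phi> h v = v))"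
proof -
  obtain v where v: "v \<in> V" using nonempty by blast
  have add: "busemann x v (\<phi> (g \<otimes> h) v) = busemann x v (\<phi> g v) + busemann x v (\<phi> h v)"
    if g: "g \<in> end_stabilizer x" and h: "h \<in> end_stabilizer x" for g h
  proof -
    have G: "g \<in> carrier G" "h \<in> carrier G" "asymptotic (\<phi> g \<circ> x) x"
      using g h by (auto simp: end_stabilizer_def)
    then show ?thesis
      using busemann_add[OF xx, of v "\<phi> g v" "\<phi> g (\<phi> h v)"] busemann_fixed[OF G(3,1), of v "\<phi> h v"] v
      by (simp add: composition_rule)
  qed
  have ell: "\<exists>w\<in>V. \<phi> h w = w" if h: "h \<in> end_stabilizer x" "busemann x v (\<phi> h v) = 0" for h
  proof (rule ccontr)
    assume "\<not> ?thesis"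
    moreover have G: "h \<in> carrier G" "asymptotic (\<phi> h \<circ> x) x" using h by (auto simp: end_stabilizer_def)
    ultimately obtain p t where ax: "axis h p t" using fixed_or_axis even by blast
    then show False
      using busemann_axis[OF G(2) ax] busemann_translation[OF G(2,1) v] h(2) axisD[OF ax] by fastforce
  qed
  show ?thesis
    by (rule exI[of _ "\<lambda>h. busemann x v (\<phi> h v)"]) (use add ell in blast)
qed

text \<open>If some two translations have exactly one end in common, then this end is fixed by all
  elements. Otherwise all translations have the same pair of ends, which every element fixes or
  interchanges.\<close>

lemma end_pair_stabilizer:
  assumes ax: "axis g p t"
    and same: "\<And>h q s. axis h q s \<Longrightarrow>
      asymptotic (ray h q) (ray g p) \<and> asymptotic (ray (inv h) q) (ray (inv g) p) \<or>
      asymptotic (ray h q) (ray (inv g) p) \<and> asymptotic (ray (inv h) q) (ray g p)"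
    and x: "x \<in> carrier G" "x \<notin> end_stabilizer (ray g p)"
    and y: "y \<in> carrier G" "y \<notin> end_stabilizer (ray g p)"
  shows "x \<otimes> inv y \<in> end_stabilizer (ray g p)"
proof -
  have g: "g \<in> carrier G" "p \<in> V" using axisD[OF ax] by auto
  \<comment> \<open>The conjugate of \<open>g\<close> by \<open>x\<close> is a translation whose
    ends are the images of the ends of \<open>g\<close>. If \<open>x\<close> does not fix the first
    end, \<open>same\<close> leaves only the interchange.\<close>
  have swap: "asymptotic (\<phi> x \<circ> ray g p) (ray (inv g) p) \<and> asymptotic (\<phi> x \<circ> ray (inv g) p) (ray g p)"
    if "x \<in> carrier G" "x \<notin> end_stabilizer (ray g p)" for x
    using same[OF axis_conj[OF ax that(1)]] that ray_conj[OF g that(1)]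
      ray_conj[of "inv g" p x] inv_conj[OF g(1) that(1)] g by (auto simp: end_stabilizer_def)
  have "asymptotic (ray (inv g) p) (\<phi> (inv y) \<circ> ray g p)"
    using asymptotic_act_inv[OF swap[OF y, THEN conjunct2] y(1)] g by simp
  then have "asymptotic (\<phi> x \<circ> ray (inv g) p) (\<phi> (x \<otimes> inv y) \<circ> ray g p)"
    using asymptotic_act[OF _ x(1)] act_comp[of "ray g p" x "inv y"] x y g by fastforce
  then show ?thesis
    using swap[OF x] asymptotic_trans asymptotic_sym x y unfolding end_stabilizer_def by blast
qed

text \<open>Conjugation of \<open>h\<close> by powers of \<open>g\<close> keeps the common end and
  moves the other end of \<open>h\<close> to infinitely many places. A translation without the
  common end could not share an end with all these conjugates, so every translation has it. Applied
  to the conjugates of \<open>g\<close> and \<open>h\<close> by \<open>x\<close>, this shows that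
  \<open>x\<close> fixes it.\<close>

lemma common_end_fixed:
  assumes share: "\<And>g p t h q s. \<lbrakk>axis g p t; axis h q s\<rbrakk> \<Longrightarrow> share_end g p h q"
    and axg: "axis g p t" and axh: "axis h q s"
    and one: "asymptotic (ray g p) (ray h q)" "\<not> asymptotic (ray (inv g) p) (ray (inv h) q)"
    and x: "x \<in> carrier G"
  shows "asymptotic (\<phi> x \<circ> ray g p) (ray g p)"
proof (rule ccontr)
  have g: "g \<in> carrier G" "p \<in> V" "h \<in> carrier G" "q \<in> V" using axisD axg axh by auto
  let ?a = "ray g p" and ?b = "ray (inv g) p" and ?c = "ray (inv h) q"
  have ac: "\<not> asymptotic ?a ?c"
    using ray_not_asymptotic[OF axh] one(1) asymptotic_sym asymptotic_trans by blast
  have bc: "\<not> asymptotic ?c ?b" using one(2) asymptotic_sym by blast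
  \<comment> \<open>A power of \<open>g\<close> that fixes the end of \<open>?c\<close> would make
    it an end of the axis of \<open>g\<close> by \<open>fixed_end\<close>.\<close>
  have moved: "\<not> asymptotic (\<phi> (g [^] i) \<circ> ?c) (\<phi> (g [^] j) \<circ> ?c)" if ij: "i < j" for i j :: nat
  proof
    assume as: "asymptotic (\<phi> (g [^] i) \<circ> ?c) (\<phi> (g [^] j) \<circ> ?c)"
    have j: "g [^] j = g [^] i \<otimes> g [^] (j - i)" using nat_pow_mult[of g i "j - i"] g ij by simp
    have "\<phi> (g [^] j) \<circ> ?c = \<phi> (g [^] i) \<circ> (\<phi> (g [^] (j - i)) \<circ> ?c)"
      unfolding j by (rule act_comp[symmetric]) (use g in simp_all)
    then have "asymptotic ?c (\<phi> (inv (g [^] i)) \<circ> (\<phi> (g [^] i) \<circ> (\<phi> (g [^] (j - i)) \<circ> ?c)))"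
      using asymptotic_act_inv[OF as] g by simp
    also have "\<phi> (inv (g [^] i)) \<circ> (\<phi> (g [^] i) \<circ> (\<phi> (g [^] (j - i)) \<circ> ?c)) = \<phi> (g [^] (j - i)) \<circ> ?c"
      using g by fastforce
    finally have fx: "asymptotic (\<phi> (g [^] (j - i)) \<circ> ?c) ?c" by (rule asymptotic_sym)
    have pos: "j - i > 0" using ij by simp
    have "asymptotic ?c ?a \<or> asymptotic ?c ?b"
      using fixed_end[OF fx axis_power[OF axg pos]] ray_power_asymptotic[OF axg pos]
        ray_power_asymptotic[OF axis_inv[OF axg] pos] nat_pow_inv[OF g(1)] asymptotic_trans by metis
    then show False using ac bc asymptotic_sym by blast
  qed
  have *: "asymptotic ?a (ray k r) \<or> asymptotic ?a (ray (inv k) r)" if axk: "axis k r u" for k r u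
  proof (rule ccontr)
    assume no: "\<not> ?thesis"
    have "asymptotic (\<phi> (g [^] n) \<circ> ?c) (ray k r) \<or> asymptotic (\<phi> (g [^] n) \<circ> ?c) (ray (inv k) r)" for n :: nat
    proof -
      have gn: "g [^] n \<in> carrier G" using g by simp
      have "asymptotic (\<phi> (g [^] n) \<circ> ?a) ?a"
      proof (induction n)
        case 0
        then show ?case using ray_asymptotic[OF axg] act_comp_one[of ?a] g by simp
      next
        case (Suc n)
        have "asymptotic (\<phi> (g [^] n) \<circ> (\<phi> g \<circ> ?a)) (\<phi> (g [^] n) \<circ> ?a)"
          using asymptotic_act[OF ray_fixed[OF axg]] g by blast
        moreover have "\<phi> (g [^] n) \<circ> (\<phi> g \<circ> ?a) = \<phi> (g [^] Suc n) \<circ> ?a"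
          using act_comp[of ?a "g [^] n" g] g by (metis nat_pow_Suc nat_pow_closed ray_closed)
        ultimately show ?case using asymptotic_trans Suc.IH by metis
      qed
      then have ha: "asymptotic (\<phi> (g [^] n) \<circ> ray h q) ?a"
        using asymptotic_trans[OF asymptotic_act[OF asymptotic_sym[OF one(1)] gn]] by blast
      have rays: "ray (g [^] n \<otimes> h \<otimes> inv (g [^] n)) (\<phi> (g [^] n) q) = \<phi> (g [^] n) \<circ> ray h q"
        "ray (inv (g [^] n \<otimes> h \<otimes> inv (g [^] n))) (\<phi> (g [^] n) q) = \<phi> (g [^] n) \<circ> ?c"
        using ray_conj[OF g(3,4) gn] ray_conj[of "inv h" q, OF _ _ gn] inv_conj[OF g(3) gn] g by simp_all
      have "\<not> asymptotic (\<phi> (g [^] n) \<circ> ray h q) y" if "\<not> asymptotic ?a y" for y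
        using that asymptotic_trans[OF asymptotic_sym[OF ha]] by blast
      then show ?thesis
        using share[OF axis_conj[OF axh gn] axk] no unfolding share_end_def rays by blast
    qed
    \<comment> \<open>Three distinct translates of the end of \<open>?c\<close> would have to be
      among the two ends of \<open>k\<close>.\<close>
    note N = this[of 0] this[of 1] this[of 2]
    have tr: "asymptotic y z" if "asymptotic y w" "asymptotic z w" for y z w
      using that asymptotic_sym asymptotic_trans by blast
    have nn: "\<not> asymptotic (\<phi> (g [^] (0::nat)) \<circ> ?c) (\<phi> (g [^] (1::nat)) \<circ> ?c)"
      "\<not> asymptotic (\<phi> (g [^] (0::nat)) \<circ> ?c) (\<phi> (g [^] (2::nat)) \<circ> ?c)"
      "\<not> asymptotic (\<phi> (g [^] (1::nat)) \<circ> ?c) (\<phi> (g [^] (2::nat)) \<circ> ?c)"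
      by (rule moved, simp)+
    then show False using N tr by blast
  qed
  assume na: "\<not> asymptotic (\<phi> x \<circ> ?a) ?a"
  \<comment> \<open>The conjugates of \<open>g\<close> and \<open>h\<close> by \<open>x\<close> both
    have \<open>?a\<close> as an end. If this is not the image of \<open>?a\<close>, it is the image
    of \<open>?b\<close> and also that of \<open>?c\<close>, which identifies \<open>?b\<close> with
    \<open>?c\<close>.\<close>
  have 1: "asymptotic ?a (\<phi> x \<circ> ?b)"
    using *[OF axis_conj[OF axg x]] na ray_conj[OF g(1,2) x] ray_conj[of "inv g" p x]
      inv_conj[OF g(1) x] g x asymptotic_sym by auto
  have "asymptotic (\<phi> x \<circ> ?a) (\<phi> x \<circ> ray h q)" using asymptotic_act[OF one(1) x] .
  then have "\<not> asymptotic ?a (\<phi> x \<circ> ray h q)" using na asymptotic_sym asymptotic_trans by blast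
  then have 2: "asymptotic ?a (\<phi> x \<circ> ?c)"
    using *[OF axis_conj[OF axh x]] ray_conj[OF g(3,4) x] ray_conj[of "inv h" q x]
      inv_conj[OF g(3) x] g x by auto
  have "asymptotic (\<phi> x \<circ> ?b) (\<phi> x \<circ> ?c)" using 1 2 asymptotic_sym asymptotic_trans by blast
  then have "asymptotic ?b (\<phi> (inv x) \<circ> (\<phi> x \<circ> ?c))" using asymptotic_act_inv x g by simp
  moreover have "\<phi> (inv x) \<circ> (\<phi> x \<circ> ?c) = ?c" using x g by fastforce
  ultimately show False using one(2) by simp
qed

text \<open>The clause on \<open>x \<otimes> inv y\<close> says that the elements outside
  \<open>H\<close> form at most one coset, so the index is at most two. Index two occurs only if the
  ends of a common axis are interchanged.\<close>

lemma virtually_fixes_end: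
  assumes even: "\<And>g p. \<lbrakk>g \<in> carrier G; p \<in> V\<rbrakk> \<Longrightarrow> even (d p (\<phi> g p))"
    and share: "\<And>g p t h q s. \<lbrakk>axis g p t; axis h q s\<rbrakk> \<Longrightarrow> share_end g p h q"
  shows "\<exists>H. \<exists>\<beta> :: 'g \<Rightarrow> int. subgroup H G \<and>
     (\<forall>x\<in>carrier G. \<forall>y\<in>carrier G. x \<notin> H \<longrightarrow> y \<notin> H \<longrightarrow> x \<otimes> inv y \<in> H) \<and>
     (\<forall>g\<in>H. \<forall>h\<in>H. \<beta> (g \<otimes> h) = \<beta> g + \<beta> h) \<and> (\<forall>h\<in>H. \<beta> h = 0 \<longrightarrow> (\<exists>v\<in>V. \<phi> h v = v))"
proof (cases "\<exists>g p t. axis g p t")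
  case False
  then have "\<forall>h\<in>carrier G. \<exists>v\<in>V. \<phi> h v = v" using fixed_or_axis[OF _ even] by meson
  then show ?thesis
    by (intro exI[of _ "carrier G"] exI[of _ "\<lambda>_. 0"]) (auto simp: subgroup_self)
next
  case True
  show ?thesis
  proof (cases "\<exists>g p t h q s. axis g p t \<and> axis h q s \<and>
      asymptotic (ray g p) (ray h q) \<and> \<not> asymptotic (ray (inv g) p) (ray (inv h) q)")
    case True
    then obtain g p t h q s where ax: "axis g p t" "axis h q s"
      and one: "asymptotic (ray g p) (ray h q)" "\<not> asymptotic (ray (inv g) p) (ray (inv h) q)" by blast
    have "asymptotic (\<phi> x \<circ> ray g p) (ray g p)" if "x \<in> carrier G" for x
      by (rule common_end_fixed[OF _ ax one that]) (rule share)
    then have eq: "end_stabilizer (ray g p) = carrier G" by (auto simp: end_stabilizer_def)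
    have "\<exists>\<beta> :: 'g \<Rightarrow> int.
       (\<forall>k\<in>end_stabilizer (ray g p). \<forall>h\<in>end_stabilizer (ray g p). \<beta> (k \<otimes> h) = \<beta> k + \<beta> h) \<and>
       (\<forall>h\<in>end_stabilizer (ray g p). \<beta> h = 0 \<longrightarrow> (\<exists>v\<in>V. \<phi> h v = v))"
      by (rule end_stabilizer_hom[OF _ ray_asymptotic[OF ax(1)]]) (rule even)
    then obtain \<beta> :: "'g \<Rightarrow> int" where
      "(\<forall>g\<in>carrier G. \<forall>h\<in>carrier G. \<beta> (g \<otimes> h) = \<beta> g + \<beta> h) \<and>
       (\<forall>h\<in>carrier G. \<beta> h = 0 \<longrightarrow> (\<exists>v\<in>V. \<phi> h v = v))"
      unfolding eq by blast
    then show ?thesis using subgroup_self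
      by (intro exI[of _ "carrier G"] exI[of _ \<beta>]) simp
  next
    case False
    obtain g p t where ax: "axis g p t" using \<open>\<exists>g p t. axis g p t\<close> by blast
    have same: "asymptotic (ray h q) (ray g p) \<and> asymptotic (ray (inv h) q) (ray (inv g) p) \<or>
      asymptotic (ray h q) (ray (inv g) p) \<and> asymptotic (ray (inv h) q) (ray g p)"
      if axh: "axis h q s" for h q s
    proof -
      have ii: "inv (inv g) = g" "inv (inv h) = h" using axisD ax axh by simp_all
      \<comment> \<open>Here a common end of two translations forces the opposite ends to agree as
        well. This is used for all choices of inverting either translation.\<close>
      have F: "asymptotic (ray (inv k) r) (ray (inv l) u)"
        if "axis k r v" "axis l u w" "asymptotic (ray k r) (ray l u)" for k r v l u w
        using False that by blast
      show ?thesis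
        using share[OF axh ax] F[OF axh ax] F[OF axh axis_inv[OF ax]] F[OF axis_inv[OF axh] ax]
          F[OF axis_inv[OF axh] axis_inv[OF ax]] unfolding share_end_def ii by blast
    qed
    have "\<forall>x\<in>carrier G. \<forall>y\<in>carrier G. x \<notin> end_stabilizer (ray g p) \<longrightarrow>
        y \<notin> end_stabilizer (ray g p) \<longrightarrow> x \<otimes> inv y \<in> end_stabilizer (ray g p)"
    proof (intro ballI impI)
      fix x y assume xy: "x \<in> carrier G" "y \<in> carrier G" "x \<notin> end_stabilizer (ray g p)"
        "y \<notin> end_stabilizer (ray g p)"
      show "x \<otimes> inv y \<in> end_stabilizer (ray g p)"
        by (rule end_pair_stabilizer[OF ax _ xy(1,3,2,4)]) (rule same)
    qed
    moreover have "\<exists>\<beta> :: 'g \<Rightarrow> int.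
       (\<forall>k\<in>end_stabilizer (ray g p). \<forall>h\<in>end_stabilizer (ray g p). \<beta> (k \<otimes> h) = \<beta> k + \<beta> h) \<and>
       (\<forall>h\<in>end_stabilizer (ray g p). \<beta> h = 0 \<longrightarrow> (\<exists>v\<in>V. \<phi> h v = v))"
      by (rule end_stabilizer_hom[OF _ ray_asymptotic[OF ax]]) (rule even)
    moreover from this obtain \<beta> :: "'g \<Rightarrow> int" where
      "(\<forall>k\<in>end_stabilizer (ray g p). \<forall>h\<in>end_stabilizer (ray g p). \<beta> (k \<otimes> h) = \<beta> k + \<beta> h) \<and>
       (\<forall>h\<in>end_stabilizer (ray g p). \<beta> h = 0 \<longrightarrow> (\<exists>v\<in>V. \<phi> h v = v))"
      by blast
    ultimately show ?thesis
      using end_stabilizer_subgroup[OF ray_asymptotic[OF ax]]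
      by (intro exI[of _ "end_stabilizer (ray g p)"] exI[of _ \<beta>]) simp
  qed
qed

end

section \<open>Free subgroups\<close>

context group
begin

definition eval_word :: "(F2_letter \<Rightarrow> 'a) \<Rightarrow> F2_letter list \<Rightarrow> 'a" where
  "eval_word s w = foldr (\<lambda>a x. s a \<otimes> x) w \<one>"

lemma eval_word_simps [simp]:
  "eval_word s [] = \<one>" "eval_word s (a # w) = s a \<otimes> eval_word s w"
  by (simp_all add: eval_word_def)

lemma eval_word_closed [simp]: "(\<And>a. s a \<in> carrier G) \<Longrightarrow> eval_word s w \<in> carrier G"
  by (induction w) auto

lemma eval_word_append:
  "(\<And>a. s a \<in> carrier G) \<Longrightarrow> eval_word s (u @ v) = eval_word s u \<otimes> eval_word s v"
  by (induction u) (auto simp: m_assoc)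

end

lemma inv_letter_inv_letter [simp]: "inv_letter (inv_letter a) = a"
  by (simp add: inv_letter_def)

lemma reduced_Nil [simp]: "reduced []"
  by (simp add: reduced_def)

lemma reduced_Cons: "reduced (a # w) \<longleftrightarrow> reduced w \<and> (w \<noteq> [] \<longrightarrow> hd w \<noteq> inv_letter a)"
  unfolding reduced_def by (auto simp: successively_Cons)

lemma reduced_cancel_cons: "reduced w \<Longrightarrow> reduced (cancel_cons a w)"
  by (cases w) (auto simp: reduced_Cons)

lemma reduced_foldr: "reduced v \<Longrightarrow> reduced (foldr cancel_cons u v)"
  by (induction u) (auto simp: reduced_cancel_cons)

lemma reduced_inverse: "reduced w \<Longrightarrow> reduced (rev (map inv_letter w))"
  unfolding reduced_def successively_rev successively_map
  by (erule successively_mono) (metis inv_letter_inv_letter)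

text \<open>Cancellation does not change the value of a word. For injectivity equal first letters
  are removed; if the first letters differ, the inverse of one word followed by the other is reduced
  and non-empty, but has value one.\<close>

lemma (in group) contains_F2I:
  fixes s :: "F2_letter \<Rightarrow> 'a"
  assumes s: "\<And>a. s a \<in> carrier G" and s_inv: "\<And>a. s (inv_letter a) = inv (s a)"
    and free: "\<And>w. \<lbrakk>reduced w; w \<noteq> []\<rbrakk> \<Longrightarrow> eval_word s w \<noteq> \<one>"
  shows "contains_F2 G"
proof -
  let ?e = "eval_word s" and ?inv = "\<lambda>w. rev (map inv_letter w)"
  have cl [simp]: "?e w \<in> carrier G" for w using s by simp
  have cancel: "?e (cancel_cons a w) = s a \<otimes> ?e w" for a w
    using s s_inv[of a] by (cases w) (auto simp: m_assoc[symmetric])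
  have mult: "?e (foldr cancel_cons u v) = ?e u \<otimes> ?e v" for u v
    using s by (induction u) (auto simp: cancel m_assoc)
  have inv: "?e (?inv w) = inv (?e w)" for w
    using s s_inv by (induction w) (auto simp: eval_word_append inv_mult_group)
  have inj: "u = v" if "reduced u" "reduced v" "?e u = ?e v" for u v
    using that
  proof (induction u arbitrary: v)
    case Nil
    then show ?case using free[of v] by fastforce
  next
    case (Cons a u)
    obtain b v' where v: "v = b # v'" using Cons.prems free[of "a # u"] by (cases v) auto
    show ?case
    proof (cases "a = b")
      case True
      then have "?e u = ?e v'" using Cons.prems v s by simp
      then show ?thesis using Cons v True by (simp add: reduced_Cons)
    next
      case False
      have "reduced (?inv (a # u) @ v)"
        using reduced_inverse[OF Cons.prems(1)] Cons.prems(2) False v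
        unfolding reduced_def by (auto simp: successively_append_iff)
      moreover have "?e (?inv (a # u) @ v) = \<one>"
        using eval_word_append[of s "?inv (a # u)" v] inv[of "a # u"] Cons.prems(3) s
        by (simp add: l_inv[OF cl[of v]])
      ultimately show ?thesis using free[of "?inv (a # u) @ v"] v by simp
    qed
  qed
  let ?H = "?e ` {w. reduced w}"
  have "subgroup ?H G"
  proof
    show "\<one> \<in> ?H" by (rule image_eqI[of _ _ "[]"]) (auto simp: reduced_def)
    show "x \<otimes> y \<in> ?H" if "x \<in> ?H" "y \<in> ?H" for x y
      using that mult[symmetric] reduced_foldr by auto
    show "inv x \<in> ?H" if "x \<in> ?H" for x
      using that inv[symmetric] reduced_inverse by auto
  qed auto
  moreover have "?e \<in> iso F2 (G\<lparr>carrier := ?H\<rparr>)"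
    using mult inj unfolding iso_def hom_def F2_def bij_betw_def inj_on_def by auto
  ultimately show ?thesis unfolding contains_F2_def is_iso_def by blast
qed

context tree_action
begin

text \<open>By induction on \<open>w\<close>, the point \<open>w b\<close> leaves \<open>b\<close> in the direction of the first letter.\<close>

lemma ping_pong:
  assumes s: "\<And>a. s a \<in> carrier G" and s_inv: "\<And>a. s (inv_letter a) = inv (s a)" and b: "b \<in> V"
    and prod: "\<And>a c. a \<noteq> c \<Longrightarrow> d b (\<phi> (s a) b) + d b (\<phi> (s c) b) \<le> C + d (\<phi> (s a) b) (\<phi> (s c) b)"
    and long: "\<And>a. C < d b (\<phi> (s a) b)"
    and w: "reduced w" "w \<noteq> []"
  shows "eval_word s w \<noteq> \<one>"
proof -
  have V: "\<phi> (s a) b \<in> V" "\<phi> (eval_word s w) b \<in> V" for a w using s b by auto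
  have *: "C + d (\<phi> (eval_word s (a # w)) b) (\<phi> (s a) b)
      < d b (\<phi> (eval_word s (a # w)) b) + d b (\<phi> (s a) b)" if "reduced (a # w)" for a w
    using that
  proof (induction w arbitrary: a)
    case Nil
    have "d (\<phi> (s a) b) (\<phi> (s a) b) = 0" using dist_0[OF V(1)[of a] V(1)[of a]] by simp
    then show ?case using long[of a] s b by simp
  next
    case (Cons c w)
    let ?y = "\<phi> (eval_word s (c # w)) b" and ?u = "\<phi> (inv (s a)) b" and ?v = "\<phi> (s c) b"
    have U: "?u \<in> V" "?y \<in> V" "?v \<in> V" using s b by auto
    have x: "\<phi> (eval_word s (a # c # w)) b = \<phi> (s a) ?y"
      using s b composition_rule[of b "s a" "eval_word s (c # w)"] by simp
    have 1: "C + d ?y ?v < d b ?y + d b ?v"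
      using Cons.IH[of c] Cons.prems by (simp add: reduced_Cons)
    have "c \<noteq> inv_letter a" using Cons.prems by (simp add: reduced_Cons)
    then have 2: "d b ?v + d b ?u \<le> C + d ?v ?u" using prod[of c "inv_letter a"] s_inv by simp
    have 3: "C < d b ?u" using long[of "inv_letter a"] s_inv by simp
    have 4: "d (\<phi> (s a) ?y) (\<phi> (s a) b) = d ?y b" using isometry s U b by simp
    have 5: "d b (\<phi> (s a) ?y) = d ?u ?y"
      using dist_act_left[of "inv (s a)" b ?y] s b U by simp
    have 6: "d b (\<phi> (s a) b) = d ?u b"
      using dist_act_left[of "inv (s a)" b b] s b by simp
    \<comment> \<open>\<open>?y\<close> follows \<open>?v\<close> away from \<open>b\<close>, while
      \<open>?u\<close> leaves in another direction, so the path from \<open>?u\<close> to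
      \<open>?y\<close> passes near \<open>b\<close>:
      \<open>d ?u b + d b ?y \<le> C + d ?u ?y\<close>. As \<open>d b ?u > C\<close>, this is the
      claim after applying \<open>s a\<close>.\<close>
    have "d ?v ?u + d b ?y \<le> max (d ?v b + d ?u ?y) (d ?v ?y + d ?u b)"
      using four_point[OF U(3,1) b U(2)] .
    then show ?case
      unfolding x 4 5 6
      using 1 2 3 dist_sym[OF U(1) b] dist_sym[OF U(2) b] dist_sym[OF U(3) b] dist_sym[OF U(3,2)]
      by linarith
  qed
  obtain a w' where aw: "w = a # w'" using w by (cases w) auto
  show ?thesis
  proof
    assume "eval_word s w = \<one>"
    moreover have "C + d (\<phi> (eval_word s w) b) (\<phi> (s a) b)
        < d b (\<phi> (eval_word s w) b) + d b (\<phi> (s a) b)"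
      using * w(1) unfolding aw by blast
    ultimately show False using b dist_0[OF b b] by simp
  qed
qed

text \<open>The four ends of the two axes are distinct, so rays towards them have bounded Gromov
  products at \<open>p\<close>, while their distances from \<open>p\<close> grow. Far enough out
  this is the input of \<open>ping_pong\<close>.\<close>

lemma not_share_end_contains_F2:
  assumes axg: "axis g p t" and axh: "axis h q u" and not_share: "\<not> share_end g p h q"
  shows "contains_F2 G"
proof -
  have g: "g \<in> carrier G" "p \<in> V" "h \<in> carrier G" "q \<in> V" using axisD axg axh by auto
  define r :: "F2_letter \<Rightarrow> 'g" where
    "r a = (case a of (x, e) \<Rightarrow> let y = if x then g else h in if e then inv y else y)" for a
  define X where "X a = ray (r a) p" for a
  have r: "r a \<in> carrier G" for a using g by (auto simp: r_def Let_def split: prod.splits)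
  have X: "X a n \<in> V" for a n using r g by (simp add: X_def)
  \<comment> \<open>The orbits of \<open>q\<close> and \<open>p\<close> under powers of
    \<open>k\<close> stay at distance \<open>d q p\<close>, so all four rays may start at
    \<open>p\<close>.\<close>
  have near: "asymptotic (ray k q) (ray k p)" if k: "axis k q u" for k
  proof (rule asymptotic_bounded[OF ray_asymptotic[OF k], of _ "d q p"])
    fix n
    show "ray k p n \<in> V" using axisD[OF k] g by simp
    show "d (ray k q n) (ray k p n) \<le> d q p"
      using axisD[OF k] g isometry[of "k [^] n" q p] by (simp add: ray_def)
  qed
  have Xg: "X (True, e) = ray (if e then inv g else g) p" for e by (simp add: X_def r_def)
  have Xh: "asymptotic (ray (if e then inv h else h) q) (X (False, e))" for e
    using near[OF axh] near[OF axis_inv[OF axh]] by (simp add: X_def r_def)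
  have refl: "asymptotic (X a) (X a)" for a
  proof -
    have "asymptotic (X (True, e)) (X (True, e))" for e
      using ray_asymptotic[OF axg] ray_asymptotic[OF axis_inv[OF axg]] by (simp add: Xg)
    moreover have "asymptotic (X (False, e)) (X (False, e))" for e using asymptotic_refl2[OF Xh] .
    ultimately show ?thesis by (cases a; cases "fst a") auto
  qed
  have different: "\<not> asymptotic (X a) (X c)" if "a \<noteq> c" for a c
  proof -
    have 1: "\<not> asymptotic (X (True, e)) (X (False, e'))" for e e'
    proof
      assume "asymptotic (X (True, e)) (X (False, e'))"
      from asymptotic_trans[OF this asymptotic_sym[OF Xh]]
      show False using not_share unfolding share_end_def Xg by (cases e; cases e') simp_all
    qed
    have 2: "\<not> asymptotic (X (True, False)) (X (True, True))"
      using ray_not_asymptotic[OF axg] by (simp add: Xg)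
    have 3: "\<not> asymptotic (X (False, False)) (X (False, True))"
    proof
      assume "asymptotic (X (False, False)) (X (False, True))"
      from asymptotic_trans[OF asymptotic_trans[OF Xh this] asymptotic_sym[OF Xh]]
      show False using ray_not_asymptotic[OF axh] by simp
    qed
    obtain x e y f where ac: "a = (x, e)" "c = (y, f)" by (cases a; cases c)
    show ?thesis
    proof
      assume as: "asymptotic (X a) (X c)"
      note as' = asymptotic_sym[OF as]
      show False
        using that as as' 1[of e f] 1[of f e] 2 3 unfolding ac
        by (cases x; cases e; cases y; cases f) simp_all
    qed
  qed
  have "\<exists>C. \<forall>\<^sub>F n in sequentially. a \<noteq> c \<longrightarrow> d p (X a n) + d p (X c n) \<le> C + d (X a n) (X c n)" for a c
  proof (cases "a = c")
    case False
    then obtain C N where "\<forall>m\<ge>N. \<forall>n\<ge>N. d p (X a m) + d p (X c n) \<le> C + d (X a m) (X c n)"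
      using asymptotic_bounded_product[OF refl refl different g(2)] by blast
    then show ?thesis by (auto simp: eventually_sequentially)
  qed auto
  then obtain C where C: "\<And>a c. \<forall>\<^sub>F n in sequentially. a \<noteq> c \<longrightarrow>
      d p (X a n) + d p (X c n) \<le> C a c + d (X a n) (X c n)" by metis
  \<comment> \<open>The sum is a crude upper bound for the finitely many constants
    \<open>C a c\<close>.\<close>
  define D where "D = (\<Sum>a\<in>UNIV. \<Sum>c\<in>UNIV. C a c)"
  have CD: "C a c \<le> D" for a c
    unfolding D_def using member_le_sum[of c UNIV "C a"] member_le_sum[of a UNIV "\<lambda>a. \<Sum>c\<in>UNIV. C a c"]
    by simp
  have "\<forall>\<^sub>F n in sequentially. (\<forall>a c. a \<noteq> c \<longrightarrow>
      d p (X a n) + d p (X c n) \<le> D + d (X a n) (X c n)) \<and> (\<forall>a. D < d p (X a n))"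
  proof (intro eventually_conj eventually_all_finite)
    show "\<forall>\<^sub>F n in sequentially. a \<noteq> c \<longrightarrow> d p (X a n) + d p (X c n) \<le> D + d (X a n) (X c n)" for a c
      using C[of a c] by eventually_elim (use CD[of a c] in auto)
    show "\<forall>\<^sub>F n in sequentially. D < d p (X a n)" for a
    proof -
      obtain N where "\<And>m n. \<lbrakk>m \<ge> N; n \<ge> N\<rbrakk> \<Longrightarrow>
          (2 * D + 1) + d (X a m) (X a n) \<le> d p (X a m) + d p (X a n)"
        using asymptoticD[OF refl g(2)] by blast
      from this[of n n for n] have "D < d p (X a n)" if "n \<ge> N" for n using that by fastforce
      then show ?thesis by (auto simp: eventually_sequentially)
    qed
  qed
  from eventually_happens'[OF sequentially_bot this]
  obtain M where M: "\<forall>a c. a \<noteq> c \<longrightarrow> d p (X a M) + d p (X c M) \<le> D + d (X a M) (X c M)"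
    "\<forall>a. D < d p (X a M)" by blast
  \<comment> \<open>The index \<open>M\<close> becomes an exponent: the point with index
    \<open>M\<close> on a ray is the image of \<open>p\<close> under this power.\<close>
  define s where "s a = r a [^] M" for a
  have s: "s a \<in> carrier G" for a using r by (simp add: s_def)
  have s_inv: "s (inv_letter a) = inv (s a)" for a
    using g by (auto simp: s_def r_def Let_def inv_letter_def nat_pow_inv split: prod.splits)
  have X_s: "X a M = \<phi> (s a) p" for a by (simp add: X_def ray_def s_def)
  have free: "eval_word s w \<noteq> \<one>" if "reduced w" "w \<noteq> []" for w
    by (rule ping_pong[of s p D w]) (use s s_inv g M[unfolded X_s] that in blast)+
  show ?thesis by (rule contains_F2I[of s]) (use s s_inv free in blast)+
qed

end

section \<open>Actions of general type\<close>

context graph_tree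
begin

sublocale tree_metric "verts T" "gdist T"
  by (rule tree_metric_gdist)

lemma gdist_automorphism_le:
  assumes f: "graph_automorphism T f" and u: "u \<in> verts T" and v: "v \<in> verts T"
  shows "gdist T (f u) (f v) \<le> gdist T u v"
proof -
  obtain p where p: "walk T u p v" "length p = Suc (gdist T u v)" using gdist_walk u v by metis
  then have sub: "set p \<subseteq> verts T" and "successively (adj T) p" by (simp_all add: walk_def)
  then have "successively (\<lambda>x y. adj T (f x) (f y)) p"
    using f unfolding graph_automorphism_def by (elim successively_mono) blast
  then have "walk T (f u) (map f p) (f v)"
    using p f sub unfolding walk_def graph_automorphism_def bij_betw_def
    by (auto simp: successively_map hd_map last_map)
  then show ?thesis using gdist_le p by fastforce
qed

lemma gromov_related_iff:
  assumes x: "range x \<subseteq> verts T" and y: "range y \<subseteq> verts T"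
  shows "gromov_related T x y \<longleftrightarrow> asymptotic x y"
proof
  assume *: "gromov_related T x y"
  show "asymptotic x y"
    unfolding asymptotic_def
  proof (intro conjI x y ballI allI)
    fix b C assume "b \<in> verts T"
    then have "\<forall>\<^sub>F (m, n) in sequentially \<times>\<^sub>F sequentially. real C \<le> gromov_product T b (x m) (y n)"
      using * unfolding gromov_related_def filterlim_at_top by (auto simp: case_prod_unfold)
    then obtain N where N: "\<And>m n. \<lbrakk>m \<ge> N; n \<ge> N\<rbrakk> \<Longrightarrow> real C \<le> gromov_product T b (x m) (y n)"
      unfolding eventually_prod_sequentially by auto
    have "C + gdist T (x m) (y n) \<le> gdist T b (x m) + gdist T b (y n)" if "m \<ge> N" "n \<ge> N" for m n
      using N[OF that] unfolding gromov_product_def by (simp add: field_simps)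
    then show "\<exists>N. \<forall>m\<ge>N. \<forall>n\<ge>N. C + gdist T (x m) (y n) \<le> gdist T b (x m) + gdist T b (y n)" by blast
  qed
next
  assume *: "asymptotic x y"
  show "gromov_related T x y"
    unfolding gromov_related_def filterlim_at_top
  proof (intro ballI allI)
    fix b and Z :: real assume "b \<in> verts T"
    \<comment> \<open>\<open>asymptotic\<close> bounds twice the Gromov product by natural numbers,
      hence the factor 2 and the truncation at 0.\<close>
    then obtain N where N: "\<And>m n. \<lbrakk>m \<ge> N; n \<ge> N\<rbrakk> \<Longrightarrow>
        nat \<lceil>2 * Z\<rceil> + gdist T (x m) (y n) \<le> gdist T b (x m) + gdist T b (y n)"
      using asymptoticD[OF *] by blast
    have "Z \<le> gromov_product T b (x m) (y n)" if "m \<ge> N" "n \<ge> N" for m n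
    proof -
      have "2 * Z \<le> real (nat \<lceil>2 * Z\<rceil>)" by linarith
      then show ?thesis
        using N[OF that, THEN of_nat_mono[where 'a = real]] unfolding gromov_product_def by simp
    qed
    then show "\<forall>\<^sub>F z in sequentially \<times>\<^sub>F sequentially. Z \<le> (case z of (m, n) \<Rightarrow> gromov_product T b (x m) (y n))"
      unfolding eventually_prod_sequentially by auto
  qed
qed

lemma converging_seqs_eq: "converging_seqs T = {x. asymptotic x x}"
  unfolding converging_seqs_def using gromov_related_iff by (auto simp: asymptotic_def)

lemma boundary_eq: "boundary T = {{y. asymptotic x y} | x. asymptotic x x}"
proof -
  have "{(x, y). x \<in> converging_seqs T \<and> y \<in> converging_seqs T \<and> gromov_related T x y} =
      {(x, y). asymptotic x y}"
  proof -
    have "x \<in> converging_seqs T \<and> y \<in> converging_seqs T \<and> gromov_related T x y \<longleftrightarrow> asymptotic x y" for x y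
    proof -
      have "gromov_related T x y \<longleftrightarrow> asymptotic x y" if "asymptotic x x" "asymptotic y y"
        using gromov_related_iff[of x y] that unfolding asymptotic_def[of x x] asymptotic_def[of y y]
        by blast
      then show ?thesis
        using asymptotic_refl1[of x y] asymptotic_refl2[of x y] unfolding converging_seqs_eq by blast
    qed
    then show ?thesis by simp
  qed
  then show ?thesis
    unfolding boundary_def quotient_def converging_seqs_eq by auto
qed

end

locale graph_tree_action = graph_tree T + group_action G "verts T" \<psi>
  for T :: "'v sgraph" and G :: "('g, 'm) monoid_scheme" (structure) and \<psi> +
  assumes automorphism: "g \<in> carrier G \<Longrightarrow> graph_automorphism T (\<psi> g)"
begin

sublocale tree_action "verts T" "gdist T" G \<psi>
proof
  interpret group G using group_hom group_hom.axioms(1) by blast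
  fix g x y assume g: "g \<in> carrier G" and V: "x \<in> verts T" "y \<in> verts T"
  have W: "\<psi> g x \<in> verts T" "\<psi> g y \<in> verts T" using g V element_image by blast+
  have "gdist T (\<psi> (inv g) (\<psi> g x)) (\<psi> (inv g) (\<psi> g y)) \<le> gdist T (\<psi> g x) (\<psi> g y)"
    using gdist_automorphism_le[OF automorphism W] g by simp
  then show "gdist T (\<psi> g x) (\<psi> g y) = gdist T x y"
    using gdist_automorphism_le[OF automorphism[OF g] V] orbit_sym_aux[OF g V(1) refl]
      orbit_sym_aux[OF g V(2) refl] by simp
qed

lemma mem_limit_set:
  "\<xi> \<in> limit_set H T \<chi> \<longleftrightarrow> (\<exists>y. \<xi> = {z. asymptotic y z} \<and> asymptotic y y \<and>
     (\<exists>v\<in>verts T. range y \<subseteq> orbit H \<chi> v))"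
proof
  assume "\<xi> \<in> limit_set H T \<chi>"
  then obtain x y v where x: "\<xi> = {z. asymptotic x z}" and y: "asymptotic x y"
    and v: "v \<in> verts T" "range y \<subseteq> orbit H \<chi> v"
    unfolding limit_set_def boundary_eq by blast
  have "\<xi> = {z. asymptotic y z}" unfolding x using y asymptotic_sym asymptotic_trans by blast
  then show "\<exists>y. \<xi> = {z. asymptotic y z} \<and> asymptotic y y \<and> (\<exists>v\<in>verts T. range y \<subseteq> orbit H \<chi> v)"
    using v asymptotic_refl2[OF y] by blast
next
  assume "\<exists>y. \<xi> = {z. asymptotic y z} \<and> asymptotic y y \<and> (\<exists>v\<in>verts T. range y \<subseteq> orbit H \<chi> v)"
  then show "\<xi> \<in> limit_set H T \<chi>" unfolding limit_set_def boundary_eq by blast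
qed

lemma mem_elt_limit_set:
  assumes "g \<in> carrier G"
  shows "\<xi> \<in> elt_limit_set G T \<psi> g \<longleftrightarrow> (\<exists>y. \<xi> = {z. asymptotic y z} \<and> asymptotic y y \<and>
     (\<exists>v\<in>verts T. \<forall>n. \<exists>k :: int. y n = \<psi> (g [^] k) v))"
proof -
  have eq: "range y \<subseteq> orbit (G\<lparr>carrier := generate G {g}\<rparr>) \<psi> v \<longleftrightarrow> (\<forall>n. \<exists>k :: int. y n = \<psi> (g [^] k) v)" for y v
    unfolding orbit_def generate_pow[OF assms] by (auto simp: image_subset_iff)
  show ?thesis unfolding elt_limit_set_def mem_limit_set eq by (rule refl)
qed

lemma int_pow_act_comm:
  assumes "g \<in> carrier G" "v \<in> verts T"
  shows "\<psi> g (\<psi> (g [^] (k :: int)) v) = \<psi> (g [^] k) (\<psi> g v)"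
proof -
  have "g \<otimes> g [^] k = g [^] k \<otimes> g"
    using int_pow_mult[OF assms(1), of 1 k] int_pow_mult[OF assms(1), of k 1] assms by (simp add: add.commute)
  then show ?thesis using assms by (metis composition_rule int_pow_closed)
qed

text \<open>\<open>g\<close> commutes with its powers, so it moves all points of the orbit of
  \<open>v\<close> by the same distance, and \<open>asymptotic_bounded\<close> applies.\<close>

lemma elt_limit_set_fixed:
  assumes g: "g \<in> carrier G" and v: "v \<in> verts T" and yy: "asymptotic y y"
    and y: "\<And>n. \<exists>k :: int. y n = \<psi> (g [^] k) v"
  shows "asymptotic (\<psi> g \<circ> y) y"
proof (rule asymptotic_sym, rule asymptotic_bounded[OF yy])
  fix n
  show "(\<psi> g \<circ> y) n \<in> verts T" using g asymptotic_in(1)[OF yy] by simp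
  obtain k :: int where "y n = \<psi> (g [^] k) v" using y by blast
  then show "gdist T (y n) ((\<psi> g \<circ> y) n) \<le> gdist T v (\<psi> g v)"
    using g v int_pow_act_comm[OF g v] isometry[of "g [^] k" v "\<psi> g v"] by simp
qed

lemma ray_in_elt_limit_set:
  assumes ax: "axis g p t"
  shows "{z. asymptotic (ray g p) z} \<in> elt_limit_set G T \<psi> g"
    and "{z. asymptotic (ray (inv g) p) z} \<in> elt_limit_set G T \<psi> g"
proof -
  have g: "g \<in> carrier G" "p \<in> verts T" using axisD[OF ax] by auto
  have "ray g p n = \<psi> (g [^] int n) p" "ray (inv g) p n = \<psi> (g [^] (- int n)) p" for n
    using g by (simp_all add: ray_def int_pow_int nat_pow_inv int_pow_neg)
  then show "{z. asymptotic (ray g p) z} \<in> elt_limit_set G T \<psi> g"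
    "{z. asymptotic (ray (inv g) p) z} \<in> elt_limit_set G T \<psi> g"
    unfolding mem_elt_limit_set[OF g(1)] using ray_asymptotic[OF ax] ray_asymptotic[OF axis_inv[OF ax]] g(2)
    by blast+
qed

text \<open>The limit set of a translation consists of the two ends of its axis: any point of it is
  fixed by the translation, and \<open>fixed_end\<close> leaves no other choice.\<close>

lemma elt_limit_sets_disjoint_iff:
  assumes axg: "axis g p t" and axh: "axis h q u"
  shows "elt_limit_set G T \<psi> g \<inter> elt_limit_set G T \<psi> h = {} \<longleftrightarrow> \<not> share_end g p h q"
proof
  have eq: "{z. asymptotic x z} = {z. asymptotic y z}" if "asymptotic x y" for x y
    using that asymptotic_sym asymptotic_trans by blast
  assume *: "elt_limit_set G T \<psi> g \<inter> elt_limit_set G T \<psi> h = {}"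
  have "\<not> asymptotic x y" if "x \<in> {ray g p, ray (inv g) p}" "y \<in> {ray h q, ray (inv h) q}" for x y
    using * eq[of x y] that ray_in_elt_limit_set[OF axg] ray_in_elt_limit_set[OF axh] by auto
  then show "\<not> share_end g p h q" unfolding share_end_def by simp
next
  assume *: "\<not> share_end g p h q"
  have g: "g \<in> carrier G" "h \<in> carrier G" using axisD axg axh by auto
  show "elt_limit_set G T \<psi> g \<inter> elt_limit_set G T \<psi> h = {}"
  proof (rule equals0I)
    fix \<xi> assume "\<xi> \<in> elt_limit_set G T \<psi> g \<inter> elt_limit_set G T \<psi> h"
    then have \<xi>: "\<xi> \<in> elt_limit_set G T \<psi> g" "\<xi> \<in> elt_limit_set G T \<psi> h" by auto
    obtain y v where y: "\<xi> = {x. asymptotic y x}" "asymptotic y y" "v \<in> verts T"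
        "\<And>n. \<exists>k :: int. y n = \<psi> (g [^] k) v"
      using \<xi>(1) unfolding mem_elt_limit_set[OF g(1)] by blast
    obtain z w where z: "\<xi> = {x. asymptotic z x}" "asymptotic z z" "w \<in> verts T"
        "\<And>n. \<exists>k :: int. z n = \<psi> (h [^] k) w"
      using \<xi>(2) unfolding mem_elt_limit_set[OF g(2)] by blast
    have "asymptotic y (ray g p) \<or> asymptotic y (ray (inv g) p)"
      using fixed_end[OF elt_limit_set_fixed[OF g(1) y(3,2,4)] axg] .
    moreover have "asymptotic z (ray h q) \<or> asymptotic z (ray (inv h) q)"
      using fixed_end[OF elt_limit_set_fixed[OF g(2) z(3,2,4)] axh] .
    moreover have "asymptotic y z" using y(1) z(1,2) by blast
    moreover have "asymptotic a b" if "asymptotic y a" "asymptotic z b" for a b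
      using that \<open>asymptotic y z\<close> asymptotic_sym asymptotic_trans by blast
    ultimately show False using * unfolding share_end_def by blast
  qed
qed

text \<open>Displacements on the axis are exact multiples of \<open>t\<close>, so the constants
  \<open>l = t\<close> and \<open>c = 0\<close> suffice; the lower bound uses
  \<open>t \<ge> 1\<close>.\<close>

lemma axis_loxodromic:
  assumes ax: "axis g p t"
  shows "loxodromic G T \<psi> g"
proof -
  have g: "g \<in> carrier G" "p \<in> verts T" "t > 0" using axisD[OF ax] by auto
  have le: "gdist T (\<psi> (g [^] m) p) (\<psi> (g [^] (m + int k)) p) = k * t" for m :: int and k
  proof -
    have "\<psi> (g [^] (m + int k)) p = \<psi> (g [^] m) (ray g p k)"
      using g by (simp add: int_pow_mult composition_rule ray_def int_pow_int)
    then show ?thesis using isometry[of "g [^] m" p "ray g p k"] axis_ray_0[OF ax] g by simp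
  qed
  have "gdist T (\<psi> (g [^] m) p) (\<psi> (g [^] n) p) = nat \<bar>m - n\<bar> * t" for m n :: int
  proof (cases "m \<le> n")
    case True
    then show ?thesis using le[of m "nat (n - m)"] by simp
  next
    case False
    then show ?thesis using le[of n "nat (m - n)"] g dist_sym[of "\<psi> (g [^] m) p" "\<psi> (g [^] n) p"] by simp
  qed
  then have d: "real (gdist T (\<psi> (g [^] m) p) (\<psi> (g [^] n) p)) = real t * real_of_int \<bar>m - n\<bar>" for m n :: int
    by simp
  have "real_of_int \<bar>m - n\<bar> / real t - 0 \<le> real t * real_of_int \<bar>m - n\<bar>" for m n
  proof -
    have "real_of_int \<bar>m - n\<bar> / real t \<le> real_of_int \<bar>m - n\<bar> / 1"
      using g by (intro divide_left_mono) auto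
    also have "\<dots> \<le> real t * real_of_int \<bar>m - n\<bar>" using g by (simp add: mult_le_cancel_right1)
    finally show ?thesis by simp
  qed
  then show ?thesis
    unfolding loxodromic_def d using g(2,3)
    by - (rule bexI[OF _ g(2)], rule exI[of _ "real t"], rule exI[of _ 0], auto simp: d)
qed

text \<open>Without an axis some vertex \<open>z\<close> has an orbit of at most two points under
  the powers of \<open>g\<close>. Then the orbit of \<open>v\<close> stays within \<open>D\<close>
  of \<open>v\<close>, against the linear lower bound.\<close>

lemma loxodromic_axis:
  assumes g: "g \<in> carrier G" and lox: "loxodromic G T \<psi> g"
  shows "\<exists>p t. axis g p t"
proof (rule ccontr)
  assume no: "\<not> ?thesis"
  then obtain z where z: "z \<in> verts T" and "\<psi> g z = z \<or> gdist T z (\<psi> g z) = 1 \<and> \<psi> g (\<psi> g z) = z"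
    using minimal_displacement[OF g] by blast
  then have z2: "gdist T z (\<psi> g z) \<le> 1" "\<psi> g (\<psi> g z) = z" using dist_0[OF z z] by auto
  have bnd: "ray g z n = z \<or> ray g z n = \<psi> g z" for n
    by (induction n) (use z z2 g in \<open>auto simp: ray_Suc\<close>)
  obtain v l c where v: "v \<in> verts T" "l \<ge> 1" and
    lo: "\<And>m n :: int. real_of_int \<bar>m - n\<bar> / l - c \<le> real (gdist T (\<psi> (g [^] m) v) (\<psi> (g [^] n) v))"
    using lox unfolding loxodromic_def by blast
  define D where "D = real (2 * gdist T v z + 1)"
  have "real n \<le> l * (D + c)" for n
  proof -
    have "gdist T (ray g v n) v \<le> gdist T (ray g v n) (ray g z n) + gdist T (ray g z n) z + gdist T z v"
      using triangle[of "ray g v n" "ray g z n" v] triangle[of "ray g z n" z v] g v z by simp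
    also have "gdist T (ray g v n) (ray g z n) = gdist T v z"
      using isometry g v z by (simp add: ray_def)
    also have "gdist T (ray g z n) z \<le> 1"
      using bnd[of n] dist_0[OF z z] z2 dist_sym[of "\<psi> g z" z] g z by auto
    finally have "real (gdist T (ray g v n) v) \<le> D" using dist_sym[OF v(1) z] by (simp add: D_def)
    moreover have "real n / l - c \<le> real (gdist T (ray g v n) v)"
      using lo[of "int n" 0] v(1) by (simp add: ray_def int_pow_int)
    ultimately have "real n / l \<le> D + c" by linarith
    then show ?thesis using v(2) by (simp add: field_simps)
  qed
  then show False using reals_Archimedean2[of "l * (D + c)"] by (meson not_le)
qed

text \<open>The images of an end of \<open>g\<close> under the powers of \<open>h\<close> are
  distinct: otherwise a positive power of \<open>h\<close> would fix this end, which would then be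
  an end of \<open>h\<close>.\<close>

lemma not_share_end_infinite_limit_set:
  assumes axg: "axis g p t" and axh: "axis h q u" and not_share: "\<not> share_end g p h q"
  shows "infinite (limit_set G T \<psi>)"
proof -
  have g: "g \<in> carrier G" "p \<in> verts T" "h \<in> carrier G" "q \<in> verts T" using axisD axg axh by auto
  define E where "E n = \<psi> (h [^] (n :: nat)) \<circ> ray g p" for n
  have EE: "asymptotic (E n) (E n)" for n
    using asymptotic_act[OF ray_asymptotic[OF axg], of "h [^] n"] g by (simp add: E_def)
  have "{z. asymptotic (E n) z} \<in> limit_set G T \<psi>" for n
  proof -
    have "E n m = \<psi> (h [^] n \<otimes> g [^] m) p" for m
      using g by (simp add: E_def ray_def composition_rule)
    then have "range (E n) \<subseteq> orbit G \<psi> p" using g unfolding orbit_def by auto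
    then show ?thesis using EE g unfolding mem_limit_set by blast
  qed
  moreover have "inj (\<lambda>n. {z. asymptotic (E n) z})"
  proof (rule linorder_injI)
    fix i j :: nat assume ij: "i < j"
    show "{z. asymptotic (E i) z} \<noteq> {z. asymptotic (E j) z}"
    proof
      assume "{z. asymptotic (E i) z} = {z. asymptotic (E j) z}"
      then have as: "asymptotic (\<psi> (h [^] i) \<circ> ray g p) (E j)" using EE by (auto simp: E_def)
      have j: "h [^] j = h [^] i \<otimes> h [^] (j - i)" using nat_pow_mult[of h i "j - i"] g ij by simp
      have Ej: "E j = \<psi> (h [^] i) \<circ> (\<psi> (h [^] (j - i)) \<circ> ray g p)"
        unfolding E_def j by (rule act_comp[symmetric]) (use g in simp_all)
      have "asymptotic (ray g p) (\<psi> (inv (h [^] i)) \<circ> E j)"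
        using asymptotic_act_inv[OF as] g by simp
      also have "\<psi> (inv (h [^] i)) \<circ> E j = \<psi> (h [^] (j - i)) \<circ> ray g p"
        unfolding Ej using g by fastforce
      finally have fx: "asymptotic (\<psi> (h [^] (j - i)) \<circ> ray g p) (ray g p)" by (rule asymptotic_sym)
      have pos: "j - i > 0" using ij by simp
      have "asymptotic (ray g p) (ray h q) \<or> asymptotic (ray g p) (ray (inv h) q)"
        using fixed_end[OF fx axis_power[OF axh pos]] ray_power_asymptotic[OF axh pos]
          ray_power_asymptotic[OF axis_inv[OF axh] pos] nat_pow_inv[OF g(3)] asymptotic_trans by metis
      then show False using not_share unfolding share_end_def by blast
    qed
  qed
  ultimately show ?thesis
    by (meson finite_subset image_subsetI infinite_UNIV_nat finite_imageD inj_on_def)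
qed

lemma general_type_iff:
  "general_type G T \<psi> \<longleftrightarrow> (\<exists>g p t h q u. axis g p t \<and> axis h q u \<and> \<not> share_end g p h q)"
proof
  assume "general_type G T \<psi>"
  then obtain g h where g: "g \<in> carrier G" "h \<in> carrier G" "loxodromic G T \<psi> g" "loxodromic G T \<psi> h"
    and disj: "elt_limit_set G T \<psi> g \<inter> elt_limit_set G T \<psi> h = {}" unfolding general_type_def by blast
  obtain p t where axg: "axis g p t" using loxodromic_axis[OF g(1,3)] by blast
  obtain q u where axh: "axis h q u" using loxodromic_axis[OF g(2,4)] by blast
  have "\<not> share_end g p h q" using elt_limit_sets_disjoint_iff[OF axg axh] disj by simp
  with axg axh show "\<exists>g p t h q u. axis g p t \<and> axis h q u \<and> \<not> share_end g p h q"
    by blast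
next
  assume "\<exists>g p t h q u. axis g p t \<and> axis h q u \<and> \<not> share_end g p h q"
  then obtain g p t h q u where ax: "axis g p t" "axis h q u" and no: "\<not> share_end g p h q"
    by (elim exE conjE)
  then show "general_type G T \<psi>"
    unfolding general_type_def
    using not_share_end_infinite_limit_set[OF ax no] elt_limit_sets_disjoint_iff[OF ax]
      axis_loxodromic[OF ax(1)] axis_loxodromic[OF ax(2)] axisD(1)[OF ax(1)] axisD(1)[OF ax(2)] no
    by (intro conjI bexI[of _ g] bexI[of _ h]) simp_all
qed

lemma general_type_contains_F2: "general_type G T \<psi> \<Longrightarrow> contains_F2 G"
  unfolding general_type_iff using not_share_end_contains_F2 by blast

end

section \<open>Subgroups of finite index and homomorphisms to the integers\<close>

lemma finite_image_factor:
  assumes "finite (f ` A)" and "\<And>a b. \<lbrakk>a \<in> A; b \<in> A; f a = f b\<rbrakk> \<Longrightarrow> g a = g b"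
  shows "finite (g ` A)"
proof -
  have "g ` A \<subseteq> (\<lambda>y. g (SOME a. a \<in> A \<and> f a = y)) ` f ` A"
  proof
    fix z assume "z \<in> g ` A"
    then obtain a where a: "a \<in> A" "z = g a" by blast
    then have "(SOME b. b \<in> A \<and> f b = f a) \<in> A \<and> f (SOME b. b \<in> A \<and> f b = f a) = f a"
      by (intro someI_ex[of "\<lambda>b. b \<in> A \<and> f b = f a"]) blast
    then have "g (SOME b. b \<in> A \<and> f b = f a) = z" using a assms(2) by blast
    then show "z \<in> (\<lambda>y. g (SOME a. a \<in> A \<and> f a = y)) ` f ` A"
      using a(1) by (intro image_eqI[of _ _ "f a"]) auto
  qed
  then show ?thesis using assms(1) finite_subset by blast
qed

context group
begin

lemma rcosets_image: "rcosets H = (\<lambda>a. H #> a) ` carrier G"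
  by (auto simp: RCOSETS_def)

lemma r_coset_eq_iff:
  assumes "subgroup H G" "a \<in> carrier G" "b \<in> carrier G"
  shows "H #> a = H #> b \<longleftrightarrow> a \<otimes> inv b \<in> H"
  using assms subgroup.rcos_module[OF assms(1) is_group, of b a] rcos_self[OF assms(2,1)]
    repr_independence[of a H b] by auto

lemma finite_index_carrier: "finite_index (carrier G) G"
proof -
  have "rcosets (carrier G) \<subseteq> {carrier G}"
    unfolding rcosets_image using coset_join2[OF _ subgroup_self] by blast
  then show ?thesis unfolding finite_index_def using subgroup_self finite_subset by blast
qed

text \<open>A coset of \<open>K\<close> is determined by the coset of \<open>H\<close> containing it
  and by a finite colouring \<open>c\<close> of \<open>H\<close>, evaluated after division by a
  representative. Most index statements below are instances with a suitable colouring.\<close>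

lemma finite_index_refine:
  assumes H: "finite_index H G" and K: "subgroup K G" "K \<subseteq> H"
    and c: "finite (c ` H)" "\<And>x y. \<lbrakk>x \<in> H; y \<in> H; c x = c y\<rbrakk> \<Longrightarrow> x \<otimes> inv y \<in> K"
  shows "finite_index K G"
proof -
  have sH: "subgroup H G" "finite (rcosets H)" using H by (auto simp: finite_index_def)
  \<comment> \<open>The choice depends on \<open>a\<close> only through \<open>H #> a\<close>, so
    elements of one coset get the same representative.\<close>
  define r where "r a = (SOME x. x \<in> H #> a)" for a
  have r: "r a \<in> H #> a" if "a \<in> carrier G" for a
    unfolding r_def using rcos_self[OF that sH(1)] by (rule someI)
  have rG: "r a \<in> carrier G" if "a \<in> carrier G" for a
    using r[OF that] r_coset_subset_G[OF subgroup.subset[OF sH(1)] that] by blast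
  have rH: "a \<otimes> inv (r a) \<in> H" if "a \<in> carrier G" for a
    using r_coset_eq_iff[OF sH(1) that rG[OF that]] repr_independence[OF r[OF that] that sH(1)] by simp
  have "finite ((\<lambda>a. K #> a) ` carrier G)"
  proof (rule finite_image_factor)
    have "(\<lambda>a. (H #> a, c (a \<otimes> inv (r a)))) ` carrier G \<subseteq> (rcosets H) \<times> c ` H"
      using rH unfolding rcosets_image by blast
    then show "finite ((\<lambda>a. (H #> a, c (a \<otimes> inv (r a)))) ` carrier G)"
      using sH(2) c(1) finite_subset by blast
    fix a b assume ab: "a \<in> carrier G" "b \<in> carrier G"
      and eq: "(H #> a, c (a \<otimes> inv (r a))) = (H #> b, c (b \<otimes> inv (r b)))"
    then have "r a = r b" by (simp add: r_def)
    then have "(a \<otimes> inv (r a)) \<otimes> inv (b \<otimes> inv (r a)) \<in> K"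
      using c(2)[OF rH[OF ab(1)] rH[OF ab(2)]] eq by simp
    also have "(a \<otimes> inv (r a)) \<otimes> inv (b \<otimes> inv (r a)) = a \<otimes> inv b"
      using ab rG[OF ab(1)] by (simp add: inv_mult_group m_assoc) (simp add: m_assoc[symmetric])
    finally show "K #> a = K #> b" using r_coset_eq_iff[OF K(1) ab] by simp
  qed
  then show ?thesis using K(1) unfolding finite_index_def rcosets_image by blast
qed

lemma finite_index_mono:
  assumes H: "finite_index H G" and K: "subgroup K G" "H \<subseteq> K"
  shows "finite_index K G"
proof -
  have sH: "subgroup H G" "finite (rcosets H)" using H by (auto simp: finite_index_def)
  have "finite ((\<lambda>a. K #> a) ` carrier G)"
    by (rule finite_image_factor[OF sH(2)[unfolded rcosets_image]])
       (use r_coset_eq_iff[OF sH(1)] r_coset_eq_iff[OF K(1)] K(2) in blast)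
  then show ?thesis using K(1) unfolding finite_index_def rcosets_image by blast
qed

lemma finite_index_Int:
  assumes H: "finite_index H G" and K: "finite_index K G"
  shows "finite_index (H \<inter> K) G"
proof (rule finite_index_refine[OF H, where c = "\<lambda>x. K #> x"])
  have s: "subgroup H G" "subgroup K G" "finite (rcosets K)"
    using H K by (auto simp: finite_index_def)
  show "subgroup (H \<inter> K) G" using subgroups_Inter_pair s by blast
  show "finite ((\<lambda>x. K #> x) ` H)"
    by (rule finite_subset[OF _ s(3)]) (use subgroup.subset[OF s(1)] in \<open>auto simp: rcosets_image\<close>)
  show "x \<otimes> inv y \<in> H \<inter> K" if "x \<in> H" "y \<in> H" "K #> x = K #> y" for x y
    using that r_coset_eq_iff[OF s(2)] subgroup.m_closed[OF s(1)] subgroup.m_inv_closed[OF s(1)]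
      subgroup.mem_carrier[OF s(1)] by blast
qed auto

lemma finite_index_trans:
  assumes H: "finite_index H G" and A: "finite_index A (G\<lparr>carrier := H\<rparr>)"
  shows "finite_index A G"
proof (rule finite_index_refine[OF H, where c = "\<lambda>x. A #> x"])
  have s: "subgroup H G" "subgroup A (G\<lparr>carrier := H\<rparr>)"
    using H A by (auto simp: finite_index_def)
  show AG: "subgroup A G" using incl_subgroup[OF s] .
  show AH: "A \<subseteq> H" using subgroup.subset[OF s(2)] by simp
  have "rcosets\<^bsub>G\<lparr>carrier := H\<rparr>\<^esub> A = (\<lambda>x. A #> x) ` H"
    by (auto simp: RCOSETS_def r_coset_def)
  then show "finite ((\<lambda>x. A #> x) ` H)" using A by (simp add: finite_index_def)
  show "x \<otimes> inv y \<in> A" if "x \<in> H" "y \<in> H" "A #> x = A #> y" for x y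
    using that r_coset_eq_iff[OF AG] subgroup.mem_carrier[OF s(1)] by blast
qed

lemma int_hom:
  assumes "\<beta> \<in> hom G integer_group"
  shows "\<lbrakk>x \<in> carrier G; y \<in> carrier G\<rbrakk> \<Longrightarrow> \<beta> (x \<otimes> y) = \<beta> x + \<beta> y" "\<beta> \<one> = 0"
    "x \<in> carrier G \<Longrightarrow> \<beta> (inv x) = - \<beta> x"
    "x \<in> carrier G \<Longrightarrow> \<beta> (x [^] (n :: int)) = n * \<beta> x"
    "x \<in> carrier G \<Longrightarrow> \<beta> (x [^] (k :: nat)) = int k * \<beta> x"
proof -
  interpret \<beta>: group_hom G integer_group \<beta>
    using assms is_group by (simp add: group_hom_def group_hom_axioms_def)
  show "\<beta> \<one> = 0" by simp
  show "\<beta> (x \<otimes> y) = \<beta> x + \<beta> y" if "x \<in> carrier G" "y \<in> carrier G" using that by simp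
  show "\<beta> (inv x) = - \<beta> x" "\<beta> (x [^] n) = n * \<beta> x" "\<beta> (x [^] k) = int k * \<beta> x"
    if "x \<in> carrier G" using that \<beta>.hom_int_pow[of x n] \<beta>.hom_nat_pow[of x k] by simp_all
qed

lemma int_homI: "(\<And>x y. \<lbrakk>x \<in> carrier G; y \<in> carrier G\<rbrakk> \<Longrightarrow> \<beta> (x \<otimes> y) = \<beta> x + \<beta> y) \<Longrightarrow> \<beta> \<in> hom G integer_group"
  by (auto simp: hom_def)

text \<open>A subgroup of \<open>\<int>\<^sup>k\<close> is isomorphic to some \<open>\<int>\<^sup>n\<close> with \<open>n \<le> k\<close>. It is given here as the
  joint image of \<open>k\<close> homomorphisms.\<close>

lemma independent_int_homs:
  fixes k :: nat and \<beta> :: "nat \<Rightarrow> 'a \<Rightarrow> int"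
  assumes "\<And>i. i < k \<Longrightarrow> \<beta> i \<in> hom G integer_group"
  shows "\<exists>n\<le>k. \<exists>\<theta>. (\<forall>i<n. \<theta> i \<in> hom G integer_group) \<and>
     (\<forall>z. \<exists>x\<in>carrier G. \<forall>i<n. \<theta> i x = z i) \<and>
     (\<forall>x\<in>carrier G. (\<forall>i<n. \<theta> i x = 0) \<longleftrightarrow> (\<forall>i<k. \<beta> i x = 0))"
  using assms
proof (induction k)
  case 0
  show ?case by (intro exI[of _ 0]) auto
next
  case (Suc k)
  then obtain n \<theta> where n: "n \<le> k" and hom: "\<And>i. i < n \<Longrightarrow> \<theta> i \<in> hom G integer_group"
    and surj: "\<And>z. \<exists>x\<in>carrier G. \<forall>i<n. \<theta> i x = z i"
    and ker: "\<And>x. x \<in> carrier G \<Longrightarrow> (\<forall>i<n. \<theta> i x = 0) \<longleftrightarrow> (\<forall>i<k. \<beta> i x = 0)" by fastforce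
  have \<beta>: "\<beta> k \<in> hom G integer_group" using Suc.prems by simp
  define K where "K = {x \<in> carrier G. \<forall>i<n. \<theta> i x = 0}"
  show ?case
  proof (cases "\<forall>x\<in>K. \<beta> k x = 0")
    case True
    then have "\<forall>x\<in>carrier G. (\<forall>i<n. \<theta> i x = 0) \<longleftrightarrow> (\<forall>i<Suc k. \<beta> i x = 0)"
      using ker by (auto simp: K_def less_Suc_eq)
    then show ?thesis using n hom surj by (intro exI[of _ n] conjI exI[of _ \<theta>]) auto
  next
    case False
    have K_mult: "x \<otimes> y [^] m \<in> K" if "x \<in> K" "y \<in> K" for x y and m :: int
      using that hom by (auto simp: K_def int_hom)
    have "\<exists>m>0. \<exists>x\<in>K. \<beta> k x = int m"
    proof -
      obtain x where x: "x \<in> K" "\<beta> k x \<noteq> 0" using False by blast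
      have xx: "\<one> \<otimes> x [^] sgn (\<beta> k x) \<in> K" "\<beta> k (\<one> \<otimes> x [^] sgn (\<beta> k x)) = \<bar>\<beta> k x\<bar>"
        using K_mult[of \<one> x] x hom by (auto simp: K_def int_hom[OF \<beta>] int_hom(2) sgn_mult_self_eq abs_sgn)
      then show ?thesis using x(2)
        by (intro exI[of _ "nat \<bar>\<beta> k x\<bar>"] conjI bexI[OF _ xx(1)]) auto
    qed
    \<comment> \<open>\<open>m\<close> generates the image of \<open>K\<close> under
      \<open>\<beta> k\<close>, a nonzero subgroup of the integers.\<close>
    then obtain m where m: "m > 0" "\<exists>x\<in>K. \<beta> k x = int m"
      and least: "\<And>l. \<lbrakk>0 < l; \<exists>x\<in>K. \<beta> k x = int l\<rbrakk> \<Longrightarrow> m \<le> l"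
      using exists_least_iff[of "\<lambda>m. m > 0 \<and> (\<exists>x\<in>K. \<beta> k x = int m)"]
      by (meson linorder_not_less)
    obtain t where t: "t \<in> K" "\<beta> k t = int m" using m by blast
    have dvd_K: "int m dvd \<beta> k x" if "x \<in> K" for x
    proof (rule ccontr)
      assume ndvd: "\<not> int m dvd \<beta> k x"
      define y where "y = x \<otimes> t [^] (- (\<beta> k x div int m))"
      have "y \<in> K" using K_mult[OF that t(1)] by (simp add: y_def)
      have "\<beta> k y = \<beta> k x - \<beta> k x div int m * int m"
        using that t by (simp add: y_def K_def int_hom[OF \<beta>])
      then have y: "y \<in> K" "\<beta> k y = \<beta> k x mod int m"
        using \<open>y \<in> K\<close> by (simp_all add: minus_div_mult_eq_mod)
      moreover have "\<beta> k x mod int m \<noteq> 0" using ndvd by presburger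
      moreover have "0 \<le> \<beta> k x mod int m" "\<beta> k x mod int m < int m" using m(1) by simp_all
      ultimately have "0 < nat (\<beta> k y)" "\<beta> k y = int (nat (\<beta> k y))" "nat (\<beta> k y) < m" by linarith+
      then show False using least y(1) by (meson not_le)
    qed
    obtain e where e: "\<And>j. e j \<in> carrier G" "\<And>i j. i < n \<Longrightarrow> \<theta> i (e j) = (if i = j then 1 else 0)"
      using surj[of "\<lambda>i. if i = j then 1 else 0" for j] by metis
    \<comment> \<open>The correction makes the new homomorphism vanish on the \<open>e j\<close>,
      which are dual to \<open>\<theta>\<close>, and does not change it on \<open>K\<close>. So
      divisibility by \<open>m\<close> extends from \<open>K\<close> to the whole group.\<close>
    define \<gamma> where "\<gamma> x = \<beta> k x - (\<Sum>i<n. \<theta> i x * \<beta> k (e i))" for x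
    have \<gamma>: "\<gamma> \<in> hom G integer_group"
      by (rule int_homI) (simp add: \<gamma>_def int_hom(1)[OF \<beta>] int_hom(1)[OF hom] sum.distrib algebra_simps)
    have \<gamma>_K: "\<gamma> x = \<beta> k x" if "x \<in> K" for x using that by (simp add: \<gamma>_def K_def)
    have \<gamma>_e: "\<gamma> (e j) = 0" if "j < n" for j
    proof -
      have "(\<Sum>i<n. \<theta> i (e j) * \<beta> k (e i)) = (\<Sum>i<n. if i = j then \<beta> k (e i) else 0)"
        by (rule sum.cong) (auto simp: e)
      then show ?thesis using that by (simp add: \<gamma>_def)
    qed
    \<comment> \<open>Induction on the number \<open>l\<close> of coordinates that may still be
      nonzero. A power of \<open>e l\<close> clears one of them and changes neither the others nor
      \<open>\<gamma>\<close>.\<close>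
    have dvd: "int m dvd \<gamma> x" if "x \<in> carrier G" "l \<le> n" "\<forall>i. l \<le> i \<and> i < n \<longrightarrow> \<theta> i x = 0" for x l
      using that
    proof (induction l arbitrary: x)
      case 0
      then have "x \<in> K" by (simp add: K_def)
      then show ?case using dvd_K \<gamma>_K by simp
    next
      case (Suc l)
      define y where "y = x \<otimes> e l [^] (- \<theta> l x)"
      have "\<theta> i y = \<theta> i x - (if i = l then \<theta> l x else 0)" if "i < n" for i
        using Suc.prems(1) e(1) e(2)[OF that] by (simp add: y_def int_hom[OF hom[OF that]])
      then have "\<forall>i. l \<le> i \<and> i < n \<longrightarrow> \<theta> i y = 0"
        using Suc.prems(3) by (metis cancel_comm_monoid_add_class.diff_cancel diff_zero le_eq_less_or_eq Suc_leI)
      moreover have "y \<in> carrier G" using Suc.prems e by (simp add: y_def)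
      moreover have "\<gamma> y = \<gamma> x" using Suc.prems e(1) \<gamma>_e by (simp add: y_def int_hom[OF \<gamma>])
      ultimately show ?case using Suc.IH[of y] Suc.prems(2) by simp
    qed
    have dvd: "int m dvd \<gamma> x" if "x \<in> carrier G" for x using dvd[OF that, of n] by simp
    define \<theta>' where "\<theta>' = \<theta>(n := \<lambda>x. \<gamma> x div int m)"
    have hom': "\<theta>' i \<in> hom G integer_group" if "i < Suc n" for i
    proof (cases "i = n")
      case True
      then show ?thesis
        unfolding \<theta>'_def by (auto intro!: int_homI simp: int_hom[OF \<gamma>] div_plus_div_distrib_dvd_left[OF dvd])
    qed (use hom that in \<open>simp add: \<theta>'_def\<close>)
    have surj': "\<exists>x\<in>carrier G. \<forall>i<Suc n. \<theta>' i x = z i" for z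
    proof -
      obtain x where x: "x \<in> carrier G" "\<forall>i<n. \<theta> i x = z i" using surj by blast
      \<comment> \<open>\<open>t\<close> is killed by all old homomorphisms and
        \<open>\<gamma> t = m\<close>, so its powers adjust the new coordinate alone.\<close>
      define y where "y = x \<otimes> t [^] (z n - \<gamma> x div int m)"
      have tG: "t \<in> carrier G" "\<forall>i<n. \<theta> i t = 0" using t by (auto simp: K_def)
      have "\<gamma> y = z n * int m"
        using x tG t \<gamma>_K[OF t(1)] dvd[OF x(1)] by (simp add: y_def int_hom[OF \<gamma>] algebra_simps)
      moreover have "\<theta> i y = z i" if "i < n" for i
        using x tG that by (simp add: y_def int_hom[OF hom[OF that]])
      ultimately show ?thesis using x tG m(1)
        by (intro bexI[of _ y]) (auto simp: \<theta>'_def less_Suc_eq y_def)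
    qed
    have ker': "(\<forall>i<Suc n. \<theta>' i x = 0) \<longleftrightarrow> (\<forall>i<Suc k. \<beta> i x = 0)" if x: "x \<in> carrier G" for x
    proof -
      have "(\<forall>i<Suc n. \<theta>' i x = 0) \<longleftrightarrow> (\<forall>i<n. \<theta> i x = 0) \<and> \<gamma> x = 0"
        using dvd[OF x] m(1) by (auto simp: \<theta>'_def less_Suc_eq dvd_div_eq_0_iff)
      also have "\<dots> \<longleftrightarrow> (\<forall>i<n. \<theta> i x = 0) \<and> \<beta> k x = 0"
        using \<gamma>_K[of x] x by (auto simp: K_def)
      also have "\<dots> \<longleftrightarrow> (\<forall>i<Suc k. \<beta> i x = 0)" using ker[OF x] by (auto simp: less_Suc_eq)
      finally show ?thesis .
    qed
    show ?thesis
      using n hom' surj' ker' by (intro exI[of _ "Suc n"] conjI exI[of _ \<theta>']) auto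
  qed
qed

lemma int_homs_kernel:
  assumes hom: "\<And>i. i < n \<Longrightarrow> \<theta> i \<in> hom G integer_group"
    and surj: "\<And>z. \<exists>x\<in>carrier G. \<forall>i<n. \<theta> i x = z i"
  shows "{x \<in> carrier G. \<forall>i<n. \<theta> i x = 0} \<lhd> G"
    and "G Mod {x \<in> carrier G. \<forall>i<n. \<theta> i x = 0} \<cong> Z_pow n"
proof -
  let ?\<Theta> = "\<lambda>x. \<lambda>i\<in>{..<n}. \<theta> i x"
  have "?\<Theta> \<in> hom G (Z_pow n)"
    by (rule homI) (auto simp: Z_pow_def int_hom[OF hom])
  moreover have "group (Z_pow n)" by (simp add: Z_pow_def)
  ultimately interpret \<Theta>: group_hom G "Z_pow n" ?\<Theta>
    using is_group by (simp add: group_hom_def group_hom_axioms_def)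
  have ker: "kernel G (Z_pow n) ?\<Theta> = {x \<in> carrier G. \<forall>i<n. \<theta> i x = 0}"
    by (auto simp: kernel_def Z_pow_def fun_eq_iff restrict_def)
  show "{x \<in> carrier G. \<forall>i<n. \<theta> i x = 0} \<lhd> G" using \<Theta>.normal_kernel unfolding ker .
  have "?\<Theta> ` carrier G = carrier (Z_pow n)"
  proof
    show "?\<Theta> ` carrier G \<subseteq> carrier (Z_pow n)"
      by (simp add: Z_pow_def image_subset_iff)
    show "carrier (Z_pow n) \<subseteq> ?\<Theta> ` carrier G"
    proof
      fix z assume z: "z \<in> carrier (Z_pow n)"
      obtain x where "x \<in> carrier G" "\<forall>i<n. \<theta> i x = z i" using surj by blast
      then show "z \<in> ?\<Theta> ` carrier G"
        using z by (intro image_eqI[of _ _ x]) (auto simp: Z_pow_def PiE_def extensional_def fun_eq_iff)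
    qed
  qed
  then show "G Mod {x \<in> carrier G. \<forall>i<n. \<theta> i x = 0} \<cong> Z_pow n"
    using \<Theta>.FactGroup_iso unfolding ker by blast
qed

end

section \<open>Extensions of free abelian groups by finite kernels\<close>

context group
begin

lemma int_pow_commute:
  assumes "x \<in> carrier G" "y \<in> carrier G" "x \<otimes> y = y \<otimes> x"
  shows "x \<otimes> y [^] (k :: int) = y [^] k \<otimes> x"
proof -
  have nat: "x \<otimes> z [^] (n :: nat) = z [^] n \<otimes> x" if "z \<in> carrier G" "x \<otimes> z = z \<otimes> x" for z n
    using group_commutes_pow[of z x n] that assms by simp
  have "x \<otimes> inv y = inv y \<otimes> (y \<otimes> x) \<otimes> inv y"
    using assms(1,2) by (simp add: m_assoc[symmetric])
  also have "\<dots> = inv y \<otimes> x"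
    unfolding assms(3)[symmetric] using assms(1,2) by (simp add: m_assoc)
  finally have "x \<otimes> inv y = inv y \<otimes> x" .
  then have inv: "x \<otimes> (inv y) [^] (n :: nat) = (inv y) [^] n \<otimes> x" for n
    using nat[of "inv y"] assms(2) by simp
  show ?thesis
  proof (cases "k \<ge> 0")
    case True
    then have "y [^] k = y [^] nat k" using int_pow_int[of G y "nat k"] by simp
    then show ?thesis using nat[OF assms(2,3)] by simp
  next
    case False
    then have "y [^] k = (inv y) [^] nat (- k)"
      using int_pow_neg_int[OF assms(2), of "nat (- k)"] nat_pow_inv[OF assms(2)] by simp
    then show ?thesis using inv by simp
  qed
qed

text \<open>The order of the factors is fixed because the group need not be commutative; additivity
  in the exponents requires the \<open>u i\<close> to commute.\<close>

primrec power_prod :: "(nat \<Rightarrow> 'a) \<Rightarrow> (nat \<Rightarrow> int) \<Rightarrow> nat \<Rightarrow> 'a" where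
  "power_prod u z 0 = \<one>"
| "power_prod u z (Suc m) = power_prod u z m \<otimes> u m [^] z m"

lemma power_prod_closed [simp]: "(\<And>i. u i \<in> carrier G) \<Longrightarrow> power_prod u z m \<in> carrier G"
  by (induction m) auto

lemma power_prod_cong: "(\<And>i. i < m \<Longrightarrow> z i = w i) \<Longrightarrow> power_prod u z m = power_prod u w m"
  by (induction m) auto

lemma power_prod_commute:
  assumes "\<And>i. u i \<in> carrier G" "x \<in> carrier G" "\<And>i. i < m \<Longrightarrow> x \<otimes> u i = u i \<otimes> x"
  shows "x \<otimes> power_prod u z m = power_prod u z m \<otimes> x"
  using assms(3)
proof (induction m)
  case (Suc m)
  have "x \<otimes> u m [^] z m = u m [^] z m \<otimes> x" using int_pow_commute assms Suc.prems by simp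
  moreover have "x \<otimes> power_prod u z m = power_prod u z m \<otimes> x" using Suc by simp
  ultimately show ?case
    using assms(1,2) m_assoc[of x "power_prod u z m" "u m [^] z m"]
      m_assoc[of "power_prod u z m" x "u m [^] z m"] m_assoc[of "power_prod u z m" "u m [^] z m" x] by simp
qed (use assms in simp)

lemma power_prod_add:
  assumes u: "\<And>i. u i \<in> carrier G" and comm: "\<And>i j. \<lbrakk>i < m; j < m\<rbrakk> \<Longrightarrow> u i \<otimes> u j = u j \<otimes> u i"
  shows "power_prod u (\<lambda>i. z i + w i) m = power_prod u z m \<otimes> power_prod u w m"
  using comm
proof (induction m)
  case (Suc m)
  have "u m \<otimes> power_prod u w m = power_prod u w m \<otimes> u m"
    using power_prod_commute[of u "u m" m w] u Suc.prems by simp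
  then have "power_prod u w m \<otimes> u m [^] z m = u m [^] z m \<otimes> power_prod u w m"
    using int_pow_commute[of "power_prod u w m" "u m"] u by simp
  then have "(power_prod u z m \<otimes> power_prod u w m) \<otimes> (u m [^] z m \<otimes> u m [^] w m) =
      (power_prod u z m \<otimes> u m [^] z m) \<otimes> (power_prod u w m \<otimes> u m [^] w m)"
    using u by (simp add: m_assoc) (simp add: m_assoc[symmetric])
  then show ?case using Suc u by (simp add: int_pow_mult)
qed simp

text \<open>Commutators lie in the finite kernel, so conjugation has finite orbits on the \<open>t j\<close>.\<close>

lemma power_commutes:
  fixes t :: "nat \<Rightarrow> 'a"
  assumes t: "\<And>j. t j \<in> carrier G" and x: "x \<in> carrier G" and fin: "finite K"
    and K: "\<And>a b. \<lbrakk>a \<in> carrier G; b \<in> carrier G\<rbrakk> \<Longrightarrow> a \<otimes> b \<otimes> inv a \<otimes> inv b \<in> K"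
  shows "\<exists>m>0. \<forall>j<n. x [^] (m :: nat) \<otimes> t j = t j \<otimes> x [^] m"
proof -
  define c where "c a = (\<lambda>j\<in>{..<n}. x [^] a \<otimes> t j \<otimes> inv (x [^] a) \<otimes> inv (t j))" for a :: nat
  have "c a \<in> (\<Pi>\<^sub>E j\<in>{..<n}. K)" for a
    unfolding c_def by (simp add: K t x)
  moreover have "finite (\<Pi>\<^sub>E j\<in>{..<n}. K)" using fin by (simp add: finite_PiE)
  ultimately have "finite (range c)" by (meson finite_subset image_subsetI)
  then have "\<not> inj c" using finite_imageD[of c UNIV] infinite_UNIV_nat by blast
  \<comment> \<open>Two powers of \<open>x\<close> with the same commutators conjugate every
    \<open>t j\<close> in the same way, so their quotient commutes with every
    \<open>t j\<close>.\<close>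
  then obtain a b where ab: "a < b" "c a = c b" by (metis linorder_injI)
  define y where "y = x [^] (b - a)"
  have b: "x [^] b = x [^] a \<otimes> y" using ab(1) x by (simp add: y_def nat_pow_mult)
  have y: "y \<in> carrier G" "x [^] a \<in> carrier G" using x by (auto simp: y_def)
  have "y \<otimes> t j = t j \<otimes> y" if "j < n" for j
  proof -
    have "c a j = c b j" using ab by simp
    then have "x [^] a \<otimes> t j \<otimes> inv (x [^] a) = x [^] b \<otimes> t j \<otimes> inv (x [^] b)"
      using that t x by (simp add: c_def)
    then have "x [^] a \<otimes> (t j \<otimes> inv (x [^] a)) = x [^] a \<otimes> (y \<otimes> t j \<otimes> inv y \<otimes> inv (x [^] a))"
      unfolding b using t y by (simp add: inv_mult_group m_assoc)
    then have "t j = y \<otimes> t j \<otimes> inv y" using t y by simp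
    then have "t j \<otimes> y = y \<otimes> t j \<otimes> inv y \<otimes> y" by simp
    also have "\<dots> = y \<otimes> t j" using t y by (simp add: m_assoc)
    finally show ?thesis by simp
  qed
  then show ?thesis using ab(1) by (intro exI[of _ "b - a"]) (simp add: y_def)
qed

lemma finite_by_Z_pow:
  assumes hom: "\<And>i. i < n \<Longrightarrow> \<theta> i \<in> hom G integer_group"
    and surj: "\<And>z. \<exists>x\<in>carrier G. \<forall>i<n. \<theta> i x = z i"
    and fin: "finite {x \<in> carrier G. \<forall>i<n. \<theta> i x = 0}"
  shows "\<exists>A. finite_index A G \<and> G\<lparr>carrier := A\<rparr> \<cong> Z_pow n"
proof -
  let ?K = "{x \<in> carrier G. \<forall>i<n. \<theta> i x = 0}"
  obtain t where t: "\<And>j. t j \<in> carrier G" "\<And>i j. i < n \<Longrightarrow> \<theta> i (t j) = (if i = j then 1 else 0)"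
    using surj[of "\<lambda>i. if i = j then 1 else 0" for j] by metis
  have "\<exists>m>0. \<forall>j<n. t i [^] (m :: nat) \<otimes> t j = t j \<otimes> t i [^] m" for i
  proof (rule power_commutes[OF t(1) t(1) fin])
    show "a \<otimes> b \<otimes> inv a \<otimes> inv b \<in> ?K" if "a \<in> carrier G" "b \<in> carrier G" for a b
      using that by (auto simp: int_hom[OF hom])
  qed
  then obtain M :: "nat \<Rightarrow> nat" where M: "\<And>i. M i > 0"
    "\<And>i j. j < n \<Longrightarrow> t i [^] M i \<otimes> t j = t j \<otimes> t i [^] M i" by metis
  define u where "u i = t i [^] M i" for i
  have u [simp]: "u i \<in> carrier G" for i using t by (simp add: u_def)
  have comm: "u i \<otimes> u j = u j \<otimes> u i" if "j < n" for i j
    using group_commutes_pow[of "t j" "u i" "M j"] M(2)[OF that, of i] t(1) by (simp add: u_def)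
  have \<theta>u: "\<theta> i (u j) = (if i = j then int (M i) else 0)" if "i < n" for i j
    using int_hom(5)[OF hom[OF that] t(1)] t(2)[OF that] by (simp add: u_def)
  define P where "P z = power_prod u z n" for z
  have P [simp]: "P z \<in> carrier G" for z by (simp add: P_def)
  have P_add: "P (\<lambda>i. z i + w i) = P z \<otimes> P w" for z w
    unfolding P_def by (rule power_prod_add) (auto simp: comm)
  have P_0: "P (\<lambda>_. 0) = \<one>" unfolding P_def by (induction n) auto
  have P_inv: "inv (P z) = P (\<lambda>i. - z i)" for z
    using P_add[of "\<lambda>i. - z i" z] P_0 by (intro inv_equality) simp_all
  have \<theta>P: "\<theta> i (P z) = z i * int (M i)" if "i < n" for i z
  proof -
    have "\<theta> i (power_prod u z m) = (if i < m then z i * int (M i) else 0)" if "m \<le> n" for m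
      using that
    proof (induction m)
      case (Suc m)
      then show ?case
        using \<theta>u[OF \<open>i < n\<close>, of m] by (auto simp: int_hom[OF hom[OF \<open>i < n\<close>]] less_Suc_eq)
    qed (simp add: int_hom(2)[OF hom[OF \<open>i < n\<close>]])
    then show ?thesis using that by (simp add: P_def)
  qed
  let ?A = "range P"
  have A: "subgroup ?A G"
  proof
    show "\<one> \<in> ?A" using P_0 by (metis rangeI)
    show "x \<otimes> y \<in> ?A" if "x \<in> ?A" "y \<in> ?A" for x y
      using that P_add by (metis (no_types, lifting) imageE rangeI)
    show "inv x \<in> ?A" if "x \<in> ?A" for x using that P_inv by auto
  qed auto
  have "P \<in> iso (Z_pow n) (G\<lparr>carrier := ?A\<rparr>)"
  proof (rule isoI)
    show "P \<in> hom (Z_pow n) (G\<lparr>carrier := ?A\<rparr>)"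
    proof (rule homI)
      fix z w
      have "P (\<lambda>i\<in>{..<n}. z i + w i) = P (\<lambda>i. z i + w i)"
        unfolding P_def by (rule power_prod_cong) simp
      then show "P (z \<otimes>\<^bsub>Z_pow n\<^esub> w) = P z \<otimes>\<^bsub>G\<lparr>carrier := ?A\<rparr>\<^esub> P w"
        using P_add[of z w] by (simp add: Z_pow_def)
    qed simp
    show "bij_betw P (carrier (Z_pow n)) (carrier (G\<lparr>carrier := ?A\<rparr>))"
      unfolding bij_betw_def
    proof
      show "inj_on P (carrier (Z_pow n))"
      proof (rule inj_onI)
        fix z w assume zw: "z \<in> carrier (Z_pow n)" "w \<in> carrier (Z_pow n)" and eq: "P z = P w"
        have "z i = w i" if "i < n" for i using \<theta>P[OF that, of z] \<theta>P[OF that, of w] eq M(1)[of i] by simp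
        then show "z = w" using zw by (auto simp: Z_pow_def intro: PiE_ext)
      qed
      have "P z = P (restrict z {..<n})" for z unfolding P_def by (rule power_prod_cong) simp
      moreover have "restrict z {..<n} \<in> carrier (Z_pow n)" for z by (simp add: Z_pow_def)
      ultimately show "P ` carrier (Z_pow n) = carrier (G\<lparr>carrier := ?A\<rparr>)" by auto
    qed
  qed
  moreover have "group (Z_pow n)" by (simp add: Z_pow_def)
  ultimately have iso: "G\<lparr>carrier := ?A\<rparr> \<cong> Z_pow n"
    using group.iso_sym is_isoI by metis
  \<comment> \<open>\<open>L\<close> is the preimage of the lattice onto which \<open>?A\<close> is
    mapped by \<open>\<theta>\<close>. Residues modulo \<open>M i\<close> bound the index of
    \<open>L\<close>, and the finite kernel bounds the index of \<open>?A\<close> in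
    \<open>L\<close>.\<close>
  define L where "L = {x \<in> carrier G. \<forall>i<n. int (M i) dvd \<theta> i x}"
  have L: "finite_index L G"
  proof (rule finite_index_refine[OF finite_index_carrier, where c = "\<lambda>x. \<lambda>i\<in>{..<n}. \<theta> i x mod int (M i)"])
    show "subgroup L G"
      by (rule subgroupI) (auto simp: L_def int_hom[OF hom] intro!: exI[of _ \<one>])
    have "(\<lambda>x. \<lambda>i\<in>{..<n}. \<theta> i x mod int (M i)) ` carrier G \<subseteq> (\<Pi>\<^sub>E i\<in>{..<n}. {0..<int (M i)})"
      using M(1) by (simp add: image_subset_iff)
    then show "finite ((\<lambda>x. \<lambda>i\<in>{..<n}. \<theta> i x mod int (M i)) ` carrier G)"
      by (rule finite_subset) (simp add: finite_PiE)
    fix x y assume xy: "x \<in> carrier G" "y \<in> carrier G"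
      and eq: "(\<lambda>i\<in>{..<n}. \<theta> i x mod int (M i)) = (\<lambda>i\<in>{..<n}. \<theta> i y mod int (M i))"
    have "\<theta> i x mod int (M i) = \<theta> i y mod int (M i)" if "i < n" for i
      using fun_cong[OF eq, of i] that by simp
    then show "x \<otimes> inv y \<in> L"
      using xy by (auto simp: L_def int_hom[OF hom] mod_eq_dvd_iff)
  qed (auto simp: L_def)
  have AL: "?A \<subseteq> L" by (auto simp: L_def \<theta>P)
  \<comment> \<open>On \<open>L\<close> the divisions are exact, so \<open>a x\<close> is an element
    of \<open>?A\<close> with the same values of \<open>\<theta>\<close> as
    \<open>x\<close>.\<close>
  define a where "a x = P (\<lambda>i. \<theta> i x div int (M i))" for x
  have aK: "inv (a x) \<otimes> x \<in> ?K" if "x \<in> L" for x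
    using that by (auto simp: L_def a_def int_hom[OF hom] \<theta>P)
  have "finite_index ?A G"
  proof (rule finite_index_refine[OF L A AL, of "\<lambda>x. inv (a x) \<otimes> x"])
    show "finite ((\<lambda>x. inv (a x) \<otimes> x) ` L)" 
      by (rule finite_subset[OF _ fin]) (use aK in blast)
    fix x y assume xy: "x \<in> L" "y \<in> L" and eq: "inv (a x) \<otimes> x = inv (a y) \<otimes> y"
    have G: "x \<in> carrier G" "y \<in> carrier G" "a x \<in> carrier G" "a y \<in> carrier G"
      using xy by (auto simp: L_def a_def)
    define k where "k = inv (a x) \<otimes> x"
    have k: "k \<in> carrier G" "x = a x \<otimes> k" using G by (simp_all add: k_def m_assoc[symmetric])
    have "y = a y \<otimes> k" using G by (simp add: k_def eq m_assoc[symmetric])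
    have "x \<otimes> inv y = (a x \<otimes> k) \<otimes> inv (a y \<otimes> k)" using k(2) \<open>y = a y \<otimes> k\<close> by simp
    also have "\<dots> = a x \<otimes> inv (a y)"
      using G k(1) by (simp add: inv_mult_group m_assoc) (simp add: m_assoc[symmetric])
    finally show "x \<otimes> inv y \<in> ?A"
      using A by (simp add: a_def subgroup.m_closed subgroup.m_inv_closed)
  qed
  then show ?thesis using iso by blast
qed

end

section \<open>Automorphisms of products of trees\<close>

locale tree_product_action = group_action G "prod_verts k T" \<phi>
  for G :: "('g, 'm) monoid_scheme" (structure) and k :: nat and T :: "nat \<Rightarrow> 'v sgraph" and \<phi> +
  assumes trees: "i < k \<Longrightarrow> tree (T i)"
    and cube_automorphisms: "g \<in> carrier G \<Longrightarrow> cube_automorphism k T (\<phi> g)"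
begin

sublocale group G
  using group_hom group_hom.axioms(1) by blast

abbreviation PV :: "(nat \<Rightarrow> 'v) set" where "PV \<equiv> prod_verts k T"

lemma PV_verts: "\<lbrakk>x \<in> PV; i < k\<rbrakk> \<Longrightarrow> x i \<in> verts (T i)"
  by (auto simp: prod_verts_def)

lemma PV_upd: "\<lbrakk>x \<in> PV; i < k; w \<in> verts (T i)\<rbrakk> \<Longrightarrow> x(i := w) \<in> PV"
  by (auto simp: prod_verts_def PiE_def extensional_def)

lemma PV_nonempty: "PV \<noteq> {}"
  using trees by (auto simp: prod_verts_def PiE_eq_empty_iff tree_def)

lemma act_in [simp]: "\<lbrakk>g \<in> carrier G; x \<in> PV\<rbrakk> \<Longrightarrow> \<phi> g x \<in> PV"
  using element_image by blast

lemma act_inv [simp]: "\<lbrakk>g \<in> carrier G; x \<in> PV\<rbrakk> \<Longrightarrow> \<phi> (inv g) (\<phi> g x) = x"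
  using orbit_sym_aux by blast

lemma act_inv' [simp]: "\<lbrakk>g \<in> carrier G; x \<in> PV\<rbrakk> \<Longrightarrow> \<phi> g (\<phi> (inv g) x) = x"
  using act_inv[of "inv g" x] by simp

lemma adjD: "\<lbrakk>i < k; adj (T i) u v\<rbrakk> \<Longrightarrow> u \<in> verts (T i) \<and> v \<in> verts (T i) \<and> u \<noteq> v \<and> adj (T i) v u"
  using trees unfolding tree_def simple_graph_def by blast

section \<open>Directions of edges in the product\<close>

definition edge :: "nat \<Rightarrow> (nat \<Rightarrow> 'v) \<Rightarrow> (nat \<Rightarrow> 'v) \<Rightarrow> bool" where
  "edge i x y \<longleftrightarrow> x \<in> PV \<and> i < k \<and> adj (T i) (x i) (y i) \<and> y = x(i := y i)"

lemma edgeD: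
  assumes "edge i x y"
  shows "x \<in> PV" "i < k" "y \<in> PV" "x i \<noteq> y i" "adj (T i) (x i) (y i)" "j \<noteq> i \<Longrightarrow> y j = x j"
proof -
  show x: "x \<in> PV" "i < k" "adj (T i) (x i) (y i)" using assms by (auto simp: edge_def)
  have y: "y = x(i := y i)" using assms by (simp add: edge_def)
  show "x i \<noteq> y i" using adjD x by blast
  show "y \<in> PV" using PV_upd[of x i "y i"] adjD[OF x(2,3)] x y by simp
  show "y j = x j" if "j \<noteq> i" using y that by (metis fun_upd_other)
qed

lemma edge_sym:
  assumes "edge i x y"
  shows "edge i y x"
proof -
  note e = edgeD[OF assms]
  have "x = y(i := x i)" using e(6) by (simp add: fun_eq_iff)
  then show ?thesis unfolding edge_def using e(2,3) adjD[OF e(2,5)] by blast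
qed

lemma edge_unique: "\<lbrakk>edge i x y; edge j x y\<rbrakk> \<Longrightarrow> i = j"
  using edgeD by metis

lemma edge_upd: "\<lbrakk>x \<in> PV; i < k; adj (T i) (x i) w\<rbrakk> \<Longrightarrow> edge i x (x(i := w))"
  by (simp add: edge_def)

text \<open>If \<open>x\<close> and \<open>y\<close> differed in two coordinates, exchanging one of them would give a third vertex
  of the cell.\<close>

lemma edge_of_cell:
  assumes cell: "{x, y} \<in> prod_cells k T" and "x \<noteq> y" and x: "x \<in> PV" and y: "y \<in> PV"
  shows "\<exists>i. edge i x y"
proof -
  obtain s where s: "{x, y} = (\<Pi>\<^sub>E i\<in>{..<k}. s i)" "\<And>i. i < k \<Longrightarrow> s i \<in> tree_cells (T i)"
    using cell unfolding prod_cells_def by blast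
  have "\<exists>i<k. x i \<noteq> y i"
    using \<open>x \<noteq> y\<close> x y unfolding prod_verts_def by (metis PiE_ext lessThan_iff)
  then obtain i where i: "i < k" "x i \<noteq> y i" by blast
  have si: "x i \<in> s i" "y i \<in> s i" using s(1) i(1) by (metis PiE_mem insertCI lessThan_iff)+
  have "x(i := y i) \<in> {x, y}"
  proof -
    have "x \<in> (\<Pi>\<^sub>E i\<in>{..<k}. s i)" using s(1) by blast
    then show ?thesis unfolding s(1) using i(1) si(2) by (auto simp: PiE_def extensional_def)
  qed
  then have eq: "y = x(i := y i)" using i(2) by (metis fun_upd_same insertE singletonD)
  have "adj (T i) (x i) (y i)"
    using s(2)[OF i(1)] si i(2) adjD[OF i(1)] unfolding tree_cells_def by auto
  then show ?thesis using eq x i(1) unfolding edge_def by blast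
qed

lemma cell_of_edge:
  assumes "edge i x y"
  shows "{x, y} \<in> prod_cells k T"
proof -
  note e = edgeD[OF assms]
  define s where "s j = (if j = i then {x i, y i} else {x j})" for j
  have "s j \<in> tree_cells (T j)" if "j < k" for j
    using that e(5) PV_verts[OF e(1) that] by (auto simp: s_def tree_cells_def)
  moreover have "{x, y} = (\<Pi>\<^sub>E j\<in>{..<k}. s j)"
  proof
    show "{x, y} \<subseteq> (\<Pi>\<^sub>E j\<in>{..<k}. s j)"
      using e(1,3,6) by (auto simp: s_def prod_verts_def PiE_def extensional_def)
    show "(\<Pi>\<^sub>E j\<in>{..<k}. s j) \<subseteq> {x, y}"
    proof
      fix z assume z: "z \<in> (\<Pi>\<^sub>E j\<in>{..<k}. s j)"
      have zj: "z j = x j" if "j \<noteq> i" for j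
        using z that e(1) by (cases "j < k") (auto simp: s_def prod_verts_def PiE_def extensional_def Pi_def)
      have "z i \<in> s i" using z e(2) by auto
      then have "z i = x i \<or> z i = y i" by (simp add: s_def)
      then show "z \<in> {x, y}" using zj e(6) by (metis ext insertI1 insertI2)
    qed
  qed
  ultimately show ?thesis unfolding prod_cells_def by blast
qed

text \<open>Edges at \<open>x\<close> in different directions lie in a common cell, whereas by
  \<open>cell_coordinates\<close> two different edges in the same direction do not. Automorphisms
  preserve cells and thus the relation of having the same direction.\<close>

lemma cell_spanned:
  assumes y: "edge i x y" and z: "edge j x z" and "i \<noteq> j"
  shows "\<exists>A\<in>prod_cells k T. x \<in> A \<and> y \<in> A \<and> z \<in> A"
proof -
  note e = edgeD[OF y] and f = edgeD[OF z]
  define s where "s l = (if l = i then {x i, y i} else if l = j then {x j, z j} else {x l})" for l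
  have "s l \<in> tree_cells (T l)" if "l < k" for l
    using that e(5) f(5) PV_verts[OF e(1) that] by (auto simp: s_def tree_cells_def)
  moreover have "x \<in> (\<Pi>\<^sub>E j\<in>{..<k}. s j)" "y \<in> (\<Pi>\<^sub>E j\<in>{..<k}. s j)" "z \<in> (\<Pi>\<^sub>E j\<in>{..<k}. s j)"
    using e(1,3,6) f(1,3,6) \<open>i \<noteq> j\<close> by (auto simp: s_def prod_verts_def PiE_def extensional_def)
  ultimately show ?thesis unfolding prod_cells_def by blast
qed

lemma cell_coordinates:
  assumes "A \<in> prod_cells k T" "x \<in> A" "y \<in> A" "z \<in> A" "i < k"
  shows "x i = y i \<or> x i = z i \<or> y i = z i"
proof -
  obtain s where s: "A = (\<Pi>\<^sub>E i\<in>{..<k}. s i)" "s i \<in> tree_cells (T i)"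
    using assms unfolding prod_cells_def by blast
  then have "x i \<in> s i" "y i \<in> s i" "z i \<in> s i" using assms by auto
  then show ?thesis using s(2) unfolding tree_cells_def by auto
qed

lemma image_cell: "\<lbrakk>g \<in> carrier G; A \<in> prod_cells k T\<rbrakk> \<Longrightarrow> \<phi> g ` A \<in> prod_cells k T"
  using cube_automorphisms[of g] unfolding cube_automorphism_def bij_betw_def by blast

lemma act_eq_iff: "\<lbrakk>g \<in> carrier G; x \<in> PV; y \<in> PV\<rbrakk> \<Longrightarrow> \<phi> g x = \<phi> g y \<longleftrightarrow> x = y"
  using inj_prop[of g] by (auto simp: inj_on_def)

lemma edge_image:
  assumes g: "g \<in> carrier G" and e: "edge i x y"
  shows "\<exists>j. edge j (\<phi> g x) (\<phi> g y)"
proof (rule edge_of_cell)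
  show "{\<phi> g x, \<phi> g y} \<in> prod_cells k T" using image_cell[OF g cell_of_edge[OF e]] by simp
  show "\<phi> g x \<noteq> \<phi> g y" "\<phi> g x \<in> PV" "\<phi> g y \<in> PV"
    using edgeD[OF e] g act_eq_iff by auto
qed

lemma edge_image_distinct:
  assumes g: "g \<in> carrier G" and e: "edge i x y" "edge i' x z" "i \<noteq> i'"
    and f: "edge j (\<phi> g x) (\<phi> g y)" "edge j' (\<phi> g x) (\<phi> g z)"
  shows "j \<noteq> j'"
proof
  assume "j = j'"
  note f' = f(2)[folded this]
  obtain A where A: "A \<in> prod_cells k T" "x \<in> A" "y \<in> A" "z \<in> A" using cell_spanned[OF e] by blast
  then have "\<phi> g x j = \<phi> g y j \<or> \<phi> g x j = \<phi> g z j \<or> \<phi> g y j = \<phi> g z j"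
    using cell_coordinates[OF image_cell[OF g A(1)], of "\<phi> g x" "\<phi> g y" "\<phi> g z" j] edgeD(2)[OF f(1)] by blast
  then have "\<phi> g y j = \<phi> g z j" using edgeD(4)[OF f(1)] edgeD(4)[OF f'] by blast
  then have "\<phi> g y = \<phi> g z" using f(1) f' unfolding edge_def by metis
  then have "y = z" using act_eq_iff[OF g] edgeD(3) e by blast
  then show False using edge_unique e by blast
qed

text \<open>This is \<open>edge_image_distinct\<close> applied to \<open>inv g\<close>.\<close>

lemma edge_image_same:
  assumes g: "g \<in> carrier G" and e: "edge i x y" "edge i x z"
    and f: "edge j (\<phi> g x) (\<phi> g y)" "edge j' (\<phi> g x) (\<phi> g z)"
  shows "j = j'"
proof (rule ccontr)
  assume "j \<noteq> j'"
  have "\<phi> (inv g) (\<phi> g x) = x" "\<phi> (inv g) (\<phi> g y) = y" "\<phi> (inv g) (\<phi> g z) = z"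
    using g edgeD(1,3)[OF e(1)] edgeD(3)[OF e(2)] by auto
  then show False
    using edge_image_distinct[of "inv g" j "\<phi> g x" "\<phi> g y" j' "\<phi> g z" i i] f e g \<open>j \<noteq> j'\<close> by simp
qed

lemma walk_upd:
  assumes "walk (T i) u p w" and "i < k" and "x \<in> PV" "x i = u" and "P x"
    and step: "\<And>u v. \<lbrakk>P u; edge i u v\<rbrakk> \<Longrightarrow> P v"
  shows "P (x(i := w))"
  using assms(1,3,4,5)
proof (induction p arbitrary: u x)
  case Nil
  then show ?case by (simp add: walk_def)
next
  case (Cons a p)
  show ?case
  proof (cases p)
    case Nil
    then have "x(i := w) = x" using Cons.prems by (auto simp: walk_def)
    then show ?thesis using Cons.prems by simp
  next
    case (Cons b q)
    then have w: "adj (T i) u b" "walk (T i) b p w" using \<open>walk (T i) u (a # p) w\<close> by (auto simp: walk_def)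
    have e: "edge i x (x(i := b))" using edge_upd[of x i b] \<open>i < k\<close> Cons.prems w by simp
    have "P ((x(i := b))(i := w))"
      using Cons.IH[OF w(2), of "x(i := b)"] edgeD(3)[OF e] step[OF \<open>P x\<close> e] by (simp only: fun_upd_same)
    then show ?thesis unfolding fun_upd_upd .
  qed
qed

text \<open>An induction along edges with directions in \<open>S\<close>. It is used with all
  directions and with all but one.\<close>

lemma product_connected:
  assumes x: "x \<in> PV" and y: "y \<in> PV" and eq: "\<And>j. \<lbrakk>j < k; j \<notin> S\<rbrakk> \<Longrightarrow> x j = y j"
    and P: "P x" and step: "\<And>i u v. \<lbrakk>i \<in> S; P u; edge i u v\<rbrakk> \<Longrightarrow> P v"
  shows "P y"
proof -
  define z where "z n j = (if j < n then y j else x j)" for n j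
  have z: "z n \<in> PV \<and> P (z n)" if "n \<le> k" for n
    using that
  proof (induction n)
    case 0
    have "z 0 = x" by (simp add: z_def fun_eq_iff)
    then show ?case using x P by simp
  next
    case (Suc n)
    then have zn: "z n \<in> PV" "P (z n)" "n < k" by auto
    have Sn: "z (Suc n) = (z n)(n := y n)" by (auto simp: z_def fun_eq_iff)
    have yn: "y n \<in> verts (T n)" using PV_verts y zn by blast
    show ?case
    proof (cases "n \<in> S")
      case True
      obtain p where p: "walk (T n) (z n n) p (y n)"
        using trees[OF zn(3)] PV_verts[OF zn(1,3)] yn unfolding tree_def by blast
      have "P ((z n)(n := y n))"
        by (rule walk_upd[of n "z n n" p "y n" "z n" P]) (use p zn step[OF True] in blast)+
      then show ?thesis using PV_upd[OF zn(1,3) yn] unfolding Sn by blast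
    next
      case False
      then have "z (Suc n) = z n" using Sn eq[OF zn(3)] by (auto simp: z_def fun_eq_iff)
      then show ?thesis using zn by simp
    qed
  qed
  have "z k = y" using x y by (auto simp: z_def fun_eq_iff prod_verts_def PiE_def extensional_def)
  then show ?thesis using z[of k] by simp
qed

text \<open>Along an edge in the same direction this is \<open>edge_image_same\<close>, along an edge in another
  direction it holds because squares are mapped to squares.\<close>

lemma edge_image_parallel:
  assumes g: "g \<in> carrier G" and x: "edge i x x'" "edge j (\<phi> g x) (\<phi> g x')"
    and y: "edge i y y'" "edge j' (\<phi> g y) (\<phi> g y')"
  shows "j' = j"
proof -
  define P where "P u \<longleftrightarrow> (\<forall>u' l. edge i u u' \<longrightarrow> edge l (\<phi> g u) (\<phi> g u') \<longrightarrow> l = j)" for u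
  have "P x" unfolding P_def using edge_image_same[OF g _ x(1) _ x(2)] by blast
  moreover have "P v" if u: "P u" and uv: "edge l u v" for l u v
    unfolding P_def
  proof (intro allI impI)
    fix v' m assume v': "edge i v v'" "edge m (\<phi> g v) (\<phi> g v')"
    obtain a where a: "edge a (\<phi> g u) (\<phi> g v)" using edge_image[OF g uv] by blast
    show "m = j"
    proof (cases "l = i")
      case True
      then have "a = j" using u uv a unfolding P_def by blast
      then show ?thesis
        using edge_image_same[OF g v'(1) _ v'(2)] edge_sym[OF uv] edge_sym[OF a] True by blast
    next
      case False
      note U = edgeD[OF uv] and V = edgeD[OF v'(1)]
      define u' where "u' = u(i := v' i)"
      have "v i = u i" using U(6)[of i] False by simp
      then have uu': "edge i u u'" using edge_upd[OF U(1) V(2)] V(5) by (simp add: u'_def)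
      have "v' = u'(l := v' l)"
        using U(6) V(6) False by (auto simp: u'_def fun_eq_iff)
      moreover have "u' l = u l" "v' l = v l" using False V(6)[of l] by (auto simp: u'_def)
      ultimately have u'v': "edge l u' v'"
        using edgeD(3)[OF uu'] U(2,5) unfolding edge_def by simp
      obtain b where "edge b (\<phi> g u) (\<phi> g u')" using edge_image[OF g uu'] by blast
      then have b: "edge j (\<phi> g u) (\<phi> g u')" using u uu' unfolding P_def by blast
      obtain e where e: "edge e (\<phi> g u') (\<phi> g v')" using edge_image[OF g u'v'] by blast
      have aj: "a \<noteq> j" using edge_image_distinct[OF g uv uu' False a b] .
      have am: "a \<noteq> m"
        using edge_image_distinct[OF g edge_sym[OF uv] v'(1) False edge_sym[OF a] v'(2)] .
      show ?thesis
      \<comment> \<open>Around the image square, one way to \<open>\<phi> g v'\<close> changes the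
        coordinates \<open>a\<close> and \<open>m\<close>, the other way \<open>j\<close> and then
        \<open>e\<close>. If \<open>m \<noteq> j\<close>, then the last step must both undo the
        change in \<open>j\<close> and make the change in \<open>a\<close>, so \<open>e\<close>
        would equal both.\<close>
      proof (rule ccontr)
        assume "m \<noteq> j"
        then have "\<phi> g v' j = \<phi> g u j" using edgeD(6)[OF v'(2), of j] edgeD(6)[OF a, of j] aj by simp
        then have "e = j" using edgeD(4)[OF b] edgeD(6)[OF e, of j] by metis
        moreover have "\<phi> g v' a = \<phi> g v a" "\<phi> g u' a = \<phi> g u a"
          using edgeD(6)[OF v'(2), of a] edgeD(6)[OF b, of a] aj am by auto
        then have "e = a" using edgeD(4)[OF a] edgeD(6)[OF e, of a] by metis
        ultimately show False using aj by simp
      qed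
    qed
  qed
  ultimately have "P y"
    using product_connected[of x y UNIV P] edgeD(1)[OF x(1)] edgeD(1)[OF y(1)] by blast
  then show ?thesis using y unfolding P_def by blast
qed

text \<open>The permutation of the factors induced by \<open>g\<close>. It is kept as a relation
  because a factor with a single vertex has no edges, so its direction has no image.\<close>

definition directions :: "'g \<Rightarrow> (nat \<times> nat) set" where
  "directions g = {(i, j). \<exists>x y. edge i x y \<and> edge j (\<phi> g x) (\<phi> g y)}"

lemma directions_single: "\<lbrakk>g \<in> carrier G; (i, j) \<in> directions g; (i, j') \<in> directions g\<rbrakk> \<Longrightarrow> j = j'"
  unfolding directions_def using edge_image_parallel by blast

lemma directions_mult:
  assumes g: "g \<in> carrier G" "h \<in> carrier G" and ij: "(i, j) \<in> directions (g \<otimes> h)"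
  obtains l where "(i, l) \<in> directions h" "(l, j) \<in> directions g"
proof -
  obtain x y where xy: "edge i x y" "edge j (\<phi> (g \<otimes> h) x) (\<phi> (g \<otimes> h) y)"
    using ij unfolding directions_def by blast
  obtain l where l: "edge l (\<phi> h x) (\<phi> h y)" using edge_image[OF g(2) xy(1)] by blast
  have "edge j (\<phi> g (\<phi> h x)) (\<phi> g (\<phi> h y))"
    using xy(2) composition_rule edgeD(1,3)[OF xy(1)] g by simp
  then show ?thesis using that[of l] xy(1) l unfolding directions_def by blast
qed

lemma directions_inv:
  assumes g: "g \<in> carrier G" and ij: "(i, j) \<in> directions (inv g)"
  shows "(j, i) \<in> directions g"
proof -
  obtain x y where xy: "edge i x y" "edge j (\<phi> (inv g) x) (\<phi> (inv g) y)"
    using ij unfolding directions_def by blast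
  then have "edge i (\<phi> g (\<phi> (inv g) x)) (\<phi> g (\<phi> (inv g) y))"
    using edgeD(1,3)[OF xy(1)] g by simp
  then show ?thesis using xy(2) unfolding directions_def by blast
qed

definition preserver :: "'g set" where
  "preserver = {g \<in> carrier G. directions g \<subseteq> Id}"

lemma preserver_subgroup: "subgroup preserver G"
proof
  show "preserver \<subseteq> carrier G" by (auto simp: preserver_def)
  have "\<phi> \<one> x = x" if "x \<in> PV" for x using id_eq_one that by (metis restrict_apply')
  then have "directions \<one> \<subseteq> Id"
    unfolding directions_def using edgeD(1,3) edge_unique by fastforce
  then show "\<one> \<in> preserver" by (simp add: preserver_def)
  show "g \<otimes> h \<in> preserver" if "g \<in> preserver" "h \<in> preserver" for g h
  proof -
    have G: "g \<in> carrier G" "h \<in> carrier G" using that by (auto simp: preserver_def)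
    have "i = j" if "(i, j) \<in> directions (g \<otimes> h)" for i j
      using directions_mult[OF G that] \<open>g \<in> preserver\<close> \<open>h \<in> preserver\<close> by (auto simp: preserver_def)
    then show ?thesis using G by (auto simp: preserver_def)
  qed
  show "inv g \<in> preserver" if "g \<in> preserver" for g
    using that directions_inv[of g] by (auto simp: preserver_def)
qed

lemma preserver_finite_index: "finite_index preserver G"
proof (rule finite_index_refine[OF finite_index_carrier preserver_subgroup, where c = directions])
  show "preserver \<subseteq> carrier G" by (auto simp: preserver_def)
  have "directions ` carrier G \<subseteq> Pow ({..<k} \<times> {..<k})"
    unfolding directions_def using edgeD(2) by auto
  then show "finite (directions ` carrier G)" by (rule finite_subset) simp
  fix x y assume xy: "x \<in> carrier G" "y \<in> carrier G" and eq: "directions x = directions y"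
  have "i = j" if ij: "(i, j) \<in> directions (x \<otimes> inv y)" for i j
  proof -
    obtain l where "(i, l) \<in> directions (inv y)" "(l, j) \<in> directions x"
      using directions_mult[OF xy(1) inv_closed[OF xy(2)] ij] by blast
    then show ?thesis using directions_inv[OF xy(2)] directions_single[OF xy(1)] eq by blast
  qed
  then show "x \<otimes> inv y \<in> preserver" using xy by (auto simp: preserver_def)
qed

lemma preserver_edge:
  assumes "h \<in> preserver" "edge i x y"
  shows "edge i (\<phi> h x) (\<phi> h y)"
proof -
  obtain j where "edge j (\<phi> h x) (\<phi> h y)"
    using edge_image[OF _ assms(2), of h] assms(1) by (auto simp: preserver_def)
  then show ?thesis using assms by (auto simp: preserver_def directions_def)
qed

lemma preserver_coordinate:
  assumes h: "h \<in> preserver" and x: "x \<in> PV" and y: "y \<in> PV" and i: "i < k" "x i = y i"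
  shows "\<phi> h x i = \<phi> h y i"
proof (rule product_connected[of x y "- {i}" "\<lambda>u. \<phi> h x i = \<phi> h u i"])
  show "x j = y j" if "j < k" "j \<notin> - {i}" for j using that i by simp
  show "\<phi> h x i = \<phi> h v i" if "l \<in> - {i}" "\<phi> h x i = \<phi> h u i" "edge l u v" for l u v
    using edgeD(6)[OF preserver_edge[OF h that(3)], of i] that by simp
qed (use x y in simp_all)

lemma preserver_factor_actions: "\<exists>\<psi>. factor_actions G preserver k T \<phi> \<psi>"
proof -
  obtain x0 where x0: "x0 \<in> PV" using PV_nonempty by blast
  \<comment> \<open>The other coordinates come from an arbitrary vertex; by
    \<open>preserver_coordinate\<close> they do not matter. \<open>Bij\<close> demands the
    restriction to the vertices.\<close>
  define \<psi> where "\<psi> i h = (\<lambda>t\<in>verts (T i). \<phi> h (x0(i := t)) i)" for i h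
  have PG: "h \<in> carrier G" if "h \<in> preserver" for h using that by (simp add: preserver_def)
  interpret P: subgroup preserver G by (rule preserver_subgroup)
  have coord: "\<phi> h x i = \<psi> i h (x i)" if "h \<in> preserver" "x \<in> PV" "i < k" for h x i
    using preserver_coordinate[OF that(1,2) PV_upd[OF x0 that(3) PV_verts[OF that(2,3)]] that(3)]
      PV_verts[OF that(2,3)] by (simp add: \<psi>_def)
  have point: "\<exists>x\<in>PV. x i = t" if "i < k" "t \<in> verts (T i)" for i t
    using PV_upd[OF x0 that] by (intro bexI[of _ "x0(i := t)"]) auto
  have closed: "\<psi> i h t \<in> verts (T i)" if "h \<in> preserver" "i < k" "t \<in> verts (T i)" for i h t
    using point[OF that(2,3)] coord[OF that(1) _ that(2)] PV_verts[OF act_in[OF PG[OF that(1)]] that(2)]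
    by metis
  have mult: "\<psi> i (g \<otimes> h) t = \<psi> i g (\<psi> i h t)"
    if gh: "g \<in> preserver" "h \<in> preserver" and t: "i < k" "t \<in> verts (T i)" for i g h t
  proof -
    obtain x where x: "x \<in> PV" "x i = t" using point[OF t] by blast
    then show ?thesis
      using coord[OF P.m_closed[OF gh] x(1) t(1)] coord[OF gh(2) x(1) t(1)]
        coord[OF gh(1) act_in[OF PG[OF gh(2)] x(1)] t(1)]
        composition_rule[OF x(1) PG[OF gh(1)] PG[OF gh(2)]] by simp
  qed
  have one: "\<psi> i \<one> t = t" if t: "i < k" "t \<in> verts (T i)" for i t
  proof -
    obtain x where x: "x \<in> PV" "x i = t" using point[OF t] by blast
    have "\<phi> \<one> x = x" using id_eq_one x(1) by (metis restrict_apply')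
    then show ?thesis using coord[OF P.one_closed x(1) t(1)] x by simp
  qed
  have inv: "\<psi> i (inv h) (\<psi> i h t) = t" "\<psi> i h (\<psi> i (inv h) t) = t"
    if "h \<in> preserver" "i < k" "t \<in> verts (T i)" for i h t
    using mult[of "inv h" h i t] mult[of h "inv h" i t] one that PG by simp_all
  have bij: "bij_betw (\<psi> i h) (verts (T i)) (verts (T i))" if "h \<in> preserver" "i < k" for i h
    by (rule bij_betw_byWitness[where f' = "\<psi> i (inv h)"]) (use inv closed that in auto)
  have "group_action (G\<lparr>carrier := preserver\<rparr>) (verts (T i)) (\<psi> i)" if i: "i < k" for i
  proof -
    have "\<psi> i \<in> hom (G\<lparr>carrier := preserver\<rparr>) (BijGroup (verts (T i)))"
    proof (rule homI)
      fix g h assume gh: "g \<in> carrier (G\<lparr>carrier := preserver\<rparr>)" "h \<in> carrier (G\<lparr>carrier := preserver\<rparr>)"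
      have B: "\<psi> i g \<in> Bij (verts (T i))" "\<psi> i h \<in> Bij (verts (T i))"
        using bij i gh by (auto simp: Bij_def \<psi>_def)
      then show "\<psi> i g \<in> carrier (BijGroup (verts (T i)))" by (simp add: BijGroup_def)
      have "\<psi> i (g \<otimes> h) = compose (verts (T i)) (\<psi> i g) (\<psi> i h)"
      proof
        fix t show "\<psi> i (g \<otimes> h) t = compose (verts (T i)) (\<psi> i g) (\<psi> i h) t"
          using mult[of g h i t] gh i by (cases "t \<in> verts (T i)") (auto simp: compose_def \<psi>_def)
      qed
      then show "\<psi> i (g \<otimes>\<^bsub>G\<lparr>carrier := preserver\<rparr>\<^esub> h) = \<psi> i g \<otimes>\<^bsub>BijGroup (verts (T i))\<^esub> \<psi> i h"
        using B by (simp add: BijGroup_def)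
    qed
    then show ?thesis
      using subgroup_imp_group[OF preserver_subgroup] group_BijGroup
      by (simp add: group_action_def group_hom_def group_hom_axioms_def)
  qed
  moreover have "graph_automorphism (T i) (\<psi> i h)" if h: "h \<in> preserver" and i: "i < k" for i h
  proof -
    have adj: "adj (T i) (\<psi> i h u) (\<psi> i h v)" if h: "h \<in> preserver" and uv: "adj (T i) u v" for h u v
    proof -
      obtain x where x: "x \<in> PV" "x i = u" using point[OF i] adjD[OF i uv] by blast
      have e: "edge i x (x(i := v))" using edge_upd[OF x(1) i] x uv by simp
      show ?thesis
        using edgeD(5)[OF preserver_edge[OF h e]] coord[OF h x(1) i] coord[OF h edgeD(3)[OF e] i] x by simp
    qed
    have "adj (T i) u v" if "u \<in> verts (T i)" "v \<in> verts (T i)" "adj (T i) (\<psi> i h u) (\<psi> i h v)" for u v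
      using adj[OF P.m_inv_closed[OF h] that(3)] inv(1)[OF h i] that by simp
    then show ?thesis unfolding graph_automorphism_def using bij[OF h i] adj[OF h] by blast
  qed
  ultimately show ?thesis unfolding factor_actions_def using coord by blast
qed

end

section \<open>Proper actions\<close>

context tree_action
begin

lemma displacement_parity:
  assumes "g \<in> carrier G" "p \<in> V" "q \<in> V"
  shows "even (d p (\<phi> g p)) \<longleftrightarrow> even (d q (\<phi> g q))"
proof -
  have V: "\<phi> g p \<in> V" "\<phi> g q \<in> V" using assms by auto
  show ?thesis
    using parity[OF assms(2) V] parity[OF assms(2,3) V(2)] isometry[OF assms] by presburger
qed

text \<open>This makes the parity of the displacement a homomorphism to the group of order two, with
  kernel \<open>even_elements\<close>.\<close>

lemma displacement_parity_mult:
  assumes "g \<in> carrier G" "h \<in> carrier G" "p \<in> V"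
  shows "even (d p (\<phi> (g \<otimes> h) p)) \<longleftrightarrow> (even (d p (\<phi> g p)) \<longleftrightarrow> even (d p (\<phi> h p)))"
  using parity[of p "\<phi> g p" "\<phi> g (\<phi> h p)"] isometry[of g p "\<phi> h p"] composition_rule assms by simp

lemma displacement_parity_inv:
  assumes "g \<in> carrier G" "p \<in> V"
  shows "d p (\<phi> (inv g) p) = d p (\<phi> g p)"
  using dist_act_left[of g p p] dist_sym[of "\<phi> g p" p] assms by simp

definition even_elements :: "'g set" where
  "even_elements = {g \<in> carrier G. \<forall>p\<in>V. even (d p (\<phi> g p))}"

lemma even_elements_iff: "p \<in> V \<Longrightarrow> even_elements = {g \<in> carrier G. even (d p (\<phi> g p))}"
  unfolding even_elements_def using displacement_parity by blast

lemma even_elements_subgroup: "subgroup even_elements G"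
proof -
  obtain p where p: "p \<in> V" using nonempty by blast
  show ?thesis
    unfolding even_elements_iff[OF p]
    by standard (use p dist_0[OF p p] in \<open>auto simp: displacement_parity_mult displacement_parity_inv\<close>)
qed

lemma even_elements_finite_index: "finite_index even_elements G"
proof -
  obtain p where p: "p \<in> V" using nonempty by blast
  show ?thesis
  proof (rule finite_index_refine[OF finite_index_carrier even_elements_subgroup,
        where c = "\<lambda>g. even (d p (\<phi> g p))"])
    show "x \<otimes> inv y \<in> even_elements" if "x \<in> carrier G" "y \<in> carrier G"
      "even (d p (\<phi> x p)) = even (d p (\<phi> y p))" for x y
      using that p unfolding even_elements_iff[OF p]
      by (simp add: displacement_parity_mult displacement_parity_inv)
  qed (auto simp: even_elements_def)
qed

end

lemma (in graph_tree_action) not_general_type_virtually_fixes_end: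
  assumes even: "\<And>g p. \<lbrakk>g \<in> carrier G; p \<in> verts T\<rbrakk> \<Longrightarrow> even (gdist T p (\<psi> g p))"
    and no: "\<not> general_type G T \<psi>"
  shows "\<exists>H. \<exists>\<beta> :: 'g \<Rightarrow> int. subgroup H G \<and>
     (\<forall>x\<in>carrier G. \<forall>y\<in>carrier G. x \<notin> H \<longrightarrow> y \<notin> H \<longrightarrow> x \<otimes> inv y \<in> H) \<and>
     (\<forall>g\<in>H. \<forall>h\<in>H. \<beta> (g \<otimes> h) = \<beta> g + \<beta> h) \<and>
     (\<forall>h\<in>H. \<beta> h = 0 \<longrightarrow> (\<exists>v\<in>verts T. \<psi> h v = v))"
proof (rule virtually_fixes_end)
  show "share_end g p h q" if "axis g p t" "axis h q s" for g p t h q s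
    using no that unfolding general_type_iff by blast
qed (rule even)

lemma group_action_restrict:
  assumes "group_action (G\<lparr>carrier := H\<rparr>) E \<psi>" "group G" "subgroup H' G" "H' \<subseteq> H"
  shows "group_action (G\<lparr>carrier := H'\<rparr>) E \<psi>"
  using assms group.subgroup_imp_group[OF assms(2,3)]
  unfolding group_action_def group_hom_def group_hom_axioms_def hom_def by auto

lemma factor_actions_restrict:
  assumes "factor_actions G H k T \<phi> \<psi>" "group G" "subgroup H' G" "H' \<subseteq> H"
  shows "factor_actions G H' k T \<phi> \<psi>"
  using assms group_action_restrict[OF _ assms(2-4)] unfolding factor_actions_def by blast

lemma factor_actions_graph_tree_action:
  assumes "factor_actions G H k T \<phi> \<psi>" "i < k" "tree (T i)"
  shows "graph_tree_action (T i) (G\<lparr>carrier := H\<rparr>) (\<psi> i)"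
  using assms unfolding factor_actions_def graph_tree_action_def graph_tree_action_axioms_def graph_tree_def
  by simp

lemma contains_F2_supergroup:
  assumes "group G" "subgroup H G" "contains_F2 (G\<lparr>carrier := H\<rparr>)"
  shows "contains_F2 G"
  using assms group.incl_subgroup[OF assms(1,2)] unfolding contains_F2_def by auto

section \<open>Assembling the factors\<close>

context tree_product_action
begin

lemma stabilizer_finite:
  assumes proper: "topologically_proper G k T \<phi>" and x: "x \<in> PV"
  shows "finite {g \<in> carrier G. \<phi> g x = x}"
proof -
  \<comment> \<open>The vertex \<open>x\<close> in barycentric coordinates; properness is applied to
    the compact set consisting of this point.\<close>
  define p where "p = (\<lambda>i\<in>{..<k}. \<lambda>u. if u = x i then 1 else 0 :: real)"
  have supp: "{w. p i w \<noteq> 0} = {x i}" if "i < k" for i using that by (auto simp: p_def)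
  have "p i \<in> tree_points (T i)" if "i < k" for i
    using that supp[OF that] PV_verts[OF x that] unfolding tree_points_def tree_cells_def
    by (auto simp: p_def)
  then have "{p} \<subseteq> prod_points k T" by (auto simp: prod_points_def PiE_iff extensional_def p_def)
  moreover have "compact {p}" by simp
  ultimately have fin: "finite {g \<in> carrier G. realise k (\<phi> g) ` {p} \<inter> {p} \<noteq> {}}"
    using proper unfolding topologically_proper_def by blast
  have PiE: "(\<Pi>\<^sub>E i\<in>{..<k}. {w. p i w \<noteq> 0}) = {x}"
  proof -
    have "(\<Pi>\<^sub>E i\<in>{..<k}. {w. p i w \<noteq> 0}) = (\<Pi>\<^sub>E i\<in>{..<k}. {x i})" by (rule PiE_cong) (simp add: supp)
    also have "\<dots> = {x}" using x by (intro PiE_singleton) (simp add: prod_verts_def PiE_def)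
    finally show ?thesis .
  qed
  have "realise k f p = p" if "f x = x" for f
  proof -
    have "(\<Sum>v | v \<in> (\<Pi>\<^sub>E i\<in>{..<k}. {w. p i w \<noteq> 0}) \<and> f v j = u. \<Prod>i<k. p i (v i)) = p j u"
      if "j < k" for j u
    proof -
      have set: "{v. v \<in> (\<Pi>\<^sub>E i\<in>{..<k}. {w. p i w \<noteq> 0}) \<and> f v j = u} = (if x j = u then {x} else {})"
        unfolding PiE using \<open>f x = x\<close> by auto
      show ?thesis unfolding set using that by (auto simp: p_def)
    qed
    then show ?thesis unfolding realise_def by (auto simp: fun_eq_iff p_def)
  qed
  then have "{g \<in> carrier G. \<phi> g x = x} \<subseteq> {g \<in> carrier G. realise k (\<phi> g) ` {p} \<inter> {p} \<noteq> {}}" by auto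
  then show ?thesis using fin finite_subset by blast
qed

lemma general_type_contains_F2:
  assumes "virtually_general_type_on_factor G k T \<phi>"
  shows "contains_F2 G"
proof -
  obtain H \<psi> i where H: "finite_index H G" "factor_actions G H k T \<phi> \<psi>" "i < k"
    "general_type (G\<lparr>carrier := H\<rparr>) (T i) (\<psi> i)"
    using assms unfolding virtually_general_type_on_factor_def by blast
  interpret A: graph_tree_action "T i" "G\<lparr>carrier := H\<rparr>" "\<psi> i"
    using factor_actions_graph_tree_action[OF H(2,3) trees[OF H(3)]] .
  show ?thesis
    using contains_F2_supergroup[OF is_group _ A.general_type_contains_F2[OF H(4)]] H(1)
    by (simp add: finite_index_def)
qed

lemma factor_int_hom:
  assumes no: "\<not> virtually_general_type_on_factor G k T \<phi>"
    and H: "finite_index H G" "factor_actions G H k T \<phi> \<psi>" and i: "i < k"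
  shows "\<exists>L. \<exists>\<beta> :: 'g \<Rightarrow> int. finite_index L G \<and> L \<subseteq> H \<and>
    (\<forall>g\<in>L. \<forall>h\<in>L. \<beta> (g \<otimes> h) = \<beta> g + \<beta> h) \<and> (\<forall>h\<in>L. \<beta> h = 0 \<longrightarrow> (\<exists>v\<in>verts (T i). \<psi> i h v = v))"
proof -
  have sH: "subgroup H G" using H(1) by (simp add: finite_index_def)
  interpret A: graph_tree_action "T i" "G\<lparr>carrier := H\<rparr>" "\<psi> i"
    using factor_actions_graph_tree_action[OF H(2) i trees[OF i]] .
  define E where "E = A.even_elements"
  have EH: "E \<subseteq> H" by (auto simp: E_def A.even_elements_def)
  have E: "finite_index E G"
    unfolding E_def using finite_index_trans[OF H(1) A.even_elements_finite_index] .
  then have sE: "subgroup E G" by (simp add: finite_index_def)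
  have fE: "factor_actions G E k T \<phi> \<psi>" using factor_actions_restrict[OF H(2) is_group sE EH] .
  interpret B: graph_tree_action "T i" "G\<lparr>carrier := E\<rparr>" "\<psi> i"
    using factor_actions_graph_tree_action[OF fE i trees[OF i]] .
  have even: "even (gdist (T i) p (\<psi> i g p))" if "g \<in> carrier (G\<lparr>carrier := E\<rparr>)" "p \<in> verts (T i)" for g p
    using that by (simp add: E_def A.even_elements_def)
  \<comment> \<open>The hypothesis concerns every subgroup of finite index that acts on the factors,
    so it also excludes general type for \<open>E\<close>.\<close>
  have "\<not> general_type (G\<lparr>carrier := E\<rparr>) (T i) (\<psi> i)"
    using no E fE i unfolding virtually_general_type_on_factor_def by blast
  then obtain L and \<beta> :: "'g \<Rightarrow> int" where L: "subgroup L (G\<lparr>carrier := E\<rparr>)"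
    and index: "\<forall>x\<in>E. \<forall>y\<in>E. x \<notin> L \<longrightarrow> y \<notin> L \<longrightarrow> x \<otimes> inv\<^bsub>G\<lparr>carrier := E\<rparr>\<^esub> y \<in> L"
    and \<beta>: "\<forall>g\<in>L. \<forall>h\<in>L. \<beta> (g \<otimes> h) = \<beta> g + \<beta> h" "\<forall>h\<in>L. \<beta> h = 0 \<longrightarrow> (\<exists>v\<in>verts (T i). \<psi> i h v = v)"
    using B.not_general_type_virtually_fixes_end[OF even] by auto
  have "finite_index L (G\<lparr>carrier := E\<rparr>)"
  proof (rule B.finite_index_refine[OF B.finite_index_carrier L, where c = "\<lambda>x. x \<in> L"])
    show "L \<subseteq> carrier (G\<lparr>carrier := E\<rparr>)" using subgroup.subset[OF L] .
    fix x y assume xy: "x \<in> carrier (G\<lparr>carrier := E\<rparr>)" "y \<in> carrier (G\<lparr>carrier := E\<rparr>)"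
      and eq: "(x \<in> L) = (y \<in> L)"
    show "x \<otimes>\<^bsub>G\<lparr>carrier := E\<rparr>\<^esub> inv\<^bsub>G\<lparr>carrier := E\<rparr>\<^esub> y \<in> L"
      using index xy eq subgroup.m_closed[OF L] subgroup.m_inv_closed[OF L] by (cases "x \<in> L") auto
  qed simp
  then have "finite_index L G" using finite_index_trans[OF E] by blast
  moreover have "L \<subseteq> H" using subgroup.subset[OF L] EH by auto
  ultimately show ?thesis using \<beta> by blast
qed

text \<open>Common fixed vertices of finitely many kernel elements in the single factors form a
  vertex of the product, whose stabiliser is finite. The bound on \<open>n\<close> comes from having
  one homomorphism for each factor.\<close>

lemma locally_finite_by_Z_pow:
  assumes proper: "topologically_proper G k T \<phi>"
    and no: "\<not> virtually_general_type_on_factor G k T \<phi>"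
  shows "\<exists>L n. \<exists>\<theta> :: nat \<Rightarrow> 'g \<Rightarrow> int. finite_index L G \<and> n \<le> k \<and>
    (\<forall>i<n. \<theta> i \<in> hom (G\<lparr>carrier := L\<rparr>) integer_group) \<and>
    (\<forall>z. \<exists>x\<in>L. \<forall>i<n. \<theta> i x = z i) \<and> locally_finite {x \<in> L. \<forall>i<n. \<theta> i x = 0} G"
proof -
  obtain \<psi> where \<psi>: "factor_actions G preserver k T \<phi> \<psi>" using preserver_factor_actions by blast
  have "\<forall>i. \<exists>L. \<exists>\<beta> :: 'g \<Rightarrow> int. i < k \<longrightarrow> finite_index L G \<and> L \<subseteq> preserver \<and>
    (\<forall>g\<in>L. \<forall>h\<in>L. \<beta> (g \<otimes> h) = \<beta> g + \<beta> h) \<and> (\<forall>h\<in>L. \<beta> h = 0 \<longrightarrow> (\<exists>v\<in>verts (T i). \<psi> i h v = v))"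
    using factor_int_hom[OF no preserver_finite_index \<psi>] by blast
  then obtain L and \<beta> :: "nat \<Rightarrow> 'g \<Rightarrow> int" where L: "\<And>i. i < k \<Longrightarrow> finite_index (L i) G"
    and \<beta>: "\<And>i g h. \<lbrakk>i < k; g \<in> L i; h \<in> L i\<rbrakk> \<Longrightarrow> \<beta> i (g \<otimes> h) = \<beta> i g + \<beta> i h"
    and ell: "\<And>i h. \<lbrakk>i < k; h \<in> L i; \<beta> i h = 0\<rbrakk> \<Longrightarrow> \<exists>v\<in>verts (T i). \<psi> i h v = v" by metis
  define M where "M = preserver \<inter> {x. \<forall>i<k. x \<in> L i}"
  have M_fin: "finite_index M G"
  proof -
    have "finite_index (preserver \<inter> {x. \<forall>i<m. x \<in> L i}) G" if "m \<le> k" for m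
      using that
    proof (induction m)
      case (Suc m)
      have "preserver \<inter> {x. \<forall>i<Suc m. x \<in> L i} = (preserver \<inter> {x. \<forall>i<m. x \<in> L i}) \<inter> L m"
        by (auto simp: less_Suc_eq)
      then show ?case using finite_index_Int[OF Suc.IH L] Suc.prems by simp
    qed (simp add: preserver_finite_index)
    then show ?thesis by (simp add: M_def)
  qed
  then have sM: "subgroup M G" by (simp add: finite_index_def)
  interpret M: group "G\<lparr>carrier := M\<rparr>" using subgroup_imp_group[OF sM] .
  have M_act: "factor_actions G M k T \<phi> \<psi>"
    by (rule factor_actions_restrict[OF \<psi> is_group sM]) (auto simp: M_def)
  have hom: "\<beta> i \<in> hom (G\<lparr>carrier := M\<rparr>) integer_group" if "i < k" for i
    by (rule M.int_homI) (use \<beta>[OF that] that in \<open>simp add: M_def\<close>)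
  obtain n and \<theta> :: "nat \<Rightarrow> 'g \<Rightarrow> int" where n: "n \<le> k"
    and \<theta>: "\<And>i. i < n \<Longrightarrow> \<theta> i \<in> hom (G\<lparr>carrier := M\<rparr>) integer_group"
    and surj: "\<forall>z. \<exists>x\<in>M. \<forall>i<n. \<theta> i x = z i"
    and ker: "\<forall>x\<in>M. (\<forall>i<n. \<theta> i x = 0) \<longleftrightarrow> (\<forall>i<k. \<beta> i x = 0)"
    using M.independent_int_homs[of k \<beta>, OF hom] by auto
  let ?K = "{x \<in> M. \<forall>i<n. \<theta> i x = 0}"
  have sK: "subgroup ?K (G\<lparr>carrier := M\<rparr>)"
    using M.int_homs_kernel(1)[of n \<theta>, OF \<theta>] surj by (simp add: normal_def)
  have "finite (generate G S)" if S: "S \<subseteq> ?K" "finite S" for S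
  proof -
    have "\<exists>v\<in>verts (T i). \<forall>s\<in>S. \<psi> i s v = v" if i: "i < k" for i
    proof -
      interpret A: graph_tree_action "T i" "G\<lparr>carrier := M\<rparr>" "\<psi> i"
        using factor_actions_graph_tree_action[OF M_act i trees[OF i]] .
      have "\<exists>v\<in>verts (T i). \<psi> i h v = v" if "h \<in> ?K" for h
        using ell[OF i] that ker i by (auto simp: M_def)
      then show ?thesis using A.common_fixed_vertex[OF sK _ S] by blast
    qed
    then obtain v where v: "\<And>i. i < k \<Longrightarrow> v i \<in> verts (T i)"
      "\<And>i s. \<lbrakk>i < k; s \<in> S\<rbrakk> \<Longrightarrow> \<psi> i s (v i) = v i" by metis
    define x where "x = restrict v {..<k}"
    have x: "x \<in> PV" using v(1) by (simp add: x_def prod_verts_def)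
    have SG: "s \<in> carrier G" if "s \<in> S" for s using that S(1) subgroup.mem_carrier[OF sM] by blast
    have "\<phi> s x = x" if s: "s \<in> S" for s
    proof -
      have "\<phi> s x \<in> PV" using SG[OF s] x by simp
      moreover have "\<phi> s x i = x i" if "i < k" for i
        using M_act S(1) s x v(2)[OF that s] that unfolding factor_actions_def by (auto simp: x_def)
      ultimately show ?thesis using x unfolding prod_verts_def by (metis PiE_ext lessThan_iff)
    qed
    then have "S \<subseteq> stabilizer G \<phi> x" using SG by (auto simp: stabilizer_def)
    then have "generate G S \<subseteq> stabilizer G \<phi> x"
      using generate_subgroup_incl stabilizer_subgroup[OF x] by blast
    moreover have "finite (stabilizer G \<phi> x)"
      using stabilizer_finite[OF proper x] by (simp add: stabilizer_def)
    ultimately show ?thesis using finite_subset by blast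
  qed
  then have "locally_finite ?K G" unfolding locally_finite_def by blast
  then show ?thesis using M_fin n \<theta> surj by blast
qed

text \<open>The locally finite kernel is normal in a subgroup of finite index, so its normaliser has
  finite index and \<open>none\<close> makes it finite. Then \<open>finite_by_Z_pow\<close>
  applies.\<close>

lemma infinite_locally_finite_or_virtually_Z_pow:
  assumes proper: "topologically_proper G k T \<phi>"
    and no: "\<not> virtually_general_type_on_factor G k T \<phi>"
    and none: "\<nexists>L. subgroup L G \<and> infinite L \<and> locally_finite L G \<and> finite_index (normalizer G L) G"
  shows "\<exists>A n. finite_index A G \<and> G\<lparr>carrier := A\<rparr> \<cong> Z_pow n"
proof -
  obtain L n and \<theta> :: "nat \<Rightarrow> 'g \<Rightarrow> int" where L: "finite_index L G"
    and \<theta>: "\<And>i. i < n \<Longrightarrow> \<theta> i \<in> hom (G\<lparr>carrier := L\<rparr>) integer_group"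
    and surj: "\<And>z. \<exists>x\<in>L. \<forall>i<n. \<theta> i x = z i"
    and fin: "locally_finite {x \<in> L. \<forall>i<n. \<theta> i x = 0} G"
    using locally_finite_by_Z_pow[OF proper no] by blast
  let ?K = "{x \<in> L. \<forall>i<n. \<theta> i x = 0}"
  have sL: "subgroup L G" using L by (simp add: finite_index_def)
  interpret L: group "G\<lparr>carrier := L\<rparr>" using subgroup_imp_group[OF sL] .
  have normal: "?K \<lhd> G\<lparr>carrier := L\<rparr>" using L.int_homs_kernel(1)[of n \<theta>, OF \<theta>] surj by simp
  have sK: "subgroup ?K G" using incl_subgroup[OF sL] normal by (simp add: normal_def)
  have "L \<subseteq> normalizer G ?K"
  proof
    fix l assume l: "l \<in> L"
    have conj: "g \<otimes> x \<otimes> inv g \<in> ?K" if "g \<in> L" "x \<in> ?K" for g x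
      using normal.inv_op_closed2[OF normal, of g x] that m_inv_consistent[OF sL] by simp
    have G: "l \<in> carrier G" "inv l \<in> L" "?K \<subseteq> carrier G"
      using l subgroup.mem_carrier[OF sL] subgroup.m_inv_closed[OF sL] by auto
    have "l <# ?K #> inv l = ?K"
    proof
      show "l <# ?K #> inv l \<subseteq> ?K" using conj[OF l] unfolding l_coset_def r_coset_def by blast
      show "?K \<subseteq> l <# ?K #> inv l"
      proof
        fix x assume x: "x \<in> ?K"
        then have xG: "x \<in> carrier G" using G(3) by blast
        have "inv l \<otimes> x \<otimes> l \<in> ?K" using conj[OF G(2) x] G by simp
        moreover have "x = l \<otimes> (inv l \<otimes> x \<otimes> l) \<otimes> inv l"
          using G xG by (simp add: m_assoc[symmetric]) (simp add: m_assoc)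
        ultimately show "x \<in> l <# ?K #> inv l" unfolding l_coset_def r_coset_def by blast
      qed
    qed
    then show "l \<in> normalizer G ?K" using G by (simp add: normalizer_def stabilizer_def)
  qed
  then have "finite_index (normalizer G ?K) G"
    using finite_index_mono[OF L] normalizer_imp_subgroup subgroup.subset[OF sK] by blast
  then have "finite ?K" using none sK fin by blast
  then obtain A where A: "finite_index A (G\<lparr>carrier := L\<rparr>)" "G\<lparr>carrier := A\<rparr> \<cong> Z_pow n"
    using L.finite_by_Z_pow[of n \<theta>, OF \<theta>] surj by auto
  then show ?thesis using finite_index_trans[OF L] by blast
qed

end

theorem theorem10p1:
  fixes G :: "('g, 'm) monoid_scheme"
    and k :: nat
    and T :: "nat \<Rightarrow> 'v sgraph"
    and \<phi> :: "'g \<Rightarrow> (nat \<Rightarrow> 'v) \<Rightarrow> nat \<Rightarrow> 'v"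
  assumes "\<And>i. i < k \<Longrightarrow> tree (T i)"
    and "group_action G (prod_verts k T) \<phi>"
    and "\<And>g. g \<in> carrier G \<Longrightarrow> cube_automorphism k T (\<phi> g)"
    and "topologically_proper G k T \<phi>"
  shows
    "(virtually_general_type_on_factor G k T \<phi> \<or>
      (\<exists>H K n. finite_index H G \<and> K \<lhd> G\<lparr>carrier := H\<rparr> \<and> locally_finite K G \<and>
         n \<le> k \<and> (G\<lparr>carrier := H\<rparr>) Mod K \<cong> Z_pow n)) \<and>
     (virtually_general_type_on_factor G k T \<phi> \<longrightarrow> contains_F2 G) \<and>
     ((\<nexists>L. subgroup L G \<and> infinite L \<and> locally_finite L G) \<longrightarrow>
        contains_F2 G \<or> (\<exists>A n. finite_index A G \<and> G\<lparr>carrier := A\<rparr> \<cong> Z_pow n)) \<and>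
     ((\<nexists>L. subgroup L G \<and> infinite L \<and> locally_finite L G \<and>
           finite_index (normalizer G L) G) \<longrightarrow>
        contains_F2 G \<or> (\<exists>A n. finite_index A G \<and> G\<lparr>carrier := A\<rparr> \<cong> Z_pow n))"
proof -
  interpret tree_product_action G k T \<phi>
    using assms(1-3) by (simp add: tree_product_action_def tree_product_action_axioms_def)
  have quotient: "\<exists>H K n. finite_index H G \<and> K \<lhd> G\<lparr>carrier := H\<rparr> \<and> locally_finite K G \<and>
      n \<le> k \<and> (G\<lparr>carrier := H\<rparr>) Mod K \<cong> Z_pow n"
    if no: "\<not> virtually_general_type_on_factor G k T \<phi>"
  proof -
    obtain L n and \<theta> :: "nat \<Rightarrow> 'g \<Rightarrow> int" where L: "finite_index L G" and n: "n \<le> k"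
      and \<theta>: "\<And>i. i < n \<Longrightarrow> \<theta> i \<in> hom (G\<lparr>carrier := L\<rparr>) integer_group"
      and surj: "\<And>z. \<exists>x\<in>L. \<forall>i<n. \<theta> i x = z i"
      and fin: "locally_finite {x \<in> L. \<forall>i<n. \<theta> i x = 0} G"
      using locally_finite_by_Z_pow[OF assms(4) no] by blast
    interpret L: group "G\<lparr>carrier := L\<rparr>"
      using subgroup_imp_group L by (simp add: finite_index_def)
    have "{x \<in> L. \<forall>i<n. \<theta> i x = 0} \<lhd> G\<lparr>carrier := L\<rparr>"
      "(G\<lparr>carrier := L\<rparr>) Mod {x \<in> L. \<forall>i<n. \<theta> i x = 0} \<cong> Z_pow n"
      using L.int_homs_kernel[of n \<theta>, OF \<theta>] surj by simp_all
    then show ?thesis using L n fin by blast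
  qed
  then show ?thesis
    using general_type_contains_F2 infinite_locally_finite_or_virtually_Z_pow[OF assms(4)] by blast
qed

end
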